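(* Let $P$, $w$, $\theta_p,\theta_w$, $\mathcal{F}$, $U,V,W$ be as in the context and suppose $\theta_w+\theta_p=1$ (i.e. $\theta_w=1$, $\theta_p=0$). Then $$\inf_{e\in\mathcal{F}}\|e\|_\infty=\max_{e^*\in U\oplus V\oplus W,\ \|e^*\|_1\le1}\langle\operatorname{Proj}_U(e^* ),w\rangle,$$ $$\inf_{e\in\mathcal{F}}\ \sup_{t}(e(t))_+=\max_{e^*\in U\oplus V\oplus W,\ e^*\ge0,\ \|e^*\|_1\le1}\langle\operatorname{Proj}_U(e^* ),w\rangle,$$ $$\inf_{e\in\mathcal{F}}\ \sup_{t}(-e(t))_+=\max_{e^*\in U\oplus V\oplus W,\ e^*\le0,\ \|e^*\|_1\le1}\langle\operatorname{Proj}_U(e^* ),w\rangle,$$ $$\inf_{e\in\mathcal{F}}\ \tfrac12\big[\sup_te(t)-\inf_te(t)\big]=\max_{e^*\in U\oplus V\oplus W,\ \int_{\mathbb{R}_+}e^*_+\le\frac12,\ \int_{\mathbb{R}_+}e^*_-\ge-\frac12}\langle\operatorname{Proj}_U(e^* ),w\rangle,$$ and, if moreover $w(t)\ge0$ for all $t\ge 0$, $$\inf_{e\in\mathcal{F}}\ \sup_{t}(e(t)-w(t))_+=\max_{e^*\in U\oplus V\oplus W,\ e^*\le0,\ \|e^*\|_1\le1}\langle\operatorname{Proj}_{V\oplus W}(e^* ),w\rangle.$$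
   Context: $\mathbb{R}_+=[0,\infty)$; $\hat g$ denotes the Laplace transform of $g$; $\lambda_+=\max(\lambda,0)$ and $\lambda_-=\min(\lambda,0)$ for real $\lambda$ (so $\lambda_-\le 0$). $C_0(\mathbb{R}_+)$ is the space of continuous $\varphi:\mathbb{R}_+\to\mathbb{R}$ with $\lim_{t\to\infty}\varphi(t)=0$, with the supremum norm. $\mathcal{S}$ is the set of proper real-rational functions with no poles in the closed right half-plane. Plant: $P$ is a proper real-rational function with a zero of order $\theta_p\ge 0$ at infinity (denominator degree minus numerator degree equals $\theta_p$). Reference input: $w:\mathbb{R}_+\to\mathbb{R}$ is an ordinary function (no delta terms) with rational Laplace transform $\hat w$ having a zero of order exactly $\theta_w\ge1$ at infinity. $P$ has poles $p_1,\dots,p_m$ and zeros $z_1,\dots,z_n$ in the closed right half-plane $\{\operatorname{Re}s\ge0\}$, and $\hat w$ has zeros $v_1,\dots,v_l$ there; none of these lie on the imaginary axis, and all are simple and mutually distinct. Let $P=\hat n/\hat d$ be a coprime factorization with $\hat n,\hat d\in\mathcal{S}$, and $\hat x,\hat v\in\mathcal{S}$ with $\hat x\hat n+\hat v\hat d=1$. $\mathcal{F}$ is the set of closed-loop error signals tending to zero that are achievable by rational stabilising controllers: $\mathcal{F}=\{e\in C_0(\mathbb{R}_+)\mid \hat e=\hat w\hat d(\hat v-\hat q\hat n)\text{ for some }\hat q\in\mathcal{S}\}$. From each complex-conjugate pair among the $z_i$ retain only one member; similarly for the $p_i$ and the $v_i$. $U$ is the real span of the functions $t\mapsto e^{-xt}\cos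 yt$ and $t\mapsto e^{-xt}\sin yt$ over retained $z=x+iy$ among the $z_i$; $V$ and $W$ are defined in the same way from the $p_i$ and the $v_i$. $\operatorname{Proj}_U$ and $\operatorname{Proj}_{V\oplus W}$ are the natural projectors of $U\oplus V\oplus W$ onto $U$ and onto $V\oplus W$. $\langle u,v\rangle=\int_0^\infty u(t)v(t)\,dt$, $\|\cdot\|_1$ is the $L^1(\mathbb{R}_+)$ norm, and inequalities such as $e^*\ge0$ are pointwise on $\mathbb{R}_+$.
   Formalization: It is additionally assumed that no right half-plane pole of P is a pole of the transform of w (the first equality fails for P=(s-2)/(s-1), w=e^t), that w is continuous, and that the pairings of w with U (in the last equality also with V+W) converge absolutely. *)

theory Defs
  imports
    "HOL-Analysis.Analysis"
    "HOL-Computational_Algebra.Computational_Algebra"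
    "HOL-Computational_Algebra.Field_as_Ring"
begin

(* A real-rational function is an element of the fraction field of real polynomials.
   Zeros, poles and degrees are read off from its reduced representation, whose numerator
   and denominator are viewed as complex polynomials. *)
type_synonym ratfun = "real poly fract"

definition rnum :: "ratfun \<Rightarrow> complex poly" where
  "rnum G = map_poly complex_of_real (fst (quot_of_fract G))"

definition rden :: "ratfun \<Rightarrow> complex poly" where
  "rden G = map_poly complex_of_real (snd (quot_of_fract G))"

definition reval :: "ratfun \<Rightarrow> complex \<Rightarrow> complex" where
  "reval G s = poly (rnum G) s / poly (rden G) s"

definition proper :: "ratfun \<Rightarrow> bool" where
  "proper G \<longleftrightarrow> degree (rnum G) \<le> degree (rden G)"

definition zero_order_at_infinity :: "ratfun \<Rightarrow> nat \<Rightarrow> bool" where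
  "zero_order_at_infinity G k \<longleftrightarrow> G \<noteq> 0 \<and> degree (rden G) = degree (rnum G) + k"

definition rhp_zeros :: "ratfun \<Rightarrow> complex set" where
  "rhp_zeros G = {s. Re s \<ge> 0 \<and> poly (rnum G) s = 0}"

definition rhp_poles :: "ratfun \<Rightarrow> complex set" where
  "rhp_poles G = {s. Re s \<ge> 0 \<and> poly (rden G) s = 0}"

definition stable_ratfuns :: "ratfun set" where
  "stable_ratfuns = {G. proper G \<and> rhp_poles G = {}}"

definition coprime_factorization ::
  "ratfun \<Rightarrow> ratfun \<Rightarrow> ratfun \<Rightarrow> ratfun \<Rightarrow> ratfun \<Rightarrow> bool" where
  "coprime_factorization P n d x v \<longleftrightarrow>
     {n, d, x, v} \<subseteq> stable_ratfuns \<and> d \<noteq> 0 \<and> P = n / d \<and> x * n + v * d = 1"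

(* Signals on the half-line are functions on the reals of which only the values on {0..} matter.
   The Laplace transform is the rational function G: the integral converges absolutely and
   equals G on some right half-plane. *)
definition has_laplace :: "(real \<Rightarrow> real) \<Rightarrow> ratfun \<Rightarrow> bool" where
  "has_laplace f G \<longleftrightarrow> (\<exists>\<sigma>. \<forall>s. Re s > \<sigma> \<longrightarrow>
     set_integrable lborel {0..} (\<lambda>t. exp (- (s * complex_of_real t)) * complex_of_real (f t)) \<and>
     (LINT t:{0..}|lborel. exp (- (s * complex_of_real t)) * complex_of_real (f t)) = reval G s)"

definition C0 :: "(real \<Rightarrow> real) set" where
  "C0 = {e. continuous_on {0..} e \<and> (e \<longlongrightarrow> 0) at_top}"

(* w_hat is the Laplace transform of the reference input. *)
definition error_signals :: "ratfun \<Rightarrow> ratfun \<Rightarrow> ratfun \<Rightarrow> ratfun \<Rightarrow> (real \<Rightarrow> real) set" where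
  "error_signals w_hat n d v =
     {e \<in> C0. \<exists>q \<in> stable_ratfuns. has_laplace e (w_hat * d * (v - q * n))}"

(* R keeps exactly one member of each complex-conjugate pair in Z, and all real members. *)
definition conj_representatives :: "complex set \<Rightarrow> complex set \<Rightarrow> bool" where
  "conj_representatives Z R \<longleftrightarrow>
     R \<subseteq> Z \<and> (\<forall>z \<in> Z. \<exists>!r. r \<in> R \<and> (r = z \<or> r = cnj z))"

(* The real span of exp(-xt) cos(yt) and exp(-xt) sin(yt), x + iy in the finite set Z. *)
definition exp_trig_span :: "complex set \<Rightarrow> (real \<Rightarrow> real) set" where
  "exp_trig_span Z =
     {\<lambda>t. \<Sum>z\<in>Z. a z * (exp (- Re z * t) * cos (Im z * t)) + b z * (exp (- Re z * t) * sin (Im z * t))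
      | a b :: complex \<Rightarrow> real. True}"

definition fun_sum :: "(real \<Rightarrow> real) set \<Rightarrow> (real \<Rightarrow> real) set \<Rightarrow> (real \<Rightarrow> real) set" where
  "fun_sum A B = {\<lambda>t. a t + b t | a b. a \<in> A \<and> b \<in> B}"

(* Projection onto A along B; meaningful on fun_sum A B when the sum is direct. *)
definition projector ::
  "(real \<Rightarrow> real) set \<Rightarrow> (real \<Rightarrow> real) set \<Rightarrow> (real \<Rightarrow> real) \<Rightarrow> (real \<Rightarrow> real)" where
  "projector A B f = (THE a. a \<in> A \<and> (\<exists>b \<in> B. f = (\<lambda>t. a t + b t)))"

definition pairing :: "(real \<Rightarrow> real) \<Rightarrow> (real \<Rightarrow> real) \<Rightarrow> real" where
  "pairing u v = (LINT t:{0..}|lborel. u t * v t)"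

(* The integral defining the pairing converges absolutely. *)
definition pairing_defined :: "(real \<Rightarrow> real) \<Rightarrow> (real \<Rightarrow> real) \<Rightarrow> bool" where
  "pairing_defined u v \<longleftrightarrow> set_integrable lborel {0..} (\<lambda>t. u t * v t)"

definition norm1 :: "(real \<Rightarrow> real) \<Rightarrow> real" where
  "norm1 f = (LINT t:{0..}|lborel. \<bar>f t\<bar>)"

(* m is the maximum of f over A, and it is attained. *)
definition is_maximum :: "ereal \<Rightarrow> ('a \<Rightarrow> real) \<Rightarrow> 'a set \<Rightarrow> bool" where
  "is_maximum m f A \<longleftrightarrow> (\<exists>a \<in> A. m = ereal (f a) \<and> (\<forall>b \<in> A. f b \<le> f a))"

end

theory Submission
  imports Defs "HOL-Complex_Analysis.Complex_Analysis"
begin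

text \<open>
  The theorem is finite-dimensional convex duality. Evaluating the error formula at a
  right half-plane zero of the plant, a pole of the plant or a zero of the reference shows
  that every achievable error has a prescribed Laplace transform there: the value of the
  reference transform at the plant zeros and 0 at the other points
  (\<open>error_signal_laplace\<close>). In real terms the pairings of the error with the
  finitely many modes \<open>exp (- x * t) * cos (y * t)\<close> and
  \<open>exp (- x * t) * sin (y * t)\<close> are prescribed, and for each combination of modes
  the pairing with the error equals the pairing of its projection onto the span at the plant
  zeros with the reference. Hence every dual feasible combination gives a lower bound.

  For the reverse inequality only errors of the form \<open>exp (- t) * poly p (exp (- t))\<close>
  are used. They have stable, strictly proper rational transforms, and they are uniformly dense
  in \<open>C0\<close> by the Weierstrass theorem. Because the orders at infinity add up to 1, a
  strictly proper transform is all that properness of the parameter \<open>q\<close> needs, so that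
  such a function is an achievable error as soon as it meets the interpolation conditions
  (\<open>decay_is_error_signal\<close>); here the simplicity of the zeros and poles enters, and the
  count is done with valuations. If a cost level above the dual optimum were out of reach, a
  hyperplane would separate the prescribed moments from those attained below that level
  (\<open>attain_moments\<close>). The hyperplane is a combination of modes, and by density its
  supremum over the cost ball is the gauge that is dual to the cost (\<open>decay_support\<close>);
  after rescaling, it would be a dual feasible element with too large a value
  (\<open>minimax\<close>). The dual maximum is attained because dual functions have bounded
  coefficients. The five equalities are instances of \<open>minimax\<close> for
  different costs; in the last one the reference also shifts the dual objective.
\<close>

section \<open>Valuations and values of rational functions\<close>

abbreviation cpoly :: "real poly \<Rightarrow> complex poly" where
  "cpoly \<equiv> map_poly complex_of_real"

lemma coeff_cpoly: "coeff (cpoly p) i = complex_of_real (coeff p i)"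
  by (simp add: coeff_map_poly)

lemma cpoly_mult: "cpoly (p * q) = cpoly p * cpoly q"
  by (rule poly_eqI) (simp add: coeff_cpoly coeff_mult)

lemma cpoly_add: "cpoly (p + q) = cpoly p + cpoly q"
  by (rule poly_eqI) (simp add: coeff_cpoly)

lemma cpoly_eq_0_iff [simp]: "cpoly p = 0 \<longleftrightarrow> p = 0"
  by (simp add: map_poly_eq_0_iff)

lemma degree_cpoly [simp]: "degree (cpoly p) = degree p"
  by (rule degree_map_poly) simp

lemma poly_cpoly_cnj: "poly (cpoly p) (cnj s) = cnj (poly (cpoly p) s)"
  by (induction p) (simp_all add: map_poly_pCons)

lemma coprime_cpoly_no_common_root:
  assumes "coprime p q"
  shows "\<not> (poly (cpoly p) s = 0 \<and> poly (cpoly q) s = 0)"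
proof
  assume z: "poly (cpoly p) s = 0 \<and> poly (cpoly q) s = 0"
  have "fst (bezout_coefficients p q) * p + snd (bezout_coefficients p q) * q = gcd p q"
    by (rule bezout_coefficients_fst_snd)
  hence "cpoly (fst (bezout_coefficients p q) * p + snd (bezout_coefficients p q) * q) = cpoly 1"
    using assms by (simp add: coprime_iff_gcd_eq_1)
  hence "poly (cpoly (fst (bezout_coefficients p q)) * cpoly p
      + cpoly (snd (bezout_coefficients p q)) * cpoly q) s = poly (cpoly 1) s"
    by (simp add: cpoly_add cpoly_mult)
  thus False using z by simp
qed

text \<open>Orders of vanishing at a complex point and at infinity obey the same rules. The locale
  extends such an order from polynomials to rational functions once for both; the order at
  infinity is the negated degree.\<close>
locale poly_valuation =
  fixes \<mu> :: "real poly \<Rightarrow> int"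
  assumes mu_mult: "p \<noteq> 0 \<Longrightarrow> q \<noteq> 0 \<Longrightarrow> \<mu> (p * q) = \<mu> p + \<mu> q"
    and mu_add: "p \<noteq> 0 \<Longrightarrow> q \<noteq> 0 \<Longrightarrow> p + q \<noteq> 0 \<Longrightarrow> min (\<mu> p) (\<mu> q) \<le> \<mu> (p + q)"
begin

definition val :: "ratfun \<Rightarrow> int" where
  "val G = \<mu> (fst (quot_of_fract G)) - \<mu> (snd (quot_of_fract G))"

text \<open>The zero function has infinite order, while \<open>val 0\<close> is an arbitrary integer.
  Stating lower bounds through this predicate makes sums that cancel to zero harmless.\<close>
definition val_ge :: "int \<Rightarrow> ratfun \<Rightarrow> bool" where
  "val_ge k G \<longleftrightarrow> G = 0 \<or> k \<le> val G"

lemma val_Fract: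
  assumes "a \<noteq> 0" "b \<noteq> 0"
  shows "val (Fract a b) = \<mu> a - \<mu> b"
proof -
  let ?G = "Fract a b"
  let ?n = "fst (quot_of_fract ?G)" and ?d = "snd (quot_of_fract ?G)"
  have "Fract ?n ?d = Fract a b" by simp
  hence eq: "?n * b = a * ?d" using assms by (simp add: eq_fract del: Fract_quot_of_fract)
  hence "?n \<noteq> 0" using assms by auto
  have "\<mu> ?n + \<mu> b = \<mu> (?n * b)" using assms \<open>?n \<noteq> 0\<close> by (simp add: mu_mult)
  also have "\<dots> = \<mu> a + \<mu> ?d" unfolding eq using assms by (simp add: mu_mult)
  finally show ?thesis by (simp add: val_def)
qed

lemma val_mult:
  assumes "G \<noteq> 0" "H \<noteq> 0"
  shows "val (G * H) = val G + val H"
proof (cases G, cases H)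
  fix a b c d assume G: "G = Fract a b" "b \<noteq> 0" and H: "H = Fract c d" "d \<noteq> 0"
  with assms have "a \<noteq> 0" "c \<noteq> 0" by (auto simp: rat_number_collapse eq_fract Zero_fract_def)
  thus ?thesis using G H by (simp add: val_Fract mu_mult)
qed

lemma val_1 [simp]: "val 1 = 0"
  by (simp add: val_def)

lemma val_inverse: "G \<noteq> 0 \<Longrightarrow> val (inverse G) = - val G"
  using val_mult[of G "inverse G"] by simp

lemma val_divide: "G \<noteq> 0 \<Longrightarrow> H \<noteq> 0 \<Longrightarrow> val (G / H) = val G - val H"
  by (simp add: divide_inverse val_mult val_inverse)

lemma val_ge_add:
  assumes "val_ge k G" "val_ge k H"
  shows "val_ge k (G + H)"
proof (cases "G = 0 \<or> H = 0 \<or> G + H = 0")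
  case True
  thus ?thesis using assms by (auto simp: val_ge_def)
next
  case False
  obtain a b where G: "G = Fract a b" "b \<noteq> 0" by (cases G)
  obtain c d where H: "H = Fract c d" "d \<noteq> 0" by (cases H)
  have GH: "G + H = Fract (a * d + c * b) (b * d)" using G H by simp
  from False G H GH have nz: "a \<noteq> 0" "c \<noteq> 0" "a * d + c * b \<noteq> 0"
    by (auto simp: Zero_fract_def eq_fract)
  have "k \<le> \<mu> a - \<mu> b" "k \<le> \<mu> c - \<mu> d"
    using assms False G H nz by (auto simp: val_ge_def val_Fract)
  moreover have "min (\<mu> (a * d)) (\<mu> (c * b)) \<le> \<mu> (a * d + c * b)"
    using nz G H by (intro mu_add) auto
  ultimately have "k \<le> val (G + H)"
    unfolding GH using nz G H by (simp add: val_Fract mu_mult)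
  thus ?thesis by (simp add: val_ge_def)
qed

lemma val_ge_mult: "val_ge k G \<Longrightarrow> val_ge l H \<Longrightarrow> val_ge (k + l) (G * H)"
  by (cases "G = 0 \<or> H = 0") (auto simp: val_ge_def val_mult)

lemma val_minus_1: "val (- 1) = 0"
  using val_mult[of "-1" "-1"] by simp

lemma val_ge_diff: "val_ge k G \<Longrightarrow> val_ge k H \<Longrightarrow> val_ge k (G - H)"
  using val_ge_add[of k G "- H"] val_ge_mult[of 0 "-1" k H]
  by (simp add: val_minus_1 val_ge_def[of 0 "-1"])

lemma val_ge_mono: "val_ge k G \<Longrightarrow> l \<le> k \<Longrightarrow> val_ge l G"
  by (auto simp: val_ge_def)

lemma val_ge_divide:
  "val_ge k G \<Longrightarrow> H \<noteq> 0 \<Longrightarrow> val_ge (k - val H) (G / H)"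
  by (cases "G = 0") (auto simp: val_ge_def val_divide)

end

lemma order_add_min:
  fixes p q :: "complex poly"
  assumes "p + q \<noteq> 0" "p \<noteq> 0" "q \<noteq> 0"
  shows "min (order s p) (order s q) \<le> order s (p + q)"
proof -
  let ?m = "min (order s p) (order s q)"
  have "[:-s, 1:] ^ ?m dvd p" "[:-s, 1:] ^ ?m dvd q"
    by (simp_all add: order_divides)
  hence "[:-s, 1:] ^ ?m dvd p + q" by simp
  thus ?thesis using assms by (simp add: order_divides)
qed

interpretation at_point: poly_valuation "\<lambda>p. int (order s (cpoly p))" for s
proof
  fix p q :: "real poly" assume "p \<noteq> 0" "q \<noteq> 0"
  thus "int (order s (cpoly (p * q))) = int (order s (cpoly p)) + int (order s (cpoly q))"
    unfolding cpoly_mult by (subst order_mult) auto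
next
  fix p q :: "real poly" assume "p \<noteq> 0" "q \<noteq> 0" "p + q \<noteq> 0"
  hence "min (order s (cpoly p)) (order s (cpoly q)) \<le> order s (cpoly p + cpoly q)"
    by (intro order_add_min) (auto simp flip: cpoly_add)
  thus "min (int (order s (cpoly p))) (int (order s (cpoly q))) \<le> int (order s (cpoly (p + q)))"
    by (simp add: cpoly_add)
qed

interpretation at_infinity: poly_valuation "\<lambda>p. - int (degree p)"
proof
  fix p q :: "real poly" assume "p \<noteq> 0" "q \<noteq> 0"
  thus "- int (degree (p * q)) = - int (degree p) + - int (degree q)"
    by (simp add: degree_mult_eq)
next
  fix p q :: "real poly"
  show "min (- int (degree p)) (- int (degree q)) \<le> - int (degree (p + q))"
    using degree_add_le_max[of p q] by linarith
qed

lemma rden_nonzero [simp]: "rden G \<noteq> 0"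
  by (simp add: rden_def)

lemma rnum_eq_0_iff [simp]: "rnum G = 0 \<longleftrightarrow> G = 0"
  by (simp add: rnum_def)

lemma rnum_rden_no_common_root: "\<not> (poly (rnum G) s = 0 \<and> poly (rden G) s = 0)"
  unfolding rnum_def rden_def
  by (rule coprime_cpoly_no_common_root) (rule coprime_quot_of_fract)

lemma val_at_point: "at_point.val s G = int (order s (rnum G)) - int (order s (rden G))"
  by (simp add: at_point.val_def rnum_def rden_def)

lemma val_at_infinity: "at_infinity.val G = int (degree (rden G)) - int (degree (rnum G))"
  by (simp add: at_infinity.val_def rnum_def rden_def)

lemma regular_iff: "poly (rden G) s \<noteq> 0 \<longleftrightarrow> at_point.val_ge s 0 G"
proof (cases "G = 0")
  case True
  thus ?thesis by (simp add: at_point.val_ge_def rden_def)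
next
  case False
  thus ?thesis using rnum_rden_no_common_root[of G s]
    by (auto simp: at_point.val_ge_def val_at_point order_root)
qed

lemma zero_iff: "poly (rnum G) s = 0 \<longleftrightarrow> at_point.val_ge s 1 G"
proof (cases "G = 0")
  case False
  have "poly (rnum G) s = 0 \<longleftrightarrow> order s (rnum G) \<noteq> 0"
    using False by (simp add: order_root)
  moreover have "poly (rden G) s = 0 \<longleftrightarrow> order s (rden G) \<noteq> 0"
    by (simp add: order_root)
  ultimately show ?thesis using False rnum_rden_no_common_root[of G s]
    by (auto simp: at_point.val_ge_def val_at_point)
qed (simp add: at_point.val_ge_def rnum_def)

lemma proper_iff: "proper G \<longleftrightarrow> at_infinity.val_ge 0 G"
  by (cases "G = 0") (auto simp: at_infinity.val_ge_def val_at_infinity proper_def rnum_def)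

lemma stable_iff:
  "G \<in> stable_ratfuns \<longleftrightarrow> at_infinity.val_ge 0 G \<and> (\<forall>s. 0 \<le> Re s \<longrightarrow> at_point.val_ge s 0 G)"
  by (auto simp: stable_ratfuns_def proper_iff rhp_poles_def regular_iff[symmetric])

text \<open>The value of a rational function may be computed from any representation whose
  denominator does not vanish at the point. Coprimality of the reduced representation excludes a
  spurious pole there.\<close>
lemma reval_Fract:
  assumes "poly (cpoly b) s \<noteq> 0"
  shows "poly (rden (Fract a b)) s \<noteq> 0"
    and "reval (Fract a b) s = poly (cpoly a) s / poly (cpoly b) s"
proof -
  let ?G = "Fract a b"
  have "b \<noteq> 0" using assms by auto
  have "Fract (fst (quot_of_fract ?G)) (snd (quot_of_fract ?G)) = Fract a b" by simp
  hence "fst (quot_of_fract ?G) * b = a * snd (quot_of_fract ?G)"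
    using \<open>b \<noteq> 0\<close> by (simp add: eq_fract del: Fract_quot_of_fract)
  hence "rnum ?G * cpoly b = cpoly a * rden ?G"
    unfolding rnum_def rden_def by (metis cpoly_mult)
  hence eq: "poly (rnum ?G) s * poly (cpoly b) s = poly (cpoly a) s * poly (rden ?G) s"
    by (metis poly_mult)
  show nz: "poly (rden ?G) s \<noteq> 0"
    using eq assms rnum_rden_no_common_root[of ?G s] by auto
  show "reval ?G s = poly (cpoly a) s / poly (cpoly b) s"
    using eq assms nz by (simp add: reval_def frac_eq_eq)
qed

lemma reval_add:
  assumes "poly (rden G) s \<noteq> 0" "poly (rden H) s \<noteq> 0"
  shows "reval (G + H) s = reval G s + reval H s"
proof -
  obtain a b where ab: "G = Fract a b" "b \<noteq> 0" "rnum G = cpoly a" "rden G = cpoly b"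
    unfolding rnum_def rden_def by (metis Fract_quot_of_fract snd_quot_of_fract_nonzero)
  obtain c d where cd: "H = Fract c d" "d \<noteq> 0" "rnum H = cpoly c" "rden H = cpoly d"
    unfolding rnum_def rden_def by (metis Fract_quot_of_fract snd_quot_of_fract_nonzero)
  have "G + H = Fract (a * d + c * b) (b * d)" using ab cd by simp
  moreover have "poly (cpoly (b * d)) s \<noteq> 0" using assms ab cd by (simp add: cpoly_mult)
  ultimately have "reval (G + H) s = poly (cpoly (a * d + c * b)) s / poly (cpoly (b * d)) s"
    using reval_Fract(2) by metis
  also have "\<dots> = reval G s + reval H s"
    unfolding reval_def ab(3,4) cd(3,4) using assms ab cd
    by (simp add: cpoly_mult cpoly_add add_frac_eq)
  finally show ?thesis .
qed

lemma reval_mult: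
  assumes "poly (rden G) s \<noteq> 0" "poly (rden H) s \<noteq> 0"
  shows "reval (G * H) s = reval G s * reval H s"
proof -
  obtain a b where ab: "G = Fract a b" "b \<noteq> 0" "rnum G = cpoly a" "rden G = cpoly b"
    unfolding rnum_def rden_def by (metis Fract_quot_of_fract snd_quot_of_fract_nonzero)
  obtain c d where cd: "H = Fract c d" "d \<noteq> 0" "rnum H = cpoly c" "rden H = cpoly d"
    unfolding rnum_def rden_def by (metis Fract_quot_of_fract snd_quot_of_fract_nonzero)
  have "G * H = Fract (a * c) (b * d)" using ab cd by simp
  moreover have "poly (cpoly (b * d)) s \<noteq> 0" using assms ab cd by (simp add: cpoly_mult)
  ultimately have "reval (G * H) s = poly (cpoly (a * c)) s / poly (cpoly (b * d)) s"
    using reval_Fract(2) by metis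
  also have "\<dots> = reval G s * reval H s"
    unfolding reval_def ab(3,4) cd(3,4) by (simp add: cpoly_mult)
  finally show ?thesis .
qed

lemma reval_diff:
  assumes "poly (rden G) s \<noteq> 0" "poly (rden H) s \<noteq> 0"
  shows "reval (G - H) s = reval G s - reval H s"
proof -
  have "poly (rden (G - H)) s \<noteq> 0"
    using assms by (simp add: regular_iff at_point.val_ge_diff)
  thus ?thesis using reval_add[of "G - H" s H] assms by simp
qed

lemma reval_eq_0_iff: "poly (rden G) s \<noteq> 0 \<Longrightarrow> reval G s = 0 \<longleftrightarrow> at_point.val_ge s 1 G"
  by (simp add: reval_def zero_iff[symmetric])

lemma regular_mult:
  "poly (rden G) s \<noteq> 0 \<Longrightarrow> poly (rden H) s \<noteq> 0 \<Longrightarrow> poly (rden (G * H)) s \<noteq> 0"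
  using at_point.val_ge_mult[of s 0 G 0 H] by (simp add: regular_iff)

lemma regular_diff:
  "poly (rden G) s \<noteq> 0 \<Longrightarrow> poly (rden H) s \<noteq> 0 \<Longrightarrow> poly (rden (G - H)) s \<noteq> 0"
  by (simp add: regular_iff at_point.val_ge_diff)

lemma reval_1 [simp]: "reval 1 s = 1"
  by (simp add: reval_def rnum_def rden_def)

lemma reval_cnj: "reval G (cnj s) = cnj (reval G s)"
  by (simp add: reval_def rnum_def rden_def poly_cpoly_cnj)

section \<open>The Laplace transform on the half-line\<close>

lemma set_integrable_dominated:
  fixes f :: "real \<Rightarrow> 'a :: {banach, second_countable_topology}"
  assumes "set_integrable lborel {0..} g" "continuous_on {0..} f"
    and "\<And>t. 0 \<le> t \<Longrightarrow> norm (f t) \<le> (g t :: real)"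
  shows "set_integrable lborel {0..} f"
proof (rule set_integrable_bound[OF assms(1)])
  have "set_borel_measurable borel {0..} f"
    using assms(2) by (intro set_measurable_continuous_on) auto
  thus "set_borel_measurable lborel {0..} f"
    by (simp add: set_borel_measurable_def)
  show "AE t in lborel. t \<in> {0..} \<longrightarrow> norm (f t) \<le> norm (g t)"
    using assms(3) by (intro AE_I2) (fastforce intro: order_trans)
qed

lemma set_integral_halfline_limit:
  fixes f :: "real \<Rightarrow> 'a :: {banach, second_countable_topology}"
  assumes "set_integrable lborel {0..} f"
  shows "(\<lambda>n. LINT t:{0..real n}|lborel. f t) \<longlonglongrightarrow> (LINT t:{0..}|lborel. f t)"
  unfolding set_lebesgue_integral_def
proof (rule integral_dominated_convergence)
  have int: "integrable lborel (\<lambda>t. indicator {0..} t *\<^sub>R f t)"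
    using assms by (simp add: set_integrable_def)
  thus "(\<lambda>t. indicator {0..} t *\<^sub>R f t) \<in> borel_measurable lborel" by simp
  show "integrable lborel (\<lambda>t. norm (indicator {0..} t *\<^sub>R f t))"
    using int by (rule integrable_norm)
  show "(\<lambda>t. indicator {0..real n} t *\<^sub>R f t) \<in> borel_measurable lborel" for n
  proof -
    have "set_integrable lborel {0..real n} f"
      by (rule set_integrable_subset[OF assms]) auto
    thus ?thesis by (auto simp: set_integrable_def)
  qed
  show "AE t in lborel. (\<lambda>n. indicator {0..real n} t *\<^sub>R f t) \<longlonglongrightarrow> indicator {0..} t *\<^sub>R f t"
  proof (rule AE_I2)
    fix t :: real
    obtain N :: nat where "t \<le> real N" using real_arch_simple by blast
    hence "eventually (\<lambda>n. indicator {0..real n} t *\<^sub>R f t = indicator {0..} t *\<^sub>R f t) sequentially"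
      by (intro eventually_sequentiallyI[of N]) (auto simp: indicator_def)
    thus "(\<lambda>n. indicator {0..real n} t *\<^sub>R f t) \<longlonglongrightarrow> indicator {0..} t *\<^sub>R f t"
      by (rule tendsto_eventually)
  qed
  show "AE t in lborel. norm (indicator {0..real n} t *\<^sub>R f t)
      \<le> norm (indicator {0..} t *\<^sub>R f t)" for n
    by (auto simp: indicator_def)
qed

lemma set_integrable_exp_decay:
  assumes "x > 0"
  shows "set_integrable lborel {0..} (\<lambda>t. exp (- x * t) :: real)"
proof -
  have "(\<lambda>t. exp (- x * t)) absolutely_integrable_on {0..}"
    using integrable_on_exp_minus_to_infinity[OF assms]
    by (intro nonnegative_absolutely_integrable_1) auto
  hence "integrable lebesgue (\<lambda>t. indicator {0..} t *\<^sub>R exp (- x * t))"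
    by (simp add: set_integrable_def)
  thus ?thesis unfolding set_integrable_def
    by (subst (asm) integrable_completion) auto
qed

definition laplace :: "(real \<Rightarrow> real) \<Rightarrow> complex \<Rightarrow> complex" where
  "laplace f s = (LINT t:{0..}|lborel. exp (- (s * complex_of_real t)) * complex_of_real (f t))"

lemma norm_laplace_kernel:
  "norm (exp (- (s * complex_of_real t)) * complex_of_real (f t)) = exp (- Re s * t) * \<bar>f t\<bar>"
  by (simp add: norm_mult)

lemma set_integrable_laplace_kernel:
  assumes "continuous_on {0..} f" "set_integrable lborel {0..} (\<lambda>t. exp (- x * t) * f t)" "x \<le> Re s"
  shows "set_integrable lborel {0..} (\<lambda>t. exp (- (s * complex_of_real t)) * complex_of_real (f t))"
proof (rule set_integrable_dominated)
  show "set_integrable lborel {0..} (\<lambda>t. exp (- x * t) * \<bar>f t\<bar>)"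
    using set_integrable_abs[OF assms(2)] by (simp add: abs_mult)
  show "continuous_on {0..} (\<lambda>t. exp (- (s * complex_of_real t)) * complex_of_real (f t))"
    by (intro continuous_intros assms)
  show "norm (exp (- (s * complex_of_real t)) * complex_of_real (f t)) \<le> exp (- x * t) * \<bar>f t\<bar>"
    if "0 \<le> t" for t
    unfolding norm_laplace_kernel using that assms(3) by (intro mult_right_mono) (auto intro: mult_right_mono)
qed

lemma truncated_laplace_holomorphic:
  assumes "continuous_on {0..} f"
  shows "(\<lambda>s. LINT t:{0..real n}|lborel. exp (- (s * complex_of_real t)) * complex_of_real (f t))
    holomorphic_on S"
proof -
  have cf: "continuous_on {0..real n} f"
    by (rule continuous_on_subset[OF assms]) auto
  have cont: "continuous_on {0..real n} (\<lambda>t. exp (- (s * complex_of_real t)) * complex_of_real (f t))" for s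
    by (intro continuous_intros cf)
  have "(\<lambda>s. integral (cbox 0 (real n)) (\<lambda>t. exp (- (s * complex_of_real t)) * complex_of_real (f t)))
      holomorphic_on UNIV"
  proof (rule leibniz_rule_holomorphic)
    show "((\<lambda>s. exp (- (s * complex_of_real t)) * complex_of_real (f t)) has_field_derivative
        - complex_of_real t * exp (- (s * complex_of_real t)) * complex_of_real (f t)) (at s within UNIV)"
      for s t by (auto intro!: derivative_eq_intros)
    show "(\<lambda>t. exp (- (s * complex_of_real t)) * complex_of_real (f t)) integrable_on cbox 0 (real n)" for s
      using cont[of s] by (intro integrable_continuous) simp
    have "continuous_on (UNIV \<times> cbox 0 (real n)) (\<lambda>p :: complex \<times> real. f (snd p))"
      by (rule continuous_on_compose2[OF cf]) (auto intro!: continuous_intros)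
    thus "continuous_on (UNIV \<times> cbox 0 (real n))
       (\<lambda>(s, t). - complex_of_real t * exp (- (s * complex_of_real t)) * complex_of_real (f t))"
      unfolding split_def by (intro continuous_intros)
  qed auto
  moreover have "(LINT t:{0..real n}|lborel. exp (- (s * complex_of_real t)) * complex_of_real (f t))
     = integral (cbox 0 (real n)) (\<lambda>t. exp (- (s * complex_of_real t)) * complex_of_real (f t))" for s
    using set_borel_integral_eq_integral(2)[OF borel_integrable_atLeastAtMost'[OF cont]] by simp
  ultimately show ?thesis using holomorphic_on_subset[of _ UNIV S] by simp
qed

text \<open>The tail of the integral is dominated by the tail at the abscissa \<open>x\<close>, uniformly
  in the half-plane to its right; this yields continuity up to the boundary and holomorphy inside.\<close>
lemma truncated_laplace_uniform_limit:
  assumes "continuous_on {0..} f" "set_integrable lborel {0..} (\<lambda>t. exp (- x * t) * f t)"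
  shows "uniform_limit {s. x \<le> Re s}
    (\<lambda>n s. LINT t:{0..real n}|lborel. exp (- (s * complex_of_real t)) * complex_of_real (f t))
    (laplace f) sequentially"
proof (rule uniform_limitI)
  fix \<epsilon> :: real assume "\<epsilon> > 0"
  let ?H = "\<lambda>t. exp (- x * t) * \<bar>f t\<bar>"
  have H: "set_integrable lborel {0..} ?H"
    using set_integrable_abs[OF assms(2)] by (simp add: abs_mult)
  have tail: "(LINT t:{0..}|lborel. g t) - (LINT t:{0..real n}|lborel. g t) = (LINT t:{real n<..}|lborel. g t)"
    if "set_integrable lborel {0..} g" for n and g :: "real \<Rightarrow> 'a :: {banach, second_countable_topology}"
  proof -
    have "(LINT t:{0..real n} \<union> {real n<..}|lborel. g t)
        = (LINT t:{0..real n}|lborel. g t) + (LINT t:{real n<..}|lborel. g t)"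
      by (rule set_integral_Un) (auto intro: set_integrable_subset[OF that])
    moreover have "{0..real n} \<union> {real n<..} = {0..}" by auto
    ultimately show ?thesis by simp
  qed
  have "eventually (\<lambda>n. \<bar>(LINT t:{0..real n}|lborel. ?H t) - (LINT t:{0..}|lborel. ?H t)\<bar> < \<epsilon>) sequentially"
    using tendstoD[OF set_integral_halfline_limit[OF H] \<open>\<epsilon> > 0\<close>] by (simp add: dist_real_def)
  thus "eventually (\<lambda>n. \<forall>s\<in>{s. x \<le> Re s}. dist (LINT t:{0..real n}|lborel.
      exp (- (s * complex_of_real t)) * complex_of_real (f t)) (laplace f s) < \<epsilon>) sequentially"
  proof (eventually_elim, safe)
    fix n s assume n: "\<bar>(LINT t:{0..real n}|lborel. ?H t) - (LINT t:{0..}|lborel. ?H t)\<bar> < \<epsilon>"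
      and s: "x \<le> Re s"
    let ?g = "\<lambda>t. exp (- (s * complex_of_real t)) * complex_of_real (f t)"
    have g: "set_integrable lborel {0..} ?g"
      by (rule set_integrable_laplace_kernel[OF assms s])
    have "dist (LINT t:{0..real n}|lborel. ?g t) (laplace f s) = norm (LINT t:{real n<..}|lborel. ?g t)"
      by (simp only: laplace_def dist_norm tail[OF g, of n, symmetric] norm_minus_commute)
    also have "\<dots> \<le> (LINT t:{real n<..}|lborel. ?H t)"
    proof -
      have gn: "set_integrable lborel {real n<..} ?g" and Hn: "set_integrable lborel {real n<..} ?H"
        by (rule set_integrable_subset[OF g]; force) (rule set_integrable_subset[OF H]; force)
      show ?thesis unfolding set_lebesgue_integral_def
      proof (rule Bochner_Integration.integral_norm_bound_integral)
        show "integrable lborel (\<lambda>t. indicator {real n<..} t *\<^sub>R ?g t)"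
          "integrable lborel (\<lambda>t. indicator {real n<..} t *\<^sub>R ?H t)"
          using gn Hn by (simp_all add: set_integrable_def)
        have "exp (- Re s * t) * \<bar>f t\<bar> \<le> ?H t" if "t > real n" for t
        proof -
          have "t \<ge> 0" using that by linarith
          thus ?thesis using s by (intro mult_right_mono) (auto intro: mult_right_mono)
        qed
        thus "norm (indicator {real n<..} t *\<^sub>R ?g t) \<le> indicator {real n<..} t *\<^sub>R ?H t" for t
          by (auto simp: indicator_def norm_mult)
      qed
    qed
    also have "\<dots> < \<epsilon>" using n tail[OF H, of n] by linarith
    finally show "dist (LINT t:{0..real n}|lborel. ?g t) (laplace f s) < \<epsilon>" .
  qed
qed

lemma laplace_continuous_on:
  assumes "continuous_on {0..} f" "set_integrable lborel {0..} (\<lambda>t. exp (- x * t) * f t)"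
  shows "continuous_on {s. x \<le> Re s} (laplace f)"
proof (rule uniform_limit_theorem[OF _ truncated_laplace_uniform_limit[OF assms]])
  show "\<forall>\<^sub>F n in sequentially. continuous_on {s. x \<le> Re s}
     (\<lambda>s. LINT t:{0..real n}|lborel. exp (- (s * complex_of_real t)) * complex_of_real (f t))"
    using truncated_laplace_holomorphic[OF assms(1)] holomorphic_on_imp_continuous_on by auto
qed simp

lemma laplace_holomorphic_on:
  assumes "continuous_on {0..} f" "set_integrable lborel {0..} (\<lambda>t. exp (- x * t) * f t)"
  shows "laplace f holomorphic_on {s. x < Re s}"
proof (rule holomorphic_uniform_sequence)
  show op: "open {s. x < Re s}" by (rule open_halfspace_Re_gt)
  show "(\<lambda>s. LINT t:{0..real n}|lborel. exp (- (s * complex_of_real t)) * complex_of_real (f t))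
      holomorphic_on {s. x < Re s}" for n
    by (rule truncated_laplace_holomorphic[OF assms(1)])
  fix z assume "z \<in> {s. x < Re s}"
  then obtain d where d: "d > 0" "cball z d \<subseteq> {s. x < Re s}"
    using op open_contains_cball by blast
  have "cball z d \<subseteq> {s. x \<le> Re s}" using d(2) by force
  thus "\<exists>d>0. cball z d \<subseteq> {s. x < Re s} \<and> uniform_limit (cball z d)
    (\<lambda>n s. LINT t:{0..real n}|lborel. exp (- (s * complex_of_real t)) * complex_of_real (f t))
    (laplace f) sequentially"
    using d uniform_limit_on_subset[OF truncated_laplace_uniform_limit[OF assms]] by blast
qed

text \<open>A transform is known to be rational on some right half-plane only, but is needed at
  zeros and poles that may lie to the left of it. Where the weighted signal is still absolutely
  integrable, the identity theorem carries the equation \<open>denominator * transform =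
  numerator\<close> over; it also shows that the denominator does not vanish, since numerator and
  denominator have no common root. The abscissa itself is included because the pairings with the
  reference are only assumed to exist at the plant zeros, possibly on the very edge of the
  half-plane of convergence.\<close>
lemma laplace_eq_reval:
  assumes f: "continuous_on {0..} f" "set_integrable lborel {0..} (\<lambda>t. exp (- x * t) * f t)"
    and G: "has_laplace f G" and s: "x \<le> Re s"
  shows "poly (rden G) s \<noteq> 0" and "laplace f s = reval G s"
proof -
  obtain \<sigma> where \<sigma>: "\<And>s. Re s > \<sigma> \<Longrightarrow> laplace f s = reval G s"
    using G unfolding has_laplace_def laplace_def by blast
  let ?h = "\<lambda>s. poly (rden G) s * laplace f s - poly (rnum G) s"
  have fin: "finite {s. poly (rden G) s = 0}" by (rule poly_roots_finite) simp
  have inside: "?h s = 0" if "x < Re s" for s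
  proof -
    let ?A = "{s. max \<sigma> x < Re s} - {s. poly (rden G) s = 0}"
    have opA: "open ?A"
      by (intro open_Diff open_halfspace_Re_gt finite_imp_closed fin)
    have inf: "infinite (complex_of_real ` {max \<sigma> x<..})"
      by (subst finite_image_iff) (auto intro: inj_onI simp: infinite_Ioi)
    have "complex_of_real ` {max \<sigma> x<..} \<subseteq> {s. max \<sigma> x < Re s}" by auto
    hence "\<not> {s. max \<sigma> x < Re s} \<subseteq> {s. poly (rden G) s = 0}"
      using inf finite_subset[OF _ fin] subset_trans by blast
    hence "?A \<noteq> {}" by (simp add: Diff_eq_empty_iff)
    show ?thesis
    proof (rule analytic_continuation_open[where f = ?h and g = "\<lambda>_. 0" and s = ?A and s' = "{s. x < Re s}"])
      show "open ?A" by (rule opA)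
      show "?A \<noteq> {}" by fact
      show "connected {s. x < Re s}" by (intro convex_connected convex_halfspace_Re_gt)
      show "?h holomorphic_on {s. x < Re s}"
        by (intro holomorphic_intros laplace_holomorphic_on f)
      show "?h z = 0" if "z \<in> ?A" for z
        using that \<sigma>[of z] by (simp add: reval_def)
    qed (use that in \<open>auto simp: open_halfspace_Re_gt\<close>)
  qed
  have "?h s = 0"
  proof (cases "x < Re s")
    case False
    hence eq: "Re s = x" using s by simp
    \<comment> \<open>the boundary line is reached from the right along a horizontal segment\<close>
    let ?y = "\<lambda>n. s + complex_of_real (inverse (real (Suc n)))"
    have lim: "?y \<longlonglongrightarrow> s + complex_of_real 0"
      by (intro tendsto_intros LIMSEQ_inverse_real_of_nat)
    have cont: "continuous_on {s. x \<le> Re s} ?h"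
      by (intro continuous_intros laplace_continuous_on f)
    have "(\<lambda>n. ?h (?y n)) \<longlonglongrightarrow> ?h s"
      by (rule continuous_on_tendsto_compose[OF cont]) (use lim eq in auto)
    moreover have "?h (?y n) = 0" for n
      by (rule inside) (simp add: eq)
    ultimately show ?thesis by (simp add: LIMSEQ_const_iff)
  qed (rule inside)
  hence eq: "poly (rden G) s * laplace f s = poly (rnum G) s" by simp
  thus nz: "poly (rden G) s \<noteq> 0" using rnum_rden_no_common_root[of G s] by auto
  show "laplace f s = reval G s" using eq nz by (simp add: reval_def field_simps)
qed

lemma laplace_exp:
  assumes "Re s > 0"
  shows "(LINT t:{0..}|lborel. exp (- (s * complex_of_real t))) = 1 / s"
proof -
  have int: "set_integrable lborel {0..} (\<lambda>t. exp (- (s * complex_of_real t)))"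
    by (rule set_integrable_dominated[OF set_integrable_exp_decay[OF assms]])
       (auto intro!: continuous_intros)
  have "s \<noteq> 0" using assms by auto
  have eq: "(LINT t:{0..real n}|lborel. exp (- (s * complex_of_real t)))
      = - exp (- (s * of_nat n)) / s - (- 1 / s)" for n
  proof -
    have "(LINT t:{0..real n}|lborel. exp (- (s * complex_of_real t)))
      = (\<lambda>t. - exp (- (s * complex_of_real t)) / s) (real n) - (\<lambda>t. - exp (- (s * complex_of_real t)) / s) 0"
      unfolding set_lebesgue_integral_def
    proof (rule integral_FTC_atLeastAtMost)
      show "((\<lambda>t. - exp (- (s * complex_of_real t)) / s) has_vector_derivative
          exp (- (s * complex_of_real t))) (at t within {0..real n})" for t
      proof (rule has_vector_derivative_real_field)
        show "((\<lambda>z. - exp (- (s * z)) / s) has_field_derivative exp (- (s * complex_of_real t)))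
            (at (complex_of_real t))"
          using \<open>s \<noteq> 0\<close> by (auto intro!: derivative_eq_intros)
      qed
    qed (auto intro!: continuous_intros)
    thus ?thesis by simp
  qed
  have "(\<lambda>n. norm (exp (- (s * of_nat n)))) \<longlonglongrightarrow> 0"
  proof -
    have "(\<lambda>n. exp (- Re s) ^ n) \<longlonglongrightarrow> 0" by (rule LIMSEQ_realpow_zero) (use assms in auto)
    thus ?thesis by (simp add: exp_of_nat_mult[symmetric] mult.commute)
  qed
  hence "(\<lambda>n. exp (- (s * of_nat n))) \<longlonglongrightarrow> 0" by (rule tendsto_norm_zero_cancel)
  hence "(\<lambda>n. - exp (- (s * of_nat n)) / s - (- 1 / s)) \<longlonglongrightarrow> - 0 / s - (- 1 / s)"
    using \<open>s \<noteq> 0\<close> by (intro tendsto_intros)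
  with set_integral_halfline_limit[OF int] show ?thesis
    unfolding eq by (intro LIMSEQ_unique[of _ "LINT t:{0..}|lborel. exp (- (s * complex_of_real t))" "1 / s"]) simp_all
qed

section \<open>Convexity in finitely many coordinates\<close>

text \<open>A space of coordinate vectors that no nontrivial functional annihilates contains
  the unit vectors. Vectors are functions on an index set, since the number of coordinates is not
  fixed by a type.\<close>
lemma coordinate_dual_family:
  fixes Y :: "('k \<Rightarrow> real) set"
  assumes "finite I"
    and lin: "\<And>y z c. y \<in> Y \<Longrightarrow> z \<in> Y \<Longrightarrow> (\<lambda>i. y i + c * z i) \<in> Y"
    and "\<And>a. (\<And>y. y \<in> Y \<Longrightarrow> (\<Sum>i\<in>I. a i * y i) = 0) \<Longrightarrow> \<forall>i\<in>I. a i = 0"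
  shows "\<exists>e. \<forall>k\<in>I. e k \<in> Y \<and> (\<forall>i\<in>I. e k i = (if i = k then 1 else 0))"
  using assms(1,3)
proof (induction I rule: finite_induct)
  case (insert j I)
  have "\<forall>i\<in>I. a i = 0" if "\<And>y. y \<in> Y \<Longrightarrow> (\<Sum>i\<in>I. a i * y i) = 0" for a
  proof -
    have "(\<Sum>i\<in>I. (a(j := 0)) i * y i) = (\<Sum>i\<in>I. a i * y i)" for y
      using insert.hyps by (intro sum.cong) auto
    hence "\<forall>i\<in>insert j I. (a(j := 0)) i = 0"
      using that insert.hyps by (intro insert.prems) simp
    thus ?thesis using insert.hyps by (metis fun_upd_apply insertCI)
  qed
  from insert.IH[OF this] obtain e where e: "\<And>k. k \<in> I \<Longrightarrow> e k \<in> Y"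
    "\<And>k i. k \<in> I \<Longrightarrow> i \<in> I \<Longrightarrow> e k i = (if i = k then 1 else 0)" by blast
  let ?a = "\<lambda>i. if i = j then 1 else - e i j"
  have "\<not> (\<forall>i\<in>insert j I. ?a i = 0)" by auto
  then obtain y where y: "y \<in> Y" "(\<Sum>i\<in>insert j I. ?a i * y i) \<noteq> 0"
    using insert.prems[of ?a] by blast
  have "(\<Sum>i\<in>I. ?a i * y i) = (\<Sum>i\<in>I. - (y i * e i j))"
    using insert.hyps by (intro sum.cong) auto
  hence y_ne: "y j - (\<Sum>i\<in>I. y i * e i j) \<noteq> 0"
    using y(2) insert.hyps by (simp add: sum_negf)
  define y' where "y' = (\<lambda>l. y l - (\<Sum>i\<in>I. y i * e i l))"
  have "(\<lambda>l. y l - (\<Sum>i\<in>J. y i * e i l)) \<in> Y" if "J \<subseteq> I" for J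
    using finite_subset[OF that insert.hyps(1)] that
  proof (induction J rule: finite_induct)
    case (insert k J)
    from lin[OF insert.IH e(1)[of k], of "- y k"] insert show ?case
      by (simp add: algebra_simps)
  qed (use y in simp)
  hence y': "y' \<in> Y" unfolding y'_def by blast
  have y'_I: "y' l = 0" if "l \<in> I" for l
  proof -
    have "(\<Sum>i\<in>I. y i * e i l) = (\<Sum>i\<in>I. if i = l then y i else 0)"
      using e(2) that by (intro sum.cong) auto
    thus ?thesis using that insert.hyps by (simp add: y'_def)
  qed
  define f where "f = (\<lambda>l. y' l + (inverse (y' j) - 1) * y' l)"
  have f: "f \<in> Y" unfolding f_def by (rule lin[OF y' y'])
  have f_eq: "f l = y' l / y' j" for l by (simp add: f_def field_simps)
  have fj: "f j = 1" and fI: "\<And>l. l \<in> I \<Longrightarrow> f l = 0"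
    using y_ne y'_I by (auto simp: f_eq y'_def)
  define e' where "e' = (\<lambda>k. if k = j then f else (\<lambda>l. e k l + (- e k j) * f l))"
  have "e' k \<in> Y \<and> (\<forall>i\<in>insert j I. e' k i = (if i = k then 1 else 0))" if "k \<in> insert j I" for k
  proof (cases "k = j")
    case True
    thus ?thesis using f fj fI insert.hyps by (auto simp: e'_def)
  next
    case False
    with that have "k \<in> I" by auto
    thus ?thesis using False fj fI e insert.hyps lin[OF e(1)[OF \<open>k \<in> I\<close>] f, of "- e k j"]
      by (auto simp: e'_def)
  qed
  thus ?case by blast
qed auto

text \<open>The normal is the difference between the point and the nearest point of the closure.
  The latter is the coordinatewise limit of a minimising sequence, which is Cauchy by the
  parallelogram law, so that no topology on the space of vectors is needed.\<close>
lemma separate_from_convex_at_positive_distance: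
  fixes C :: "('k \<Rightarrow> real) set" and c :: "'k \<Rightarrow> real"
  assumes "finite I" "C \<noteq> {}"
    and convex: "\<And>y z s. y \<in> C \<Longrightarrow> z \<in> C \<Longrightarrow> 0 \<le> s \<Longrightarrow> s \<le> 1 \<Longrightarrow> (\<lambda>i. (1 - s) * y i + s * z i) \<in> C"
    and "\<delta> > 0" and far: "\<And>y. y \<in> C \<Longrightarrow> \<delta> \<le> (\<Sum>i\<in>I. (y i - c i)\<^sup>2)"
  shows "\<exists>a. (\<exists>i\<in>I. a i \<noteq> 0) \<and> (\<forall>y\<in>C. (\<Sum>i\<in>I. a i * y i) \<le> (\<Sum>i\<in>I. a i * c i))"
proof -
  define S where "S = (\<lambda>y. \<Sum>i\<in>I. (y i - c i)\<^sup>2)"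
  define D where "D = Inf (S ` C)"
  have bdd: "bdd_below (S ` C)" using far unfolding S_def by (intro bdd_belowI2) blast
  have D_le: "D \<le> S y" if "y \<in> C" for y
    unfolding D_def using that bdd by (intro cInf_lower) auto
  have D_ge: "\<delta> \<le> D" unfolding D_def
    using far assms(2) by (intro cInf_greatest) (auto simp: S_def)
  have "\<exists>y\<in>C. S y < D + inverse (real (Suc n))" for n
    using cInf_lessD[of "S ` C" "D + inverse (real (Suc n))"] assms(2) unfolding D_def by auto
  then obtain y where y: "\<And>n. y n \<in> C" "\<And>n. S (y n) < D + inverse (real (Suc n))" by metis
  \<comment> \<open>parallelogram law at the midpoint, which lies in the convex set\<close>
  have close: "(\<Sum>i\<in>I. (y m i - y n i)\<^sup>2) \<le> 2 * inverse (real (Suc m)) + 2 * inverse (real (Suc n))" for m n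
  proof -
    have "D \<le> S (\<lambda>i. (1 - 1/2) * y m i + 1/2 * y n i)"
      by (intro D_le convex y) auto
    also have "\<dots> = (\<Sum>i\<in>I. (y m i - c i)\<^sup>2 / 2 + (y n i - c i)\<^sup>2 / 2 - (y m i - y n i)\<^sup>2 / 4)"
      unfolding S_def by (intro sum.cong) (auto simp: power2_eq_square field_simps)
    also have "\<dots> = S (y m) / 2 + S (y n) / 2 - (\<Sum>i\<in>I. (y m i - y n i)\<^sup>2) / 4"
      by (simp add: S_def sum.distrib sum_subtractf sum_divide_distrib)
    finally show ?thesis using y(2)[of m] y(2)[of n] by argo
  qed
  have "\<exists>L. (\<lambda>n. y n i) \<longlonglongrightarrow> L" if "i \<in> I" for i
  proof -
    have "Cauchy (\<lambda>n. y n i)"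
    proof (rule metric_CauchyI)
      fix e :: real assume e: "e > 0"
      obtain N where N: "inverse (real (Suc N)) < e\<^sup>2 / 4"
        using reals_Archimedean[of "e\<^sup>2 / 4"] e by auto
      have "dist (y m i) (y n i) < e" if "m \<ge> N" "n \<ge> N" for m n
      proof -
        have "inverse (real (Suc m)) \<le> inverse (real (Suc N))"
          "inverse (real (Suc n)) \<le> inverse (real (Suc N))"
          using that by (auto simp: field_simps)
        moreover have "(y m i - y n i)\<^sup>2 \<le> (\<Sum>i\<in>I. (y m i - y n i)\<^sup>2)"
          using \<open>i \<in> I\<close> assms(1) by (intro member_le_sum) auto
        ultimately have "(y m i - y n i)\<^sup>2 < e\<^sup>2" using N close[of m n] by linarith
        hence "\<bar>y m i - y n i\<bar> < e"
          using e power2_less_imp_less[of "\<bar>y m i - y n i\<bar>" e] by simp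
        thus ?thesis by (simp add: dist_real_def)
      qed
      thus "\<exists>M. \<forall>m\<ge>M. \<forall>n\<ge>M. dist (y m i) (y n i) < e" by blast
    qed
    thus ?thesis by (simp add: Cauchy_convergent_iff convergent_def)
  qed
  then obtain L where L: "\<And>i. i \<in> I \<Longrightarrow> (\<lambda>n. y n i) \<longlonglongrightarrow> L i" by metis
  have "(\<lambda>n. S (y n)) \<longlonglongrightarrow> S L"
    unfolding S_def by (intro tendsto_intros L)
  moreover have "(\<lambda>n. D + inverse (real (Suc n))) \<longlonglongrightarrow> D + 0"
    by (intro tendsto_intros LIMSEQ_inverse_real_of_nat)
  ultimately have SL: "S L \<le> D"
    using y(2) by (intro LIMSEQ_le[of "\<lambda>n. S (y n)" "S L" "\<lambda>n. D + inverse (real (Suc n))" D])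
      (auto intro: less_imp_le)
  have SL_ge: "D \<le> S L"
    using \<open>(\<lambda>n. S (y n)) \<longlonglongrightarrow> S L\<close> D_le y(1) by (intro LIMSEQ_le_const) auto
  \<comment> \<open>moving from the nearest point towards a point of the set does not decrease the distance\<close>
  have key: "0 \<le> (\<Sum>i\<in>I. (L i - c i) * (z i - L i))" if z: "z \<in> C" for z
  proof (rule ccontr)
    define A where "A = (\<Sum>i\<in>I. (L i - c i) * (z i - L i))"
    define B where "B = (\<Sum>i\<in>I. (z i - L i)\<^sup>2)"
    assume "\<not> 0 \<le> (\<Sum>i\<in>I. (L i - c i) * (z i - L i))"
    hence A: "A < 0" by (simp add: A_def)
    have B: "B \<ge> 0" by (simp add: B_def sum_nonneg)
    have seg: "0 \<le> 2 * s * A + s\<^sup>2 * B" if s: "0 \<le> s" "s \<le> 1" for s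
    proof -
      have "(\<lambda>n. S (\<lambda>i. (1 - s) * y n i + s * z i)) \<longlonglongrightarrow> S (\<lambda>i. (1 - s) * L i + s * z i)"
        unfolding S_def by (intro tendsto_intros L)
      hence "D \<le> S (\<lambda>i. (1 - s) * L i + s * z i)"
        using D_le convex[OF y(1) z s] by (intro LIMSEQ_le_const) auto
      also have "\<dots> = (\<Sum>i\<in>I. (L i - c i)\<^sup>2 + 2 * s * ((L i - c i) * (z i - L i)) + s\<^sup>2 * (z i - L i)\<^sup>2)"
        unfolding S_def by (intro sum.cong) (auto simp: power2_eq_square algebra_simps)
      also have "\<dots> = S L + 2 * s * A + s\<^sup>2 * B"
        by (simp add: S_def A_def B_def sum.distrib sum_distrib_left)
      finally show ?thesis using SL by linarith
    qed
    define s where "s = min 1 (- A / (B + 1))"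
    have s: "0 < s" "s \<le> 1" using A B by (auto simp: s_def field_simps)
    have "s * B \<le> - A"
    proof -
      have "s * B \<le> (- A / (B + 1)) * B" using B by (intro mult_right_mono) (auto simp: s_def)
      also have "\<dots> \<le> - A" using A B by (simp add: field_simps)
      finally show ?thesis .
    qed
    hence "s * (2 * A + s * B) < 0" using s A by (intro mult_pos_neg) auto
    thus False using seg[of s] s by (simp add: power2_eq_square algebra_simps)
  qed
  show ?thesis
  proof (intro exI[of _ "\<lambda>i. c i - L i"] conjI ballI)
    show "\<exists>i\<in>I. c i - L i \<noteq> 0"
    proof (rule ccontr)
      assume "\<not> ?thesis"
      hence "S L = 0" by (simp add: S_def)
      thus False using SL_ge D_ge \<open>\<delta> > 0\<close> by linarith
    qed
    fix z assume "z \<in> C"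
    have "(\<Sum>i\<in>I. (c i - L i) * c i) - (\<Sum>i\<in>I. (c i - L i) * z i)
        = (\<Sum>i\<in>I. (L i - c i) * (z i - L i) + (L i - c i)\<^sup>2)"
      unfolding sum_subtractf[symmetric]
      by (intro sum.cong) (auto simp: power2_eq_square algebra_simps)
    also have "\<dots> \<ge> 0"
      unfolding sum.distrib by (rule add_nonneg_nonneg[OF key[OF \<open>z \<in> C\<close>]]) (simp add: sum_nonneg)
    finally show "(\<Sum>i\<in>I. (c i - L i) * z i) \<le> (\<Sum>i\<in>I. (c i - L i) * c i)" by simp
  qed
qed

text \<open>The moment vectors attained below a cost level form a convex set. If it came no closer to
  the prescribed vector than some positive distance, a separating functional would contradict the
  hypothesis. Thus the prescribed moments are attained approximately, and the defect is
  removed along a dual family at an arbitrarily small cost. This is why the final level may be any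
  \<open>r'\<close> above the level \<open>r\<close> at which functionals are compared.\<close>
lemma attain_moments:
  fixes E :: "('x \<Rightarrow> real) set" and m :: "('x \<Rightarrow> real) \<Rightarrow> 'k \<Rightarrow> real" and \<Phi> :: "('x \<Rightarrow> real) \<Rightarrow> real"
  assumes "finite I"
    and E: "\<And>f g c. f \<in> E \<Longrightarrow> g \<in> E \<Longrightarrow> (\<lambda>t. f t + c * g t) \<in> E"
    and m: "\<And>f g c i. f \<in> E \<Longrightarrow> g \<in> E \<Longrightarrow> i \<in> I \<Longrightarrow> m (\<lambda>t. f t + c * g t) i = m f i + c * m g i"
    and indep: "\<And>a. (\<And>f. f \<in> E \<Longrightarrow> (\<Sum>i\<in>I. a i * m f i) = 0) \<Longrightarrow> \<forall>i\<in>I. a i = 0"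
    and convex: "\<And>f g s. f \<in> E \<Longrightarrow> g \<in> E \<Longrightarrow> 0 \<le> s \<Longrightarrow> s \<le> 1 \<Longrightarrow>
        \<Phi> (\<lambda>t. (1 - s) * f t + s * g t) \<le> (1 - s) * \<Phi> f + s * \<Phi> g"
    and lipschitz: "\<And>f g c. f \<in> E \<Longrightarrow> g \<in> E \<Longrightarrow> \<Phi> (\<lambda>t. f t + c * g t) \<le> \<Phi> f + \<bar>c\<bar> * N g"
    and start: "f0 \<in> E" "\<Phi> f0 < r"
    and separated: "\<And>a. \<exists>i\<in>I. a i \<noteq> 0 \<Longrightarrow>
        \<exists>f\<in>E. \<Phi> f < r \<and> (\<Sum>i\<in>I. a i * c i) < (\<Sum>i\<in>I. a i * m f i)"
    and "r < r'"
  shows "\<exists>f\<in>E. \<Phi> f < r' \<and> (\<forall>i\<in>I. m f i = c i)"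
proof -
  let ?R = "\<lambda>f i. if i \<in> I then m f i else 0"
  have sumR: "(\<Sum>i\<in>I. a i * ?R f i) = (\<Sum>i\<in>I. a i * m f i)" for a f
    by (rule sum.cong) auto
  obtain e' where e': "\<And>k. k \<in> I \<Longrightarrow> e' k \<in> ?R ` E \<and> (\<forall>i\<in>I. e' k i = (if i = k then 1 else 0))"
  proof -
    have "\<exists>e. \<forall>k\<in>I. e k \<in> ?R ` E \<and> (\<forall>i\<in>I. e k i = (if i = k then 1 else 0))"
    proof (rule coordinate_dual_family[OF \<open>finite I\<close>])
      fix y z c assume "y \<in> ?R ` E" "z \<in> ?R ` E"
      then obtain f g where "f \<in> E" "g \<in> E" "y = ?R f" "z = ?R g" by blast
      thus "(\<lambda>i. y i + c * z i) \<in> ?R ` E"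
        using m[of f g _ c] by (intro image_eqI[OF _ E[of f g c]]) auto
    next
      fix a assume zero: "\<And>y. y \<in> ?R ` E \<Longrightarrow> (\<Sum>i\<in>I. a i * y i) = 0"
      have "(\<Sum>i\<in>I. a i * m f i) = 0" if "f \<in> E" for f
        using zero[OF imageI[OF that]] unfolding sumR .
      thus "\<forall>i\<in>I. a i = 0" by (rule indep)
    qed
    thus ?thesis using that by blast
  qed
  have "\<exists>e. \<forall>k\<in>I. e k \<in> E \<and> (\<forall>i\<in>I. m (e k) i = (if i = k then 1 else 0))"
  proof (rule bchoice, rule ballI)
    fix k assume "k \<in> I"
    then obtain f where f: "f \<in> E" "e' k = ?R f" using e' by blast
    have "m f i = (if i = k then 1 else 0)" if "i \<in> I" for i
    proof -
      have "m f i = e' k i" using f(2) that by simp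
      thus ?thesis using e'[OF \<open>k \<in> I\<close>] that by simp
    qed
    thus "\<exists>f. f \<in> E \<and> (\<forall>i\<in>I. m f i = (if i = k then 1 else 0))"
      using f(1) by blast
  qed
  then obtain e where e: "\<And>k. k \<in> I \<Longrightarrow> e k \<in> E"
    "\<And>k i. k \<in> I \<Longrightarrow> i \<in> I \<Longrightarrow> m (e k) i = (if i = k then 1 else 0)" by blast
  define \<eta> where "\<eta> = (r' - r) / (1 + (\<Sum>k\<in>I. \<bar>N (e k)\<bar>))"
  have pos: "0 < 1 + (\<Sum>k\<in>I. \<bar>N (e k)\<bar>)" by (intro add_pos_nonneg sum_nonneg) auto
  hence \<eta>: "\<eta> > 0" using \<open>r < r'\<close> by (simp add: \<eta>_def)
  have "\<exists>f\<in>E. \<Phi> f < r \<and> (\<Sum>i\<in>I. (m f i - c i)\<^sup>2) < \<eta>\<^sup>2"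
  proof (rule ccontr)
    assume no: "\<not> ?thesis"
    have sep: "\<exists>a. (\<exists>i\<in>I. a i \<noteq> 0) \<and>
        (\<forall>y\<in>?R ` {f \<in> E. \<Phi> f < r}. (\<Sum>i\<in>I. a i * y i) \<le> (\<Sum>i\<in>I. a i * c i))"
    proof (rule separate_from_convex_at_positive_distance[OF \<open>finite I\<close>])
      show "?R ` {f \<in> E. \<Phi> f < r} \<noteq> {}" using start by blast
      show "0 < \<eta>\<^sup>2" using \<eta> by simp
      show "\<eta>\<^sup>2 \<le> (\<Sum>i\<in>I. (y i - c i)\<^sup>2)" if y: "y \<in> ?R ` {f \<in> E. \<Phi> f < r}" for y
      proof -
        obtain f where f: "f \<in> E" "\<Phi> f < r" "y = ?R f" using y by blast
        have "(\<Sum>i\<in>I. (y i - c i)\<^sup>2) = (\<Sum>i\<in>I. (m f i - c i)\<^sup>2)"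
          unfolding f(3) by (intro sum.cong) auto
        thus ?thesis using no f(1,2) not_less by metis
      qed
      fix y z s assume y: "y \<in> ?R ` {f \<in> E. \<Phi> f < r}" and z: "z \<in> ?R ` {f \<in> E. \<Phi> f < r}"
        and s: "0 \<le> s" "s \<le> (1 :: real)"
      obtain f where f: "f \<in> E" "\<Phi> f < r" "y = ?R f" using y by blast
      obtain g where g: "g \<in> E" "\<Phi> g < r" "z = ?R g" using z by blast
      let ?d = "\<lambda>t. g t + (-1) * f t"
      have d: "?d \<in> E" using E[OF g(1) f(1), of "-1"] .
      have eq: "(\<lambda>t. (1 - s) * f t + s * g t) = (\<lambda>t. f t + s * ?d t)" by (auto simp: algebra_simps)
      have "(\<lambda>t. (1 - s) * f t + s * g t) \<in> E" unfolding eq by (rule E[OF f(1) d])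
      moreover have "\<Phi> (\<lambda>t. (1 - s) * f t + s * g t) < r"
      proof -
        have "\<Phi> (\<lambda>t. (1 - s) * f t + s * g t) \<le> (1 - s) * \<Phi> f + s * \<Phi> g"
          by (rule convex[OF f(1) g(1) s])
        also have "\<dots> < r" by (rule convex_bound_lt) (use f g s in auto)
        finally show ?thesis .
      qed
      moreover have "?R (\<lambda>t. (1 - s) * f t + s * g t) = (\<lambda>i. (1 - s) * y i + s * z i)"
      proof
        fix i
        show "?R (\<lambda>t. (1 - s) * f t + s * g t) i = (1 - s) * y i + s * z i"
        proof (cases "i \<in> I")
          case True
          have "m (\<lambda>t. f t + s * ?d t) i = m f i + s * (m g i + (-1) * m f i)"
            by (simp only: m[OF f(1) d True] m[OF g(1) f(1) True])
          also have "\<dots> = (1 - s) * y i + s * z i" using True f(3) g(3) by (simp add: algebra_simps)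
          finally show ?thesis unfolding eq using True by simp
        qed (simp add: f(3) g(3))
      qed
      ultimately show "(\<lambda>i. (1 - s) * y i + s * z i) \<in> ?R ` {f \<in> E. \<Phi> f < r}"
        by (intro image_eqI[of _ _ "\<lambda>t. (1 - s) * f t + s * g t"]) auto
    qed
    obtain a where a: "\<exists>i\<in>I. a i \<noteq> 0"
      and le: "\<And>f. f \<in> E \<Longrightarrow> \<Phi> f < r \<Longrightarrow> (\<Sum>i\<in>I. a i * m f i) \<le> (\<Sum>i\<in>I. a i * c i)"
    proof -
      assume *: "\<And>a. \<exists>i\<in>I. a i \<noteq> 0 \<Longrightarrow>
        (\<And>f. f \<in> E \<Longrightarrow> \<Phi> f < r \<Longrightarrow> (\<Sum>i\<in>I. a i * m f i) \<le> (\<Sum>i\<in>I. a i * c i)) \<Longrightarrow> thesis"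
      obtain a where a: "\<exists>i\<in>I. a i \<noteq> 0"
        and le: "\<forall>y\<in>?R ` {f \<in> E. \<Phi> f < r}. (\<Sum>i\<in>I. a i * y i) \<le> (\<Sum>i\<in>I. a i * c i)"
        using sep by blast
      have "(\<Sum>i\<in>I. a i * m f i) \<le> (\<Sum>i\<in>I. a i * c i)" if "f \<in> E" "\<Phi> f < r" for f
        using bspec[OF le, of "?R f"] that unfolding sumR by blast
      thus thesis by (rule *[OF a])
    qed
    obtain f where "f \<in> E" "\<Phi> f < r" "(\<Sum>i\<in>I. a i * c i) < (\<Sum>i\<in>I. a i * m f i)"
      using separated[OF a] by blast
    thus False using le[of f] by linarith
  qed
  then obtain f where f: "f \<in> E" "\<Phi> f < r" "(\<Sum>i\<in>I. (m f i - c i)\<^sup>2) < \<eta>\<^sup>2" by blast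
  \<comment> \<open>the small moment defect of f is corrected along the dual family\<close>
  define b where "b = (\<lambda>k. c k - m f k)"
  have b: "\<bar>b k\<bar> \<le> \<eta>" if "k \<in> I" for k
  proof -
    have "(b k)\<^sup>2 \<le> (\<Sum>i\<in>I. (m f i - c i)\<^sup>2)"
      using that \<open>finite I\<close> member_le_sum[of k I "\<lambda>i. (m f i - c i)\<^sup>2"]
      by (simp add: b_def power2_commute)
    hence "(b k)\<^sup>2 \<le> \<eta>\<^sup>2" using f(3) by linarith
    thus ?thesis using \<eta> abs_le_square_iff[of "b k" \<eta>] by simp
  qed
  have corr: "(\<lambda>t. f t + (\<Sum>k\<in>J. b k * e k t)) \<in> E \<and>
      (\<forall>i\<in>I. m (\<lambda>t. f t + (\<Sum>k\<in>J. b k * e k t)) i = m f i + (\<Sum>k\<in>J. b k * m (e k) i)) \<and>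
      \<Phi> (\<lambda>t. f t + (\<Sum>k\<in>J. b k * e k t)) \<le> \<Phi> f + (\<Sum>k\<in>J. \<bar>b k\<bar> * N (e k))" if "J \<subseteq> I" for J
    using finite_subset[OF that \<open>finite I\<close>] that
  proof (induction J rule: finite_induct)
    case (insert k J)
    let ?g = "\<lambda>t. f t + (\<Sum>k\<in>J. b k * e k t)"
    have g: "?g \<in> E" "\<forall>i\<in>I. m ?g i = m f i + (\<Sum>k\<in>J. b k * m (e k) i)"
      "\<Phi> ?g \<le> \<Phi> f + (\<Sum>k\<in>J. \<bar>b k\<bar> * N (e k))" using insert by auto
    have eq: "(\<lambda>t. f t + (\<Sum>k\<in>insert k J. b k * e k t)) = (\<lambda>t. ?g t + b k * e k t)"
      using insert.hyps by (auto simp: algebra_simps)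
    have ek: "e k \<in> E" using insert.prems e(1) by blast
    show ?case unfolding eq
    proof (intro conjI ballI)
      show "(\<lambda>t. ?g t + b k * e k t) \<in> E" by (rule E[OF g(1) ek])
      show "m (\<lambda>t. ?g t + b k * e k t) i = m f i + (\<Sum>k\<in>insert k J. b k * m (e k) i)"
        if "i \<in> I" for i
        using m[OF g(1) ek that, of "b k"] bspec[OF g(2) that] insert.hyps by simp
      show "\<Phi> (\<lambda>t. ?g t + b k * e k t) \<le> \<Phi> f + (\<Sum>k\<in>insert k J. \<bar>b k\<bar> * N (e k))"
        using lipschitz[OF g(1) ek, of "b k"] g(3) insert.hyps by simp
    qed
  qed (use f in auto)
  let ?g = "\<lambda>t. f t + (\<Sum>k\<in>I. b k * e k t)"
  have "m ?g i = c i" if "i \<in> I" for i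
  proof -
    have "(\<Sum>k\<in>I. b k * m (e k) i) = (\<Sum>k\<in>I. if k = i then b k else 0)"
      using that e(2) by (intro sum.cong) auto
    also have "\<dots> = b i" using that \<open>finite I\<close> by simp
    finally show ?thesis using corr[OF subset_refl] that by (simp add: b_def)
  qed
  moreover have "\<Phi> ?g < r'"
  proof -
    have "(\<Sum>k\<in>I. \<bar>b k\<bar> * N (e k)) \<le> (\<Sum>k\<in>I. \<eta> * \<bar>N (e k)\<bar>)"
    proof (rule sum_mono)
      fix k assume k: "k \<in> I"
      have "\<bar>b k\<bar> * N (e k) \<le> \<bar>b k\<bar> * \<bar>N (e k)\<bar>" by (rule mult_left_mono) auto
      also have "\<dots> \<le> \<eta> * \<bar>N (e k)\<bar>" by (rule mult_right_mono) (auto simp: b k)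
      finally show "\<bar>b k\<bar> * N (e k) \<le> \<eta> * \<bar>N (e k)\<bar>" .
    qed
    also have "\<dots> \<le> \<eta> * (1 + (\<Sum>k\<in>I. \<bar>N (e k)\<bar>))"
      using \<eta> by (simp add: sum_distrib_left algebra_simps)
    also have "\<dots> = r' - r" using pos by (simp add: \<eta>_def)
    finally show ?thesis using corr[OF subset_refl] f(2) by linarith
  qed
  ultimately show ?thesis using corr[OF subset_refl] by blast
qed

lemma compact_coordinate_box: "compact {a :: 'k \<Rightarrow> real. \<forall>k. \<bar>a k\<bar> \<le> M k}"
proof -
  have "compactin (product_topology (\<lambda>_. euclidean) UNIV) (PiE UNIV (\<lambda>k. {- M k..M k}))"
    unfolding compactin_PiE by simp
  moreover have "PiE UNIV (\<lambda>k. {- M k..M k}) = {a. \<forall>k. \<bar>a k\<bar> \<le> M k}"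
    by (auto simp: PiE_iff abs_le_iff minus_le_iff)
  ultimately show ?thesis by (simp add: euclidean_product_topology)
qed

section \<open>Polynomials in a decaying exponential\<close>

definition decay :: "real poly \<Rightarrow> real \<Rightarrow> real" where
  "decay p t = exp (- t) * poly p (exp (- t))"

lemma decay_add_smult: "decay (p + smult c q) = (\<lambda>t. decay p t + c * decay q t)"
  by (auto simp: decay_def algebra_simps)

lemma decay_continuous: "continuous_on A (decay p)"
  unfolding decay_def by (intro continuous_intros)

lemma decay_tendsto_0: "(decay p \<longlongrightarrow> 0) at_top"
proof -
  have "((\<lambda>t :: real. exp (- t)) \<longlongrightarrow> 0) at_top" 
    by (rule filterlim_compose[OF exp_at_bot filterlim_uminus_at_bot_at_top])
  hence "((\<lambda>t. exp (- t) * poly p (exp (- t))) \<longlongrightarrow> 0 * poly p 0) at_top"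
    by (intro tendsto_intros)
  thus ?thesis by (simp add: decay_def[abs_def])
qed

lemma decay_bounded: "\<exists>B. \<forall>t\<ge>0. \<bar>decay p t\<bar> \<le> B"
proof -
  have "compact ((\<lambda>x. x * poly p x) ` {0..1})"
    by (intro compact_continuous_image continuous_intros) auto
  then obtain B where B: "\<And>x. x \<in> {0..1} \<Longrightarrow> \<bar>x * poly p x\<bar> \<le> B"
    using compact_imp_bounded bounded_iff by (metis imageI real_norm_def)
  have "\<bar>decay p t\<bar> \<le> B" if "t \<ge> 0" for t
    using B[of "exp (- t)"] that by (simp add: decay_def)
  thus ?thesis by blast
qed

text \<open>With \<open>x = exp (- t)\<close> the half-line becomes the interval from 0 to 1, and
  \<open>g (- ln x) / x\<close> is continuous there because it vanishes near 0. The Weierstrass theorem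
  applies to it.\<close>
lemma decay_approximates:
  assumes g: "continuous_on {0..} g" and "T \<ge> 0" and "\<And>t. T \<le> t \<Longrightarrow> g t = 0" and "\<epsilon> > 0"
  shows "\<exists>p. \<forall>t\<ge>0. \<bar>decay p t - g t\<bar> \<le> \<epsilon>"
proof -
  \<comment> \<open>cutting off at the image of T avoids the logarithm at 0; beyond it both sides vanish\<close>
  let ?m = "\<lambda>x. max x (exp (- T))"
  define h where "h = (\<lambda>x. g (- ln (?m x)) / ?m x)"
  have m_pos: "?m x > 0" for x by (simp add: less_max_iff_disj)
  have "continuous_on {0..1} (\<lambda>x. g (- ln (?m x)))"
  proof (rule continuous_on_compose2[OF g])
    have "?m x \<noteq> 0" for x using m_pos[of x] by simp
    thus "continuous_on {0..1} (\<lambda>x. - ln (?m x))"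
      by (intro continuous_intros) auto
    show "(\<lambda>x. - ln (?m x)) ` {0..1} \<subseteq> {0..}"
      using m_pos \<open>T \<ge> 0\<close> by (auto simp: ln_le_zero_iff)
  qed
  hence "continuous_on {0..1} h"
    unfolding h_def using m_pos by (intro continuous_intros) (auto simp: less_imp_neq[THEN not_sym])
  from Stone_Weierstrass_real_polynomial_function[OF compact_Icc this \<open>\<epsilon> > 0\<close>]
  obtain q where "real_polynomial_function q" and q: "\<And>x. x \<in> {0..1} \<Longrightarrow> \<bar>h x - q x\<bar> < \<epsilon>" by blast
  then obtain a n where a: "q = (\<lambda>x. \<Sum>i\<le>n. a i * x ^ i)"
    unfolding real_polynomial_function_iff_sum by blast
  define p where "p = (\<Sum>i\<le>n. monom (a i) i)"
  have p: "poly p x = q x" for x by (simp add: p_def a poly_sum poly_monom)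
  have "\<bar>decay p t - g t\<bar> \<le> \<epsilon>" if t: "t \<ge> 0" for t
  proof -
    have "exp (- t) * h (exp (- t)) = g t"
    proof (cases "t \<le> T")
      case True
      thus ?thesis by (simp add: h_def max_def)
    next
      case False
      thus ?thesis using assms(3)[of T] assms(3)[of t] by (simp add: h_def max_def)
    qed
    hence "decay p t - g t = exp (- t) * (q (exp (- t)) - h (exp (- t)))"
      by (simp add: decay_def p algebra_simps)
    hence "\<bar>decay p t - g t\<bar> = exp (- t) * \<bar>h (exp (- t)) - q (exp (- t))\<bar>"
      by (simp add: abs_mult abs_minus_commute)
    also have "\<dots> \<le> 1 * \<epsilon>"
      using q[of "exp (- t)"] t by (intro mult_mono) auto
    finally show ?thesis by simp
  qed
  thus ?thesis by blast
qed

lemma set_integrable_bounded_mult: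
  fixes e f :: "real \<Rightarrow> real"
  assumes "continuous_on {0..} e" "continuous_on {0..} f" "set_integrable lborel {0..} f"
    and "\<And>t. 0 \<le> t \<Longrightarrow> \<bar>e t\<bar> \<le> B"
  shows "set_integrable lborel {0..} (\<lambda>t. e t * f t)"
proof (rule set_integrable_dominated)
  show "set_integrable lborel {0..} (\<lambda>t. B * \<bar>f t\<bar>)"
    using assms(3) by (intro set_integrable_mult_right set_integrable_abs)
  show "continuous_on {0..} (\<lambda>t. e t * f t)" using assms by (intro continuous_intros)
  show "norm (e t * f t) \<le> B * \<bar>f t\<bar>" if "0 \<le> t" for t
    using assms(4)[OF that] by (simp add: abs_mult mult_right_mono)
qed

lemma set_integrable_decay_mult:
  assumes "continuous_on {0..} f" "set_integrable lborel {0..} f"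
  shows "set_integrable lborel {0..} (\<lambda>t. decay p t * f t)"
  using decay_bounded[of p] set_integrable_bounded_mult[OF decay_continuous assms] by blast

lemma pos_neg_part_limit:
  fixes x :: real
  assumes "n * \<bar>x\<bar> \<ge> 1 \<or> x = 0"
  shows "(b * min 1 (n * max x 0) - a * min 1 (n * max (- x) 0)) * x = b * max x 0 + a * max (- x) 0"
  using assms by (cases "x > 0"; cases "x = 0") (auto simp: max_def min_def abs_if)

text \<open>The support function of a box of admissible signals, computed with decaying exponential
  polynomials alone. The pointwise maximiser switches between \<open>\<beta>\<close> and
  \<open>- \<alpha>\<close> with the sign of \<open>f\<close>. It is replaced by continuous
  functions of compact support, and these by exponential polynomials, which may leave the box by
  \<open>\<epsilon>\<close>. The upper edge is a function, so that an unbounded reference can occur in it.\<close>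
lemma decay_support:
  assumes f: "continuous_on {0..} f" "set_integrable lborel {0..} f"
    and \<beta>: "continuous_on {0..} \<beta>" "\<And>t. 0 \<le> t \<Longrightarrow> 0 \<le> \<beta> t"
      "set_integrable lborel {0..} (\<lambda>t. \<beta> t * f t)"
    and "\<alpha> \<ge> 0" "\<epsilon> > 0"
    and bound: "\<And>p. (\<And>t. 0 \<le> t \<Longrightarrow> - \<alpha> - \<epsilon> \<le> decay p t \<and> decay p t \<le> \<beta> t + \<epsilon>) \<Longrightarrow>
      pairing (decay p) f \<le> B"
  shows "(LINT t:{0..}|lborel. \<beta> t * max (f t) 0 + \<alpha> * max (- f t) 0) \<le> B"
proof -
  \<comment> \<open>a cut-off at n times a ramp of slope n in place of the sign of f\<close>
  define g where "g = (\<lambda>n t. max 0 (min 1 (real n - t)) *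
      (\<beta> t * min 1 (real n * max (f t) 0) - \<alpha> * min 1 (real n * max (- f t) 0)))"
  have g_bounds: "- \<alpha> \<le> g n t \<and> g n t \<le> \<beta> t" if t: "0 \<le> t" for n t
  proof -
    define c where "c = max 0 (min 1 (real n - t))"
    have c: "0 \<le> c" "c \<le> 1" by (auto simp: c_def)
    have 1: "0 \<le> \<beta> t * min 1 (real n * max (f t) 0)" "\<beta> t * min 1 (real n * max (f t) 0) \<le> \<beta> t * 1"
      using \<beta>(2)[OF t] by (auto intro!: mult_nonneg_nonneg mult_left_le)
    have 2: "0 \<le> \<alpha> * min 1 (real n * max (- f t) 0)" "\<alpha> * min 1 (real n * max (- f t) 0) \<le> \<alpha> * 1"
      using \<open>\<alpha> \<ge> 0\<close> by (auto intro!: mult_nonneg_nonneg mult_left_le)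
    have clip: "- \<alpha> \<le> c * x \<and> c * x \<le> \<beta> t" if "- \<alpha> \<le> x" "x \<le> \<beta> t" for x
    proof (cases "x \<ge> 0")
      case True
      have "0 \<le> c * x" "c * x \<le> 1 * x" 
        using c True mult_right_mono[of c 1 x] by auto
      thus ?thesis using that \<open>\<alpha> \<ge> 0\<close> by linarith
    next
      case False
      have "c * x \<le> 0" "1 * x \<le> c * x"
        using c False mult_right_mono_neg[of c 1 x] by (auto simp: mult_le_0_iff)
      thus ?thesis using that \<beta>(2)[OF t] by linarith
    qed
    show ?thesis unfolding g_def c_def[symmetric] using 1 2 by (intro clip) linarith+
  qed
  have g_cont: "continuous_on {0..} (g n)" for n
    unfolding g_def by (intro continuous_intros f \<beta>)
  have "\<exists>p. \<forall>t\<ge>0. \<bar>decay p t - g n t\<bar> \<le> min \<epsilon> (inverse (real (Suc n)))" for n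
    by (rule decay_approximates[OF g_cont, of "real n"]) (use \<open>\<epsilon> > 0\<close> in \<open>auto simp: g_def\<close>)
  then obtain p where "\<And>n. \<forall>t\<ge>0. \<bar>decay (p n) t - g n t\<bar> \<le> min \<epsilon> (inverse (real (Suc n)))" by metis
  hence p: "\<bar>decay (p n) t - g n t\<bar> \<le> \<epsilon>" "\<bar>decay (p n) t - g n t\<bar> \<le> inverse (real (Suc n))"
    if "t \<ge> 0" for n t using that by auto
  have p_bounds: "- \<alpha> - \<epsilon> \<le> decay (p n) t \<and> decay (p n) t \<le> \<beta> t + \<epsilon>" if "0 \<le> t" for n t
    using p(1)[OF that, of n] g_bounds[OF that, of n] by (auto simp: abs_le_iff)
  let ?h = "\<lambda>t. \<beta> t * max (f t) 0 + \<alpha> * max (- f t) 0"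
  have g_lim: "(\<lambda>n. g n t * f t) \<longlonglongrightarrow> ?h t" if "t \<ge> 0" for t
  proof -
    obtain N1 :: nat where N1: "t + 1 \<le> real N1" using real_arch_simple by blast
    obtain N2 :: nat where N2: "inverse \<bar>f t\<bar> \<le> real N2" using real_arch_simple by blast
    have "g n t * f t = ?h t" if n: "n \<ge> max N1 N2" for n
    proof -
      have "real N1 \<le> real n" "real N2 \<le> real n" using n by auto
      hence "max 0 (min 1 (real n - t)) = 1" using N1 by (auto simp: max_def min_def)
      moreover have "real n * \<bar>f t\<bar> \<ge> 1 \<or> f t = 0"
      proof (cases "f t = 0")
        case False
        have "inverse \<bar>f t\<bar> \<le> real n" using N2 \<open>real N2 \<le> real n\<close> by linarith
        thus ?thesis using False by (simp add: field_simps)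
      qed simp
      ultimately show ?thesis using pos_neg_part_limit[of "real n" "f t" "\<beta> t" \<alpha>] by (simp add: g_def)
    qed
    thus ?thesis by (intro tendsto_eventually eventually_sequentiallyI)
  qed
  have p_lim: "(\<lambda>n. decay (p n) t * f t) \<longlonglongrightarrow> ?h t" if t: "t \<ge> 0" for t
  proof -
    have "(\<lambda>n. decay (p n) t - g n t) \<longlonglongrightarrow> 0"
      by (rule Lim_null_comparison[OF _ LIMSEQ_inverse_real_of_nat]) (use p(2)[OF t] in auto)
    hence "(\<lambda>n. (decay (p n) t - g n t) * f t + g n t * f t) \<longlonglongrightarrow> 0 * f t + ?h t"
      by (intro tendsto_intros g_lim t)
    thus ?thesis by (simp add: algebra_simps)
  qed
  have "(\<lambda>n. LINT t:{0..}|lborel. decay (p n) t * f t) \<longlonglongrightarrow> (LINT t:{0..}|lborel. ?h t)"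
    unfolding set_lebesgue_integral_def
  proof (rule integral_dominated_convergence)
    have \<beta>f: "set_integrable lborel {0..} (\<lambda>t. \<bar>\<beta> t * f t\<bar>)" using \<beta>(3) by (rule set_integrable_abs)
    have \<alpha>f: "set_integrable lborel {0..} (\<lambda>t. (\<alpha> + \<epsilon>) * \<bar>f t\<bar>)"
      using f(2) by (intro set_integrable_mult_right set_integrable_abs)
    show "integrable lborel (\<lambda>t. indicator {0..} t *\<^sub>R (\<bar>\<beta> t * f t\<bar> + (\<alpha> + \<epsilon>) * \<bar>f t\<bar>))"
      using set_integral_add(1)[OF \<beta>f \<alpha>f] by (simp add: set_integrable_def)
    show "(\<lambda>t. indicator {0..} t *\<^sub>R (decay (p n) t * f t)) \<in> borel_measurable lborel" for n
      using set_integrable_decay_mult[OF f, of "p n"] by (auto simp: set_integrable_def)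
    have "set_borel_measurable borel {0..} ?h"
      by (intro set_measurable_continuous_on) (auto intro!: continuous_intros f \<beta>)
    thus "(\<lambda>t. indicator {0..} t *\<^sub>R ?h t) \<in> borel_measurable lborel"
      by (simp add: set_borel_measurable_def)
    show "AE t in lborel. (\<lambda>n. indicator {0..} t *\<^sub>R (decay (p n) t * f t)) \<longlonglongrightarrow> indicator {0..} t *\<^sub>R ?h t"
      using p_lim by (intro AE_I2) (auto simp: indicator_def)
    have "\<bar>decay (p n) t * f t\<bar> \<le> \<bar>\<beta> t * f t\<bar> + (\<alpha> + \<epsilon>) * \<bar>f t\<bar>" if "t \<ge> 0" for n t
    proof -
      have "\<bar>decay (p n) t\<bar> \<le> \<beta> t + (\<alpha> + \<epsilon>)"
        using p_bounds[OF that, of n] \<beta>(2)[OF that] \<open>\<alpha> \<ge> 0\<close> \<open>\<epsilon> > 0\<close> by (auto simp: abs_le_iff)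
      hence "\<bar>decay (p n) t\<bar> * \<bar>f t\<bar> \<le> (\<beta> t + (\<alpha> + \<epsilon>)) * \<bar>f t\<bar>" by (rule mult_right_mono) simp
      thus ?thesis using \<beta>(2)[OF that] by (simp add: abs_mult algebra_simps)
    qed
    thus "AE t in lborel. norm (indicator {0..} t *\<^sub>R (decay (p n) t * f t))
        \<le> indicator {0..} t *\<^sub>R (\<bar>\<beta> t * f t\<bar> + (\<alpha> + \<epsilon>) * \<bar>f t\<bar>)" for n
      by (intro AE_I2) (auto simp: indicator_def)
  qed
  moreover have "(LINT t:{0..}|lborel. decay (p n) t * f t) \<le> B" for n
    using bound[of "p n"] p_bounds by (simp add: pairing_def)
  ultimately show ?thesis by (intro LIMSEQ_le_const2) auto
qed

lemma nonneg_integral_le_0_imp_0: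
  fixes f :: "real \<Rightarrow> real"
  assumes "continuous_on {0..} f" "set_integrable lborel {0..} f" "\<And>t. 0 \<le> t \<Longrightarrow> 0 \<le> f t"
    and "(LINT t:{0..}|lborel. f t) \<le> 0" and "0 \<le> t"
  shows "f t = 0"
proof -
  have int: "set_integrable lborel {0..t + 1} f"
    by (rule set_integrable_subset[OF assms(2)]) auto
  have cont: "continuous_on {0..t + 1} f" by (rule continuous_on_subset[OF assms(1)]) auto
  have "(LINT t:{0..t + 1}|lborel. f t) \<le> (LINT t:{0..}|lborel. f t)"
    unfolding set_lebesgue_integral_def
    by (rule integral_mono) (use int assms(2,3) in \<open>auto simp: set_integrable_def indicator_def\<close>)
  moreover have "(LINT t:{0..t + 1}|lborel. f t) \<ge> 0"
    unfolding set_lebesgue_integral_def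
    by (rule integral_nonneg_AE) (use assms(3) in \<open>auto simp: indicator_def\<close>)
  ultimately have "integral {0..t + 1} f = 0"
    using set_borel_integral_eq_integral(2)[OF int] assms(4) by simp
  thus ?thesis using integral_eq_0_iff[OF cont] assms(3,5) by auto
qed

section \<open>Exponential modes\<close>

text \<open>Comparing the relation at \<open>t + h\<close> with \<open>exp (- (s0 * h))\<close> times
  the relation at \<open>t\<close> eliminates the term of \<open>s0\<close> and keeps the others up to the
  factors \<open>exp (- (s * h)) - exp (- (s0 * h))\<close>. A suitable \<open>h\<close> makes such a
  factor nonzero.\<close>
lemma complex_exponentials_independent:
  fixes c :: "complex \<Rightarrow> complex"
  assumes "finite S" "\<And>t. 0 \<le> t \<Longrightarrow> (\<Sum>s\<in>S. c s * exp (- (s * complex_of_real t))) = 0"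
  shows "\<forall>s\<in>S. c s = 0"
  using assms
proof (induction S arbitrary: c rule: finite_induct)
  case (insert s0 S)
  have step: "c s * (exp (- (s * complex_of_real h)) - exp (- (s0 * complex_of_real h))) = 0"
    if "h \<ge> 0" "s \<in> S" for h s
  proof -
    let ?c = "\<lambda>s. c s * (exp (- (s * complex_of_real h)) - exp (- (s0 * complex_of_real h)))"
    have "(\<Sum>s\<in>S. ?c s * exp (- (s * complex_of_real t))) = 0" if t: "0 \<le> t" for t
    proof -
      have "(\<Sum>s\<in>S. ?c s * exp (- (s * complex_of_real t)))
          = (\<Sum>s\<in>insert s0 S. ?c s * exp (- (s * complex_of_real t)))"
        using insert.hyps by simp
      also have "\<dots> = (\<Sum>s\<in>insert s0 S. c s * exp (- (s * complex_of_real (t + h)))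
          - exp (- (s0 * complex_of_real h)) * (c s * exp (- (s * complex_of_real t))))"
        by (intro sum.cong) (auto simp: algebra_simps exp_add exp_diff exp_minus divide_simps)
      also have "\<dots> = (\<Sum>s\<in>insert s0 S. c s * exp (- (s * complex_of_real (t + h))))
          - exp (- (s0 * complex_of_real h)) * (\<Sum>s\<in>insert s0 S. c s * exp (- (s * complex_of_real t)))"
        unfolding sum_subtractf sum_distrib_left ..
      also have "\<dots> = 0"
        using insert.prems[of t] insert.prems[of "t + h"] t \<open>h \<ge> 0\<close> by simp
      finally show ?thesis .
    qed
    from insert.IH[of ?c, OF this] that(2) show ?thesis by blast
  qed
  have zero: "c s = 0" if s: "s \<in> S" for s
  proof -
    define d where "d = s0 - s"
    \<comment> \<open>a number of modulus 1 is not a multiple of 2 pi i unless it is 0, so its exponential is not 1\<close>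
    define w where "w = d * complex_of_real (1 / norm d)"
    have d: "d \<noteq> 0" using s insert.hyps by (auto simp: d_def)
    hence "norm w = 1" by (simp add: w_def norm_mult norm_divide)
    have "exp w \<noteq> 1"
    proof
      assume "exp w = 1"
      then obtain n where n: "Re w = 0" "Im w = of_int (2 * n) * pi"
        using exp_eq_1[of w] by blast
      have "\<bar>Im w\<bar> = 1" using \<open>norm w = 1\<close> n(1) by (simp add: cmod_eq_Im)
      moreover have "\<bar>of_int (2 * n) * pi\<bar> = 2 * pi * \<bar>of_int n\<bar>" by (simp add: abs_mult)
      moreover have "n = 0 \<or> \<bar>real_of_int n\<bar> \<ge> 1" by linarith
      moreover have "2 * pi * 1 \<le> 2 * pi * \<bar>of_int n\<bar>" if "\<bar>real_of_int n\<bar> \<ge> 1"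
        using that by (intro mult_left_mono) auto
      ultimately show False using n(2) pi_gt3 by auto
    qed
    moreover have "exp w = exp (- (s * complex_of_real (1 / norm d))) / exp (- (s0 * complex_of_real (1 / norm d)))"
      by (simp add: w_def d_def exp_diff[symmetric] algebra_simps diff_divide_distrib)
    ultimately have "exp (- (s * complex_of_real (1 / norm d))) - exp (- (s0 * complex_of_real (1 / norm d))) \<noteq> 0"
      by auto
    thus ?thesis using step[of "1 / norm d" s] s by simp
  qed
  have "(\<Sum>s\<in>insert s0 S. c s * exp (- (s * complex_of_real 0))) = c s0"
    using zero insert.hyps by simp
  hence "c s0 = 0" using insert.prems[of 0] by simp
  thus ?case using zero by blast
qed auto

definition mode :: "complex \<times> bool \<Rightarrow> real \<Rightarrow> real" where
  "mode k t = exp (- Re (fst k) * t) * (if snd k then cos (Im (fst k) * t) else sin (Im (fst k) * t))"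

text \<open>For a real exponent the sine vanishes identically and is left out, so that the
  modes are independent.\<close>
definition modes :: "complex set \<Rightarrow> (complex \<times> bool) set" where
  "modes R = {(z, b). z \<in> R \<and> (b \<or> Im z \<noteq> 0)}"

definition comb :: "(complex \<times> bool) set \<Rightarrow> (complex \<times> bool \<Rightarrow> real) \<Rightarrow> real \<Rightarrow> real" where
  "comb I a t = (\<Sum>k\<in>I. a k * mode k t)"

definition conj_free :: "complex set \<Rightarrow> bool" where
  "conj_free R \<longleftrightarrow> (\<forall>z\<in>R. cnj z \<in> R \<longrightarrow> cnj z = z)"

lemma finite_modes [simp]: "finite R \<Longrightarrow> finite (modes R)"
  by (rule finite_subset[of _ "R \<times> UNIV"]) (auto simp: modes_def)

lemma modes_Un: "modes (A \<union> B) = modes A \<union> modes B"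
  by (auto simp: modes_def)

lemma modes_disjoint: "A \<inter> B = {} \<Longrightarrow> modes A \<inter> modes B = {}"
  by (auto simp: modes_def)

lemma comb_modes:
  assumes "finite R"
  shows "comb (modes R) a t = (\<Sum>z\<in>R. a (z, True) * (exp (- Re z * t) * cos (Im z * t))
    + a (z, False) * (exp (- Re z * t) * sin (Im z * t)))"
proof -
  have "comb (modes R) a t = (\<Sum>k\<in>R \<times> UNIV. a k * mode k t)"
    unfolding comb_def using assms
    by (intro sum.mono_neutral_left) (auto simp: modes_def mode_def)
  also have "\<dots> = (\<Sum>z\<in>R. \<Sum>b\<in>UNIV. a (z, b) * mode (z, b) t)"
    by (simp add: sum.cartesian_product)
  finally show ?thesis by (simp add: UNIV_bool mode_def add.commute)
qed

lemma exp_trig_span_eq: "finite R \<Longrightarrow> exp_trig_span R = range (comb (modes R))"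
proof (intro equalityI subsetI)
  fix f assume R: "finite R" and "f \<in> exp_trig_span R"
  then obtain a b where f: "f = (\<lambda>t. \<Sum>z\<in>R. a z * (exp (- Re z * t) * cos (Im z * t))
      + b z * (exp (- Re z * t) * sin (Im z * t)))"
    unfolding exp_trig_span_def by blast
  have "f = comb (modes R) (\<lambda>(z, c). if c then a z else b z)"
    unfolding f by (rule ext) (simp add: comb_modes[OF R])
  thus "f \<in> range (comb (modes R))" by blast
next
  fix f assume R: "finite R" and "f \<in> range (comb (modes R))"
  then obtain a where "f = comb (modes R) a" by blast
  hence "f = (\<lambda>t. \<Sum>z\<in>R. a (z, True) * (exp (- Re z * t) * cos (Im z * t))
    + a (z, False) * (exp (- Re z * t) * sin (Im z * t)))"
    by (simp add: fun_eq_iff comb_modes[OF R])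
  thus "f \<in> exp_trig_span R"
    unfolding exp_trig_span_def mem_Collect_eq
    by (intro exI[of _ "\<lambda>z. a (z, True)"] exI[of _ "\<lambda>z. a (z, False)"]) simp
qed

text \<open>In complex form the combination is a sum over the exponents and their conjugates, with
  conjugate coefficients. The conjugate of a nonreal exponent is a new exponent, so that
  independence of the complex exponentials determines the whole coefficient; a real exponent
  coincides with its conjugate, and only the real part of its coefficient, which belongs to the
  cosine, is determined.\<close>
lemma modes_independent:
  assumes R: "finite R" "conj_free R" and zero: "\<And>t. 0 \<le> t \<Longrightarrow> comb (modes R) a t = 0"
  shows "\<forall>k\<in>modes R. a k = 0"
proof -
  define \<gamma> where "\<gamma> = (\<lambda>z. Complex (a (z, True) / 2) (a (z, False) / 2))"
  define C where "C = (\<lambda>s. (if s \<in> R then \<gamma> s else 0) + (if s \<in> cnj ` R then cnj (\<gamma> (cnj s)) else 0))"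
  have "(\<Sum>s\<in>R \<union> cnj ` R. C s * exp (- (s * complex_of_real t))) = 0" if "t \<ge> 0" for t
  proof -
    have "(\<Sum>s\<in>R \<union> cnj ` R. C s * exp (- (s * complex_of_real t)))
        = (\<Sum>s\<in>R \<union> cnj ` R. if s \<in> R then \<gamma> s * exp (- (s * complex_of_real t)) else 0)
        + (\<Sum>s\<in>R \<union> cnj ` R. if s \<in> cnj ` R then cnj (\<gamma> (cnj s)) * exp (- (s * complex_of_real t)) else 0)"
      unfolding sum.distrib[symmetric] by (intro sum.cong) (auto simp: C_def algebra_simps)
    also have "\<dots> = (\<Sum>s\<in>R. \<gamma> s * exp (- (s * complex_of_real t)))
        + (\<Sum>s\<in>cnj ` R. cnj (\<gamma> (cnj s)) * exp (- (s * complex_of_real t)))"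
      using R(1) by (simp add: sum.If_cases Int_absorb1 Int_absorb2)
    also have "(\<Sum>s\<in>cnj ` R. cnj (\<gamma> (cnj s)) * exp (- (s * complex_of_real t)))
        = (\<Sum>z\<in>R. cnj (\<gamma> z) * exp (- (cnj z * complex_of_real t)))"
      by (subst sum.reindex) (auto intro: inj_onI)
    also have "(\<Sum>s\<in>R. \<gamma> s * exp (- (s * complex_of_real t))) + \<dots>
        = (\<Sum>z\<in>R. complex_of_real (a (z, True) * (exp (- Re z * t) * cos (Im z * t))
          + a (z, False) * (exp (- Re z * t) * sin (Im z * t))))"
      unfolding sum.distrib[symmetric]
      by (intro sum.cong) (auto simp: \<gamma>_def complex_eq_iff Re_exp Im_exp algebra_simps)
    also have "\<dots> = complex_of_real (comb (modes R) a t)"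
      by (simp add: comb_modes[OF R(1)])
    finally show ?thesis using zero[OF that] by simp
  qed
  hence C: "\<forall>s\<in>R \<union> cnj ` R. C s = 0"
    using R(1) by (intro complex_exponentials_independent) auto
  show ?thesis
  proof
    fix k assume "k \<in> modes R"
    then obtain z b where k: "k = (z, b)" "z \<in> R" "b \<or> Im z \<noteq> 0" by (auto simp: modes_def)
    have Cz: "C z = 0" using C k by blast
    show "a k = 0"
    proof (cases "Im z = 0")
      case True
      hence "cnj z = z" by (simp add: complex_eq_iff)
      hence "z \<in> cnj ` R" using k(2) by (metis imageI)
      hence "\<gamma> z + cnj (\<gamma> z) = 0" using Cz k(2) \<open>cnj z = z\<close> by (simp add: C_def)
      thus ?thesis using k True by (simp add: \<gamma>_def complex_eq_iff)
    next
      case False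
      hence "cnj z \<noteq> z" by (simp add: complex_eq_iff)
      hence "cnj z \<notin> R" using R(2) k(2) by (auto simp: conj_free_def)
      hence "z \<notin> cnj ` R" by auto
      hence "\<gamma> z = 0" using Cz k(2) by (simp add: C_def)
      thus ?thesis using k by (cases b) (auto simp: \<gamma>_def complex_eq_iff)
    qed
  qed
qed

lemma comb_Un:
  assumes "finite A" "finite B" "A \<inter> B = {}"
  shows "comb (modes (A \<union> B)) a t = comb (modes A) a t + comb (modes B) a t"
  unfolding modes_Un comb_def using assms by (intro sum.union_disjoint) (auto simp: modes_disjoint)

lemma comb_cong: "(\<And>k. k \<in> I \<Longrightarrow> a k = b k) \<Longrightarrow> comb I a = comb I b"
  unfolding comb_def by (intro ext sum.cong) auto

lemma comb_merge:
  assumes "finite A" "finite B" "A \<inter> B = {}"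
  shows "(\<lambda>t. comb (modes A) a t + comb (modes B) b t)
    = comb (modes (A \<union> B)) (\<lambda>k. if fst k \<in> A then a k else b k)"
proof
  fix t
  have "comb (modes A) (\<lambda>k. if fst k \<in> A then a k else b k) = comb (modes A) a"
    by (rule comb_cong) (auto simp: modes_def)
  moreover have "comb (modes B) (\<lambda>k. if fst k \<in> A then a k else b k) = comb (modes B) b"
    using assms(3) by (intro comb_cong) (auto simp: modes_def)
  ultimately show "comb (modes A) a t + comb (modes B) b t
    = comb (modes (A \<union> B)) (\<lambda>k. if fst k \<in> A then a k else b k) t"
    by (simp add: comb_Un[OF assms])
qed

lemma fun_sum_exp_trig_span:
  assumes "finite A" "finite B" "A \<inter> B = {}"
  shows "fun_sum (exp_trig_span A) (exp_trig_span B) = exp_trig_span (A \<union> B)"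
proof -
  have "fun_sum (range (comb (modes A))) (range (comb (modes B))) = range (comb (modes (A \<union> B)))"
  proof (intro equalityI subsetI)
    fix f assume "f \<in> fun_sum (range (comb (modes A))) (range (comb (modes B)))"
    then obtain a b where "f = (\<lambda>t. comb (modes A) a t + comb (modes B) b t)"
      by (auto simp: fun_sum_def)
    thus "f \<in> range (comb (modes (A \<union> B)))" unfolding comb_merge[OF assms] by blast
  next
    fix f assume "f \<in> range (comb (modes (A \<union> B)))"
    then obtain a where "f = comb (modes (A \<union> B)) a" by blast
    hence "f = (\<lambda>t. comb (modes A) a t + comb (modes B) a t)"
      by (simp add: fun_eq_iff comb_Un[OF assms])
    thus "f \<in> fun_sum (range (comb (modes A))) (range (comb (modes B)))"
      by (auto simp: fun_sum_def)
  qed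
  thus ?thesis using assms by (simp add: exp_trig_span_eq)
qed

lemma projector_comb:
  assumes AB: "finite A" "finite B" "A \<inter> B = {}" and "conj_free (A \<union> B)"
  shows "projector (exp_trig_span A) (exp_trig_span B) (comb (modes (A \<union> B)) a) = comb (modes A) a"
  unfolding projector_def exp_trig_span_eq[OF AB(1)] exp_trig_span_eq[OF AB(2)]
proof (rule the_equality)
  show "comb (modes A) a \<in> range (comb (modes A)) \<and>
      (\<exists>b\<in>range (comb (modes B)). comb (modes (A \<union> B)) a = (\<lambda>t. comb (modes A) a t + b t))"
    by (auto simp: fun_eq_iff comb_Un[OF AB])
next
  fix u assume "u \<in> range (comb (modes A)) \<and>
      (\<exists>b\<in>range (comb (modes B)). comb (modes (A \<union> B)) a = (\<lambda>t. u t + b t))"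
  then obtain a' b' where u: "u = comb (modes A) a'"
    and eq: "comb (modes (A \<union> B)) a = (\<lambda>t. comb (modes A) a' t + comb (modes B) b' t)" by blast
  define m where "m = (\<lambda>k. if fst k \<in> A then a' k else b' k)"
  have eq': "comb (modes (A \<union> B)) a = comb (modes (A \<union> B)) m"
    unfolding eq comb_merge[OF AB] m_def ..
  have "\<forall>k\<in>modes (A \<union> B). (\<lambda>k. a k - m k) k = 0"
  proof (rule modes_independent)
    show "comb (modes (A \<union> B)) (\<lambda>k. a k - m k) t = 0" for t
      using fun_cong[OF eq', of t] by (simp add: comb_def left_diff_distrib sum_subtractf)
  qed (use AB assms(4) in auto)
  hence "\<forall>k\<in>modes A. a' k = a k" by (auto simp: modes_def m_def)
  thus "u = comb (modes A) a" unfolding u by (intro comb_cong) auto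
qed

lemma mode_continuous: "continuous_on S (mode k)"
  unfolding mode_def by (cases "snd k") (auto intro!: continuous_intros)

lemma mode_integrable:
  assumes "Re (fst k) > 0"
  shows "set_integrable lborel {0..} (mode k)"
proof (rule set_integrable_dominated[OF set_integrable_exp_decay[OF assms] mode_continuous])
  show "norm (mode k t) \<le> exp (- Re (fst k) * t)" for t
    using abs_cos_le_one[of "Im (fst k) * t"] abs_sin_le_one[of "Im (fst k) * t"]
    by (auto simp: mode_def abs_mult mult_left_le)
qed

lemma comb_continuous: "continuous_on S (comb I a)"
  unfolding comb_def by (intro continuous_intros mode_continuous)

lemma set_integral_sum:
  fixes f :: "'i \<Rightarrow> 'a \<Rightarrow> real"
  assumes "finite I" "\<And>i. i \<in> I \<Longrightarrow> set_integrable M A (f i)"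
  shows "set_integrable M A (\<lambda>t. \<Sum>i\<in>I. f i t)"
    and "(LINT t:A|M. (\<Sum>i\<in>I. f i t)) = (\<Sum>i\<in>I. LINT t:A|M. f i t)"
proof -
  have int: "integrable M (\<lambda>t. indicator A t *\<^sub>R f i t)" if "i \<in> I" for i
    using assms(2)[OF that] by (simp only: set_integrable_def)
  show "set_integrable M A (\<lambda>t. \<Sum>i\<in>I. f i t)"
    unfolding set_integrable_def scaleR_sum_right
    by (rule Bochner_Integration.integrable_sum) (rule int)
  show "(LINT t:A|M. (\<Sum>i\<in>I. f i t)) = (\<Sum>i\<in>I. LINT t:A|M. f i t)"
    unfolding set_lebesgue_integral_def scaleR_sum_right
    by (rule Bochner_Integration.integral_sum) (rule int)
qed

lemma comb_integrable:
  assumes "finite R" "\<And>z. z \<in> R \<Longrightarrow> Re z > 0"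
  shows "set_integrable lborel {0..} (comb (modes R) a)"
  unfolding comb_def using assms
  by (intro set_integral_sum finite_modes set_integrable_mult_right mode_integrable) (auto simp: modes_def)

lemma pairing_comb:
  assumes "finite I" "\<And>k. k \<in> I \<Longrightarrow> pairing_defined (mode k) f"
  shows "pairing (comb I a) f = (\<Sum>k\<in>I. a k * pairing (mode k) f)"
proof -
  have int: "set_integrable lborel {0..} (\<lambda>t. a k * (mode k t * f t))" if "k \<in> I" for k
    using assms(2)[OF that] unfolding pairing_defined_def by (rule set_integrable_mult_right)
  have "pairing (comb I a) f = (LINT t:{0..}|lborel. (\<Sum>k\<in>I. a k * (mode k t * f t)))"
    unfolding pairing_def comb_def by (simp add: sum_distrib_right mult.assoc)
  also have "\<dots> = (\<Sum>k\<in>I. LINT t:{0..}|lborel. a k * (mode k t * f t))"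
    by (rule set_integral_sum[OF assms(1) int])
  finally show ?thesis by (simp add: pairing_def)
qed

lemma pairing_commute: "pairing u v = pairing v u"
  by (simp add: pairing_def mult.commute)

lemma pairing_mode_laplace:
  assumes "set_integrable lborel {0..} (\<lambda>t. exp (- (z * complex_of_real t)) * complex_of_real (f t))"
  shows "pairing (mode (z, True)) f = Re (laplace f z)"
    and "pairing (mode (z, False)) f = - Im (laplace f z)"
proof -
  let ?g = "\<lambda>t. indicator {0..} t *\<^sub>R (exp (- (z * complex_of_real t)) * complex_of_real (f t))"
  have int: "integrable lborel ?g" using assms by (simp add: set_integrable_def)
  have "Re (laplace f z) = (\<integral>t. Re (?g t) \<partial>lborel)"
    unfolding laplace_def set_lebesgue_integral_def using int by (rule integral_Re[symmetric])
  also have "\<dots> = pairing (mode (z, True)) f"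
    unfolding pairing_def set_lebesgue_integral_def
    by (intro Bochner_Integration.integral_cong) (auto simp: mode_def Re_exp)
  finally show "pairing (mode (z, True)) f = Re (laplace f z)" ..
  have "- Im (laplace f z) = - (\<integral>t. Im (?g t) \<partial>lborel)"
    unfolding laplace_def set_lebesgue_integral_def by (simp only: integral_Im[OF int])
  also have "\<dots> = (\<integral>t. - Im (?g t) \<partial>lborel)" by simp
  also have "\<dots> = pairing (mode (z, False)) f"
    unfolding pairing_def set_lebesgue_integral_def
    by (intro Bochner_Integration.integral_cong) (auto simp: mode_def Im_exp)
  finally show "pairing (mode (z, False)) f = - Im (laplace f z)" ..
qed

text \<open>The two real pairings are the real part and the negated imaginary part of the transform.
  At a real exponent the imaginary parts agree trivially, which matches the missing sine mode.\<close>
lemma mode_moments_iff_laplace: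
  assumes "set_integrable lborel {0..} (\<lambda>t. exp (- (z * complex_of_real t)) * complex_of_real (f t))"
    and "set_integrable lborel {0..} (\<lambda>t. exp (- (z * complex_of_real t)) * complex_of_real (g t))"
    and "z \<in> R"
  shows "(\<forall>b. (z, b) \<in> modes R \<longrightarrow> pairing (mode (z, b)) f = pairing (mode (z, b)) g)
    \<longleftrightarrow> laplace f z = laplace g z"
proof -
  have "Im (laplace f z) = Im (laplace g z)" if "Im z = 0"
  proof -
    have "pairing (mode (z, False)) h = 0" for h using that by (simp add: pairing_def mode_def)
    thus ?thesis using pairing_mode_laplace(2)[OF assms(1)] pairing_mode_laplace(2)[OF assms(2)] by simp
  qed
  thus ?thesis using \<open>z \<in> R\<close>
    unfolding all_bool_eq modes_def complex_eq_iff
    by (auto simp: pairing_mode_laplace[OF assms(1)] pairing_mode_laplace[OF assms(2)])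
qed

text \<open>Since \<open>1 \<le> \<bar>cos y\<bar> + \<bar>sin y\<bar>\<close>, absolute
  convergence of both real pairings gives that of the weighted integral.\<close>
lemma exp_weight_integrable:
  assumes "continuous_on {0..} f" "pairing_defined (mode (z, True)) f" "pairing_defined (mode (z, False)) f"
  shows "set_integrable lborel {0..} (\<lambda>t. exp (- Re z * t) * f t)"
proof (rule set_integrable_dominated)
  show "set_integrable lborel {0..} (\<lambda>t. \<bar>mode (z, True) t * f t\<bar> + \<bar>mode (z, False) t * f t\<bar>)"
    using assms(2,3) unfolding pairing_defined_def by (intro set_integral_add set_integrable_abs)
  show "continuous_on {0..} (\<lambda>t. exp (- Re z * t) * f t)" by (intro continuous_intros assms)
  show "norm (exp (- Re z * t) * f t) \<le> \<bar>mode (z, True) t * f t\<bar> + \<bar>mode (z, False) t * f t\<bar>" for t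
  proof -
    have "(cos (Im z * t))\<^sup>2 \<le> \<bar>cos (Im z * t)\<bar>" "(sin (Im z * t))\<^sup>2 \<le> \<bar>sin (Im z * t)\<bar>"
      using mult_left_le[of "\<bar>cos (Im z * t)\<bar>" "\<bar>cos (Im z * t)\<bar>"]
        mult_left_le[of "\<bar>sin (Im z * t)\<bar>" "\<bar>sin (Im z * t)\<bar>"]
      by (auto simp: power2_eq_square)
    hence "1 \<le> \<bar>cos (Im z * t)\<bar> + \<bar>sin (Im z * t)\<bar>"
      using sin_cos_squared_add[of "Im z * t"] by linarith
    hence "exp (- Re z * t) * \<bar>f t\<bar> * 1 \<le> exp (- Re z * t) * \<bar>f t\<bar> * (\<bar>cos (Im z * t)\<bar> + \<bar>sin (Im z * t)\<bar>)"
      by (intro mult_left_mono) auto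
    thus ?thesis by (simp add: mode_def abs_mult algebra_simps)
  qed
qed

section \<open>Error signals as solutions of an interpolation problem\<close>

lemma C0_bounded:
  assumes "e \<in> C0"
  shows "\<exists>B. \<forall>t\<ge>0. \<bar>e t\<bar> \<le> B"
proof -
  have cont: "continuous_on {0..} e" and "(e \<longlongrightarrow> 0) at_top" using assms by (auto simp: C0_def)
  hence "eventually (\<lambda>t. dist (e t) 0 < 1) at_top" by (intro tendstoD) auto
  then obtain T where T: "\<And>t. T \<le> t \<Longrightarrow> \<bar>e t\<bar> < 1"
    by (auto simp: eventually_at_top_linorder)
  have "compact (e ` {0..T})"
    by (intro compact_continuous_image continuous_on_subset[OF cont]) auto
  then obtain B where "\<forall>y\<in>e ` {0..T}. norm y \<le> B"
    using compact_imp_bounded bounded_iff by blast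
  hence B: "\<bar>e t\<bar> \<le> B" if "0 \<le> t" "t \<le> T" for t using that by auto
  have "\<bar>e t\<bar> \<le> max B 1" if "t \<ge> 0" for t
    using B[OF that] T[of t] by (cases "t \<le> T") (auto simp: le_max_iff_disj)
  thus ?thesis by blast
qed

lemma C0_exp_weight_integrable:
  assumes "e \<in> C0" "x > 0"
  shows "set_integrable lborel {0..} (\<lambda>t. exp (- x * t) * e t)"
proof -
  obtain B where "\<And>t. t \<ge> 0 \<Longrightarrow> \<bar>e t\<bar> \<le> B" using C0_bounded[OF assms(1)] by blast
  moreover have "continuous_on {0..} e" using assms(1) by (simp add: C0_def)
  ultimately have "set_integrable lborel {0..} (\<lambda>t. e t * exp (- x * t))"
    by (intro set_integrable_bounded_mult set_integrable_exp_decay assms continuous_intros)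
  thus ?thesis by (simp add: mult.commute)
qed

lemma decay_in_C0: "decay p \<in> C0"
  by (simp add: C0_def decay_continuous decay_tendsto_0)

lemma laplace_add:
  assumes "set_integrable lborel {0..} (\<lambda>t. exp (- (s * complex_of_real t)) * complex_of_real (f t))"
    and "set_integrable lborel {0..} (\<lambda>t. exp (- (s * complex_of_real t)) * complex_of_real (g t))"
  shows "set_integrable lborel {0..} (\<lambda>t. exp (- (s * complex_of_real t)) * complex_of_real (f t + g t))"
    and "laplace (\<lambda>t. f t + g t) s = laplace f s + laplace g s"
  using set_integral_add[OF assms] by (simp_all add: laplace_def distrib_left)

lemma laplace_real_exponential:
  assumes "k > 0" "0 \<le> Re s"
  shows "set_integrable lborel {0..}
      (\<lambda>t. exp (- (s * complex_of_real t)) * complex_of_real (c * exp (- k * t)))"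
    and "laplace (\<lambda>t. c * exp (- k * t)) s = complex_of_real c / (complex_of_real k + s)"
proof -
  let ?u = "s + complex_of_real k"
  have u: "Re ?u > 0" using assms by simp
  have eq: "(\<lambda>t. exp (- (s * complex_of_real t)) * complex_of_real (c * exp (- k * t)))
      = (\<lambda>t. complex_of_real c * exp (- (?u * complex_of_real t)))"
    by (auto simp: fun_eq_iff exp_of_real[symmetric] exp_add[symmetric] algebra_simps)
  have "set_integrable lborel {0..} (\<lambda>t. exp (- (?u * complex_of_real t)))"
    by (rule set_integrable_dominated[OF set_integrable_exp_decay[OF u]])
       (auto intro!: continuous_intros simp: algebra_simps)
  thus "set_integrable lborel {0..}
      (\<lambda>t. exp (- (s * complex_of_real t)) * complex_of_real (c * exp (- k * t)))"
    unfolding eq by (rule set_integrable_mult_right)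
  show "laplace (\<lambda>t. c * exp (- k * t)) s = complex_of_real c / (complex_of_real k + s)"
    unfolding laplace_def eq using laplace_exp[OF u] by (simp add: add.commute)
qed

text \<open>The transform is the sum of \<open>c / (s + k)\<close> over the monomials, where
  \<open>k\<close> is at least 1: strictly proper, and without poles in the closed right half-plane.\<close>
lemma decay_rational_laplace:
  obtains A where "at_infinity.val_ge 1 A"
    and "\<And>s. 0 \<le> Re s \<Longrightarrow> poly (rden A) s \<noteq> 0"
    and "\<And>s. 0 \<le> Re s \<Longrightarrow> laplace (decay p) s = reval A s"
    and "\<And>s. 0 \<le> Re s \<Longrightarrow> set_integrable lborel {0..}
      (\<lambda>t. exp (- (s * complex_of_real t)) * complex_of_real (decay p t))"
proof -
  let ?f = "\<lambda>n t. \<Sum>i<n. coeff p i * exp (- real (Suc i) * t)"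
  have "\<exists>A. at_infinity.val_ge 1 A \<and> (\<forall>s. 0 \<le> Re s \<longrightarrow> poly (rden A) s \<noteq> 0
      \<and> laplace (?f n) s = reval A s \<and> set_integrable lborel {0..}
        (\<lambda>t. exp (- (s * complex_of_real t)) * complex_of_real (?f n t)))" for n
  proof (induction n)
    case 0
    show ?case
      by (rule exI[of _ 0])
         (auto simp: at_infinity.val_ge_def laplace_def reval_def rnum_def rden_def set_integrable_def)
  next
    case (Suc n)
    then obtain A where A: "at_infinity.val_ge 1 A"
      and As: "\<And>s. 0 \<le> Re s \<Longrightarrow> poly (rden A) s \<noteq> 0 \<and> laplace (?f n) s = reval A s
        \<and> set_integrable lborel {0..} (\<lambda>t. exp (- (s * complex_of_real t)) * complex_of_real (?f n t))"
      by blast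
    let ?B = "Fract [:coeff p n:] [:real (Suc n), 1:]"
    have "at_infinity.val_ge 1 ?B"
    proof (cases "coeff p n = 0")
      case True
      thus ?thesis by (simp add: at_infinity.val_ge_def eq_fract Zero_fract_def)
    next
      case False
      thus ?thesis by (simp add: at_infinity.val_ge_def at_infinity.val_Fract)
    qed
    hence inf: "at_infinity.val_ge 1 (A + ?B)" using A by (rule at_infinity.val_ge_add[rotated])
    have "poly (rden (A + ?B)) s \<noteq> 0 \<and> laplace (?f (Suc n)) s = reval (A + ?B) s
        \<and> set_integrable lborel {0..} (\<lambda>t. exp (- (s * complex_of_real t)) * complex_of_real (?f (Suc n) t))"
      if s: "0 \<le> Re s" for s
    proof -
      have "complex_of_real (real (Suc n)) + s \<noteq> 0"
      proof
        assume "complex_of_real (real (Suc n)) + s = 0"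
        hence "Re (complex_of_real (real (Suc n)) + s) = 0" by simp
        thus False using s by simp
      qed
      hence nz: "poly (cpoly [:real (Suc n), 1:]) s \<noteq> 0" by (simp add: map_poly_pCons)
      have B: "poly (rden ?B) s \<noteq> 0" "reval ?B s = complex_of_real (coeff p n) / (complex_of_real (real (Suc n)) + s)"
        using reval_Fract[OF nz, of "[:coeff p n:]"] by (auto simp: map_poly_pCons)
      note exp = laplace_real_exponential[of "real (Suc n)" s "coeff p n", OF _ s]
      have "poly (rden (A + ?B)) s \<noteq> 0"
        using As[OF s] B(1) by (simp add: regular_iff at_point.val_ge_add)
      moreover have "reval (A + ?B) s = reval A s + reval ?B s"
        using As[OF s] B(1) by (intro reval_add) auto
      moreover have "?f (Suc n) = (\<lambda>t. ?f n t + coeff p n * exp (- real (Suc n) * t))" by simp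
      ultimately show ?thesis
        using laplace_add[of s "?f n" "\<lambda>t. coeff p n * exp (- real (Suc n) * t)"] As[OF s] exp B(2)
        by simp
    qed
    with inf show ?case by blast
  qed
  from this[of "Suc (degree p)"] obtain A where A: "at_infinity.val_ge 1 A"
    and As: "\<And>s. 0 \<le> Re s \<Longrightarrow> poly (rden A) s \<noteq> 0 \<and> laplace (?f (Suc (degree p))) s = reval A s
        \<and> set_integrable lborel {0..}
          (\<lambda>t. exp (- (s * complex_of_real t)) * complex_of_real (?f (Suc (degree p)) t))"
    by blast
  have "decay p = ?f (Suc (degree p))"
    unfolding decay_def poly_altdef lessThan_Suc_atMost sum_distrib_left
    by (intro ext sum.cong) (auto simp: exp_of_nat_mult[symmetric] exp_add[symmetric] algebra_simps)
  thus ?thesis using A As that[of A] by simp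
qed

text \<open>Coprime factors have no common zero, neither at a point nor at infinity.\<close>
lemma (in poly_valuation) bezout_not_both_positive:
  assumes "val_ge 0 x" "val_ge 0 v" "x * n + v * d = 1"
  shows "\<not> (val_ge 1 n \<and> val_ge 1 d)"
proof
  assume "val_ge 1 n \<and> val_ge 1 d"
  hence "val_ge 1 (x * n + v * d)"
    using val_ge_mult[OF assms(1), of 1 n] val_ge_mult[OF assms(2), of 1 d] by (simp add: val_ge_add)
  thus False by (simp add: assms(3) val_ge_def)
qed

text \<open>The orders at infinity are those forced by their sum being 1 and the order of the reference
  being positive.\<close>
locale tracking_problem =
  fixes P w_hat n d x v :: ratfun and w :: "real \<Rightarrow> real"
  assumes P_order: "zero_order_at_infinity P 0"
    and w_order: "zero_order_at_infinity w_hat 1"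
    and w_cont: "continuous_on {0..} w"
    and w_laplace: "has_laplace w w_hat"
    and off_axis: "\<And>s. s \<in> rhp_zeros P \<union> rhp_poles P \<union> rhp_zeros w_hat \<Longrightarrow> Re s \<noteq> 0"
    and simple_zeros: "\<And>s. s \<in> rhp_zeros P \<Longrightarrow> order s (rnum P) = 1"
    and simple_poles: "\<And>s. s \<in> rhp_poles P \<Longrightarrow> order s (rden P) = 1"
    and simple_w: "\<And>s. s \<in> rhp_zeros w_hat \<Longrightarrow> order s (rnum w_hat) = 1"
    and distinct: "rhp_zeros P \<inter> rhp_poles P = {}"
      "rhp_zeros P \<inter> rhp_zeros w_hat = {}" "rhp_poles P \<inter> rhp_zeros w_hat = {}"
    and factorization: "coprime_factorization P n d x v"
    and no_common_pole: "rhp_poles P \<inter> rhp_poles w_hat = {}"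
    and w_integrable: "\<And>z. z \<in> rhp_zeros P \<Longrightarrow> set_integrable lborel {0..} (\<lambda>t. exp (- Re z * t) * w t)"
begin

text \<open>At these points \<open>w_hat * d * n\<close> vanishes, so that there the transform of an
  achievable error does not depend on the parameter.\<close>
definition nodes :: "complex set" where
  "nodes = rhp_zeros P \<union> rhp_poles P \<union> rhp_zeros w_hat"

definition target :: "complex \<Rightarrow> complex" where
  "target s = (if s \<in> rhp_zeros P then reval w_hat s else 0)"

lemma nonzero: "P \<noteq> 0" "w_hat \<noteq> 0" "d \<noteq> 0" "n \<noteq> 0" and n_eq: "n = P * d"
proof -
  show "P \<noteq> 0" "w_hat \<noteq> 0" using P_order w_order by (auto simp: zero_order_at_infinity_def)
  show "d \<noteq> 0" using factorization by (auto simp: coprime_factorization_def)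
  thus "n = P * d" using factorization by (auto simp: coprime_factorization_def)
  thus "n \<noteq> 0" using \<open>P \<noteq> 0\<close> \<open>d \<noteq> 0\<close> by simp
qed

lemma bezout: "x * n + v * d = 1"
  using factorization by (auto simp: coprime_factorization_def)

lemma stable: "G \<in> {n, d, x, v} \<Longrightarrow> G \<in> stable_ratfuns"
  using factorization by (auto simp: coprime_factorization_def)

lemma stable_at: "G \<in> {n, d, x, v} \<Longrightarrow> 0 \<le> Re s \<Longrightarrow> at_point.val_ge s 0 G"
  using stable[of G] unfolding stable_iff by blast

lemma node_Re: "s \<in> nodes \<Longrightarrow> 0 < Re s"
  using off_axis[of s] by (auto simp: nodes_def rhp_zeros_def rhp_poles_def less_le)

lemma val_at_infinity_eqs:
  "at_infinity.val w_hat = 1" "at_infinity.val n = 0" "at_infinity.val d = 0"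
proof -
  show "at_infinity.val w_hat = 1" using w_order by (simp add: zero_order_at_infinity_def val_at_infinity)
  have "at_infinity.val P = 0" using P_order by (simp add: zero_order_at_infinity_def val_at_infinity)
  hence eq: "at_infinity.val n = at_infinity.val d"
    unfolding n_eq using nonzero by (simp add: at_infinity.val_mult)
  have "at_infinity.val_ge 0 n" "at_infinity.val_ge 0 x" "at_infinity.val_ge 0 v"
    using stable by (auto simp: stable_iff)
  with at_infinity.bezout_not_both_positive[OF _ _ bezout] eq
  show "at_infinity.val n = 0" "at_infinity.val d = 0"
    using nonzero unfolding at_infinity.val_ge_def by force+
qed

text \<open>The difference of the two orders is the order of the plant, and by the Bezout identity at
  most one of them is positive. So the zeros of the plant belong to \<open>n\<close> and its poles to
  \<open>d\<close>, with the same orders.\<close>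
lemma val_factors:
  assumes s: "0 \<le> Re s"
  shows "at_point.val s n = (if s \<in> rhp_zeros P then 1 else 0)"
    and "at_point.val s d = (if s \<in> rhp_poles P then 1 else 0)"
proof -
  have eq: "at_point.val s n = at_point.val s P + at_point.val s d"
    unfolding n_eq using nonzero by (simp add: at_point.val_mult)
  have P: "at_point.val s P = (if s \<in> rhp_zeros P then 1 else 0) - (if s \<in> rhp_poles P then 1 else 0)"
  proof -
    have "order s (rnum P) = (if s \<in> rhp_zeros P then 1 else 0)"
      using simple_zeros[of s] s nonzero by (auto simp: rhp_zeros_def order_0I)
    moreover have "order s (rden P) = (if s \<in> rhp_poles P then 1 else 0)"
      using simple_poles[of s] s by (auto simp: rhp_poles_def order_0I)
    ultimately show ?thesis by (simp add: val_at_point)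
  qed
  have "0 \<le> at_point.val s n" "0 \<le> at_point.val s d"
    using stable_at[of n s] stable_at[of d s] s nonzero by (auto simp: at_point.val_ge_def)
  moreover have "\<not> (1 \<le> at_point.val s n \<and> 1 \<le> at_point.val s d)"
    using at_point.bezout_not_both_positive[OF _ _ bezout, of s] stable_at[of x s] stable_at[of v s] s
    by (auto simp: at_point.val_ge_def)
  ultimately show "at_point.val s n = (if s \<in> rhp_zeros P then 1 else 0)"
    "at_point.val s d = (if s \<in> rhp_poles P then 1 else 0)"
    using eq P distinct(1) by (auto split: if_splits)
qed

text \<open>The reference has no pole at a plant zero, because its transform integral converges
  there.\<close>
lemma w_hat_at_zero:
  assumes "z \<in> rhp_zeros P"
  shows "poly (rden w_hat) z \<noteq> 0" "laplace w z = reval w_hat z"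
  using laplace_eq_reval[OF w_cont w_integrable[OF assms] w_laplace] by auto

lemma w_hat_regular_at_node: "s \<in> nodes \<Longrightarrow> poly (rden w_hat) s \<noteq> 0"
  using w_hat_at_zero(1)[of s] no_common_pole rnum_rden_no_common_root[of w_hat s]
  by (auto simp: nodes_def rhp_zeros_def rhp_poles_def)

text \<open>At a plant zero \<open>n\<close> vanishes and the Bezout identity leaves
  \<open>v * d = 1\<close>; at the other nodes \<open>d\<close> or the reference transform vanishes.
  The parameter drops out in every case.\<close>
lemma reval_error_formula:
  assumes s: "s \<in> nodes" and H: "poly (rden H) s \<noteq> 0"
  shows "reval (w_hat * d * (v - H * n)) s = target s"
proof -
  have Re: "0 \<le> Re s" using node_Re[OF s] by simp
  note reg = w_hat_regular_at_node[OF s] H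
    stable_at[of n s, OF _ Re, folded regular_iff] stable_at[of d s, OF _ Re, folded regular_iff]
    stable_at[of x s, OF _ Re, folded regular_iff] stable_at[of v s, OF _ Re, folded regular_iff]
  have "reval (w_hat * d * (v - H * n)) s = reval w_hat s * reval d s * (reval v s - reval H s * reval n s)"
    using reg by (simp add: reval_mult reval_diff regular_mult regular_diff)
  also have "\<dots> = target s"
  proof (cases "s \<in> rhp_zeros P")
    case True
    have "reval n s = 0"
      using val_factors(1)[OF Re] True reg by (simp add: reval_eq_0_iff at_point.val_ge_def)
    moreover have "reval x s * reval n s + reval v s * reval d s = reval (x * n + v * d) s"
      using reg by (simp add: reval_mult reval_add regular_mult)
    ultimately have "reval v s * reval d s = 1" by (simp add: bezout)
    thus ?thesis using \<open>reval n s = 0\<close> True by (simp add: target_def mult.commute)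
  next
    case False
    hence "reval w_hat s = 0 \<or> reval d s = 0"
      using s val_factors(2)[OF Re] reg
      by (auto simp: nodes_def reval_eq_0_iff at_point.val_ge_def[of _ _ d] rhp_zeros_def zero_iff[symmetric])
    thus ?thesis using False by (auto simp: target_def)
  qed
  finally show ?thesis .
qed

lemma error_signal_laplace:
  assumes "e \<in> error_signals w_hat n d v" "s \<in> nodes"
  shows "laplace e s = target s"
proof -
  obtain q where e: "e \<in> C0" and q: "q \<in> stable_ratfuns" "has_laplace e (w_hat * d * (v - q * n))"
    using assms(1) by (auto simp: error_signals_def)
  have "continuous_on {0..} e" using e by (simp add: C0_def)
  hence "laplace e s = reval (w_hat * d * (v - q * n)) s"
    using laplace_eq_reval(2)[OF _ C0_exp_weight_integrable[OF e node_Re[OF assms(2)]] q(2)] by simp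
  also have "\<dots> = target s"
    using q(1) node_Re[OF assms(2)] by (intro reval_error_formula assms) (auto simp: stable_iff regular_iff)
  finally show ?thesis .
qed

text \<open>The parameter is solved for: \<open>q = (w_hat * d * v - A) / (w_hat * d * n)\<close>, where
  \<open>A\<close> is the transform of the signal. At a node the denominator has order exactly 1,
  and the interpolation condition provides a zero of the numerator. Elsewhere in the closed right
  half-plane only the reference may have a nonzero order, which is then negative; the denominator has that
  order and the numerator at least that order. At infinity both have order at least 1, the denominator exactly 1.\<close>
lemma decay_is_error_signal:
  assumes interp: "\<And>s. s \<in> nodes \<Longrightarrow> laplace (decay p) s = target s"
  shows "decay p \<in> error_signals w_hat n d v"
proof -
  obtain A where A_inf: "at_infinity.val_ge 1 A"
    and A_reg: "\<And>s. 0 \<le> Re s \<Longrightarrow> poly (rden A) s \<noteq> 0"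
    and A_eq: "\<And>s. 0 \<le> Re s \<Longrightarrow> laplace (decay p) s = reval A s"
    and A_int: "\<And>s. 0 \<le> Re s \<Longrightarrow> set_integrable lborel {0..}
      (\<lambda>t. exp (- (s * complex_of_real t)) * complex_of_real (decay p t))"
    using decay_rational_laplace[of p] by blast
  define X where "X = w_hat * d * v - A"
  define q where "q = X / (w_hat * d * n)"
  have nz: "w_hat * d * n \<noteq> 0" using nonzero by simp
  have "q * (w_hat * d * n) = X" using nz by (simp add: q_def)
  hence G: "w_hat * d * (v - q * n) = A" by (simp add: X_def algebra_simps)
  have "q \<in> stable_ratfuns"
    unfolding stable_iff
  proof (intro conjI allI impI)
    have "at_infinity.val_ge 1 X"
      unfolding X_def
    proof (rule at_infinity.val_ge_diff[OF _ A_inf])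
      have "at_infinity.val_ge 1 (w_hat * d)" "at_infinity.val_ge 0 v"
        using val_at_infinity_eqs stable[of v] nonzero
        by (auto simp: stable_iff at_infinity.val_ge_def at_infinity.val_mult)
      from at_infinity.val_ge_mult[OF this] show "at_infinity.val_ge 1 (w_hat * d * v)" by simp
    qed
    from at_infinity.val_ge_divide[OF this nz] show "at_infinity.val_ge 0 q"
      using val_at_infinity_eqs nonzero by (simp add: q_def at_infinity.val_mult)
  next
    fix s :: complex assume s: "0 \<le> Re s"
    have val_nz: "at_point.val s (w_hat * d * n) = at_point.val s w_hat
        + (if s \<in> rhp_poles P then 1 else 0) + (if s \<in> rhp_zeros P then 1 else 0)"
      using nonzero val_factors[OF s] by (simp add: at_point.val_mult)
    have "at_point.val_ge s (at_point.val s (w_hat * d * n)) X"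
    proof (cases "s \<in> nodes")
      case True
      have "at_point.val s w_hat = (if s \<in> rhp_zeros w_hat then 1 else 0)"
        using simple_w[of s] w_hat_regular_at_node[OF True] s nonzero
        by (auto simp: val_at_point rhp_zeros_def order_0I)
      hence "at_point.val s (w_hat * d * n) = 1"
        using True distinct unfolding val_nz nodes_def by auto
      moreover have "poly (rden X) s \<noteq> 0" "reval X s = 0"
      proof -
        have reg: "poly (rden w_hat) s \<noteq> 0" "poly (rden d) s \<noteq> 0" "poly (rden v) s \<noteq> 0"
          "poly (rden A) s \<noteq> 0"
          using w_hat_regular_at_node[OF True] A_reg[OF s]
            stable_at[of d s, OF _ s, folded regular_iff] stable_at[of v s, OF _ s, folded regular_iff]
          by auto
        show "poly (rden X) s \<noteq> 0" unfolding X_def by (intro regular_diff regular_mult reg)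
        have "reval (w_hat * d * v) s = target s"
          using reval_error_formula[OF True, of 0] by (simp add: rden_def)
        thus "reval X s = 0" unfolding X_def
          using reg A_eq[OF s] interp[OF True] by (simp add: reval_diff regular_mult)
      qed
      ultimately show ?thesis by (simp add: reval_eq_0_iff)
    next
      case False
      hence val_eq: "at_point.val s (w_hat * d * n) = at_point.val s w_hat"
        unfolding val_nz by (simp add: nodes_def)
      have "order s (rnum w_hat) = 0"
        using False s by (auto simp: nodes_def rhp_zeros_def order_0I)
      hence le: "at_point.val s w_hat \<le> 0" by (simp add: val_at_point)
      have "at_point.val_ge s (at_point.val s w_hat) (w_hat * (d * v))"
        using at_point.val_ge_mult[of s "at_point.val s w_hat" w_hat 0 "d * v"]
          at_point.val_ge_mult[of s 0 d 0 v] stable_at[of d s] stable_at[of v s] s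
        by (simp add: at_point.val_ge_def[of _ _ w_hat])
      moreover have "at_point.val_ge s (at_point.val s w_hat) A"
        using A_reg[OF s] le unfolding regular_iff by (rule at_point.val_ge_mono)
      ultimately show ?thesis unfolding val_eq X_def
        by (simp add: at_point.val_ge_diff mult.assoc)
    qed
    from at_point.val_ge_divide[OF this nz] show "at_point.val_ge s 0 q" by (simp add: q_def)
  qed
  moreover have "has_laplace (decay p) A"
    unfolding has_laplace_def using A_eq A_int
    by (intro exI[of _ 0]) (auto simp: laplace_def)
  ultimately show ?thesis
    using G decay_in_C0 by (auto simp: error_signals_def)
qed

end

section \<open>Minimax over the span of the modes\<close>

lemma pairing_decay_add:
  assumes "continuous_on {0..} f" "set_integrable lborel {0..} f"
  shows "pairing (\<lambda>t. decay p t + c * decay q t) f = pairing (decay p) f + c * pairing (decay q) f"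
proof -
  note int = set_integrable_decay_mult[OF assms]
  have "pairing (\<lambda>t. decay p t + c * decay q t) f
      = (LINT t:{0..}|lborel. decay p t * f t + c * (decay q t * f t))"
    by (simp add: pairing_def algebra_simps)
  also have "\<dots> = (LINT t:{0..}|lborel. decay p t * f t) + (LINT t:{0..}|lborel. c * (decay q t * f t))"
    by (rule set_integral_add(2)) (auto intro!: int set_integrable_mult_right)
  finally show ?thesis by (simp add: pairing_def)
qed

lemma set_integral_mono_halfline:
  fixes f g :: "real \<Rightarrow> real"
  assumes "set_integrable lborel {0..} f" "set_integrable lborel {0..} g" "\<And>t. 0 \<le> t \<Longrightarrow> f t \<le> g t"
  shows "(LINT t:{0..}|lborel. f t) \<le> (LINT t:{0..}|lborel. g t)"
  using assms by (intro set_integral_mono) auto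

lemma lipschitz_image_integrable:
  fixes f :: "real \<Rightarrow> real" and g :: "real \<Rightarrow> real"
  assumes "continuous_on {0..} f" "set_integrable lborel {0..} f"
    and "\<And>x y. \<bar>g x - g y\<bar> \<le> \<bar>x - y\<bar>" "g 0 = 0"
  shows "set_integrable lborel {0..} (\<lambda>t. g (f t))"
proof (rule set_integrable_dominated[OF set_integrable_abs[OF assms(2)]])
  have "continuous_on UNIV g"
    unfolding continuous_on_iff dist_real_def using assms(3) by (meson le_less_trans)
  thus "continuous_on {0..} (\<lambda>t. g (f t))"
    using continuous_on_compose2[OF _ assms(1), of UNIV g] by simp
  show "norm (g (f t)) \<le> \<bar>f t\<bar>" for t using assms(3)[of "f t" 0] assms(4) by simp
qed

lemma abs_max_0_diff: "\<bar>max x 0 - max y 0\<bar> \<le> \<bar>x - y\<bar>" for x y :: real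
  by (auto simp: max_def)

lemma abs_min_0_diff: "\<bar>min x 0 - min y 0\<bar> \<le> \<bar>x - y\<bar>" for x y :: real
  by (auto simp: min_def)

locale mode_family =
  fixes R :: "complex set"
  assumes finite_R: "finite R" and Re_pos: "\<And>z. z \<in> R \<Longrightarrow> 0 < Re z" and conj_free_R: "conj_free R"
begin

abbreviation "K \<equiv> modes R"

lemma finite_K: "finite K" using finite_R by simp

lemma K_integrable: "k \<in> K \<Longrightarrow> set_integrable lborel {0..} (mode k)"
  by (rule mode_integrable) (auto simp: modes_def Re_pos)

lemma combK_integrable: "set_integrable lborel {0..} (comb K a)"
  using comb_integrable[OF finite_R Re_pos] .

lemma combK_lipschitz_integrable:
  "(\<And>x y. \<bar>g x - g y\<bar> \<le> \<bar>x - y\<bar>) \<Longrightarrow> g 0 = (0 :: real) \<Longrightarrow>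
    set_integrable lborel {0..} (\<lambda>t. g (comb K a t))"
  by (rule lipschitz_image_integrable[OF comb_continuous combK_integrable])

lemmas combK_parts_integrable =
  combK_lipschitz_integrable[of "\<lambda>x. max x 0", OF abs_max_0_diff, simplified]
  combK_lipschitz_integrable[of "\<lambda>x. min x 0", OF abs_min_0_diff, simplified]
  set_integrable_abs[OF combK_integrable]

lemma pairing_bounded_comb:
  assumes "continuous_on {0..} e" "\<And>t. 0 \<le> t \<Longrightarrow> \<bar>e t\<bar> \<le> B"
  shows "pairing e (comb K a) = (\<Sum>k\<in>K. a k * pairing e (mode k))"
proof -
  have "pairing_defined (mode k) e" if "k \<in> K" for k
    using set_integrable_bounded_mult[OF assms(1) mode_continuous K_integrable[OF that] assms(2)]
    by (simp add: pairing_defined_def mult.commute)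
  from pairing_comb[OF finite_K this] show ?thesis by (simp add: pairing_commute)
qed

lemma pairing_decay_comb: "pairing (decay p) (comb K a) = (\<Sum>k\<in>K. a k * pairing (decay p) (mode k))"
proof -
  obtain B where "\<forall>t\<ge>0. \<bar>decay p t\<bar> \<le> B" using decay_bounded by blast
  thus ?thesis using pairing_bounded_comb[OF decay_continuous, of p B a] by simp
qed

lemma norm1_pos:
  assumes "0 \<le> t" "comb K a t \<noteq> 0"
  shows "0 < norm1 (comb K a)"
proof (rule ccontr)
  assume "\<not> 0 < norm1 (comb K a)"
  hence "\<bar>comb K a t\<bar> = 0"
    by (intro nonneg_integral_le_0_imp_0[OF _ combK_parts_integrable(3) _ _ assms(1)])
       (auto intro!: continuous_intros comb_continuous simp: norm1_def)
  thus False using assms(2) by simp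
qed

text \<open>A combination of modes that is orthogonal to all exponential polynomials has \<open>L1\<close>
  norm 0 by density, so it vanishes, and the modes are independent.\<close>
lemma decay_moments_independent:
  assumes "\<And>p. (\<Sum>k\<in>K. a k * pairing (decay p) (mode k)) = 0"
  shows "\<forall>k\<in>K. a k = 0"
proof (rule modes_independent[OF finite_R conj_free_R])
  fix t :: real assume t: "0 \<le> t"
  have "(LINT t:{0..}|lborel. 1 * max (comb K a t) 0 + 1 * max (- comb K a t) 0) \<le> 0"
    by (rule decay_support[where \<epsilon> = 1])
       (use assms in \<open>auto simp: pairing_decay_comb intro!: comb_continuous combK_integrable\<close>)
  moreover have "max y 0 + max (- y) 0 = \<bar>y\<bar>" for y :: real by auto
  ultimately have "norm1 (comb K a) \<le> 0" by (simp add: norm1_def)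
  thus "comb K a t = 0" using norm1_pos[OF t, of a] by linarith
qed

text \<open>A dual family of exponential polynomials reads off the coefficients, each with the bound
  given by its supremum norm.\<close>
lemma coefficient_bounds:
  obtains M where "\<And>a k. norm1 (comb K a) \<le> 1 \<Longrightarrow> k \<in> K \<Longrightarrow> \<bar>a k\<bar> \<le> M k"
proof -
  define \<rho> where "\<rho> = (\<lambda>p k. if k \<in> K then pairing (decay p) (mode k) else 0)"
  have \<rho>: "\<rho> p k = pairing (decay p) (mode k)" if "k \<in> K" for p k
    using that by (simp add: \<rho>_def)
  have \<rho>_add: "(\<lambda>k. \<rho> p k + c * \<rho> q k) = \<rho> (p + smult c q)" for p q c
    by (auto simp: \<rho>_def decay_add_smult pairing_decay_add[OF mode_continuous K_integrable])
  have "\<exists>e. \<forall>k\<in>K. e k \<in> range \<rho> \<and> (\<forall>i\<in>K. e k i = (if i = k then 1 else 0))"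
  proof (rule coordinate_dual_family[OF finite_K])
    fix y z c assume "y \<in> range \<rho>" "z \<in> range \<rho>"
    then obtain p q where "y = \<rho> p" "z = \<rho> q" by blast
    thus "(\<lambda>k. y k + c * z k) \<in> range \<rho>" by (simp only: \<rho>_add rangeI)
  next
    fix a assume zero: "\<And>y. y \<in> range \<rho> \<Longrightarrow> (\<Sum>k\<in>K. a k * y k) = 0"
    show "\<forall>k\<in>K. a k = 0"
    proof (rule decay_moments_independent)
      fix p
      show "(\<Sum>k\<in>K. a k * pairing (decay p) (mode k)) = 0"
        using zero[OF rangeI, of p] by (simp add: \<rho>)
    qed
  qed
  then obtain e where e: "\<And>k. k \<in> K \<Longrightarrow> e k \<in> range \<rho>"
    "\<And>k i. k \<in> K \<Longrightarrow> i \<in> K \<Longrightarrow> e k i = (if i = k then 1 else 0)" by blast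
  have "\<forall>k\<in>K. \<exists>M. \<forall>a. norm1 (comb K a) \<le> 1 \<longrightarrow> \<bar>a k\<bar> \<le> M"
  proof
    fix k assume k: "k \<in> K"
    obtain p where p: "e k = \<rho> p"
      using e(1)[OF k] by (rule rangeE)
    obtain B where B: "\<And>t. t \<ge> 0 \<Longrightarrow> \<bar>decay p t\<bar> \<le> B" using decay_bounded[of p] by blast
    hence "B \<ge> 0" using abs_ge_zero[of "decay p 0"] B[of 0] by linarith
    have "\<bar>a k\<bar> \<le> B" if a: "norm1 (comb K a) \<le> 1" for a
    proof -
      have "pairing (decay p) (comb K a) = (\<Sum>i\<in>K. a i * e k i)"
        unfolding pairing_decay_comb p by (rule sum.cong) (simp_all add: \<rho>)
      also have "\<dots> = (\<Sum>i\<in>K. if i = k then a i else 0)"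
        using e(2)[OF k] by (intro sum.cong) auto
      also have "\<dots> = a k" using k finite_K by simp
      finally have ak: "a k = pairing (decay p) (comb K a)" ..
      have "\<bar>a k\<bar> \<le> (LINT t:{0..}|lborel. \<bar>decay p t * comb K a t\<bar>)"
        unfolding ak pairing_def set_lebesgue_integral_def
        using integral_norm_bound[of lborel "\<lambda>t. indicator {0..} t *\<^sub>R (decay p t * comb K a t)"]
        by (simp add: abs_mult)
      also have "\<dots> \<le> (LINT t:{0..}|lborel. B * \<bar>comb K a t\<bar>)"
      proof (rule set_integral_mono_halfline)
        show "set_integrable lborel {0..} (\<lambda>t. \<bar>decay p t * comb K a t\<bar>)"
          by (intro set_integrable_abs set_integrable_decay_mult comb_continuous combK_integrable)
        show "set_integrable lborel {0..} (\<lambda>t. B * \<bar>comb K a t\<bar>)"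
          by (intro set_integrable_mult_right combK_parts_integrable)
        show "\<bar>decay p t * comb K a t\<bar> \<le> B * \<bar>comb K a t\<bar>" if "0 \<le> t" for t
          using B[OF that] by (simp add: abs_mult mult_right_mono)
      qed
      also have "\<dots> = B * norm1 (comb K a)" by (simp add: norm1_def)
      also have "\<dots> \<le> B" using a \<open>B \<ge> 0\<close> by (simp add: mult_left_le)
      finally show ?thesis .
    qed
    thus "\<exists>M. \<forall>a. norm1 (comb K a) \<le> 1 \<longrightarrow> \<bar>a k\<bar> \<le> M" by blast
  qed
  from bchoice[OF this] obtain M
    where "\<forall>k\<in>K. \<forall>a. norm1 (comb K a) \<le> 1 \<longrightarrow> \<bar>a k\<bar> \<le> M k" by (rule exE)
  thus ?thesis by (intro that[of M]) simp
qed

text \<open>The dual constraints are integrals of the absolute value and of the positive and negative parts.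
  They are closed conditions on the coefficients.\<close>
lemma continuous_lipschitz_integral:
  assumes "\<And>x y. \<bar>g x - g y\<bar> \<le> \<bar>x - y\<bar>" "g 0 = (0 :: real)"
  shows "continuous_on UNIV (\<lambda>a. LINT t:{0..}|lborel. g (comb K a t))"
  unfolding continuous_on_def
proof
  fix a :: "complex \<times> bool \<Rightarrow> real"
  let ?J = "\<lambda>a. LINT t:{0..}|lborel. g (comb K a t)"
  note int = combK_lipschitz_integrable[of g, OF assms]
  have bound: "\<bar>?J b - ?J a\<bar> \<le> (\<Sum>k\<in>K. \<bar>b k - a k\<bar> * norm1 (mode k))" for b
  proof -
    have modes_int: "set_integrable lborel {0..} (\<lambda>t. \<bar>b k - a k\<bar> * \<bar>mode k t\<bar>)" if "k \<in> K" for k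
      by (intro set_integrable_mult_right set_integrable_abs K_integrable that)
    have "\<bar>?J b - ?J a\<bar> = \<bar>LINT t:{0..}|lborel. g (comb K b t) - g (comb K a t)\<bar>"
      using set_integral_diff(2)[OF int[of b] int[of a]] by simp
    also have "\<dots> \<le> (LINT t:{0..}|lborel. \<bar>g (comb K b t) - g (comb K a t)\<bar>)"
      unfolding set_lebesgue_integral_def
      using integral_norm_bound[of lborel "\<lambda>t. indicator {0..} t *\<^sub>R (g (comb K b t) - g (comb K a t))"]
      by (simp add: abs_mult)
    also have "\<dots> \<le> (LINT t:{0..}|lborel. (\<Sum>k\<in>K. \<bar>b k - a k\<bar> * \<bar>mode k t\<bar>))"
    proof (rule set_integral_mono_halfline)
      show "set_integrable lborel {0..} (\<lambda>t. \<bar>g (comb K b t) - g (comb K a t)\<bar>)"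
        using set_integral_diff(1)[OF int[of b] int[of a]] by (rule set_integrable_abs)
      show "set_integrable lborel {0..} (\<lambda>t. \<Sum>k\<in>K. \<bar>b k - a k\<bar> * \<bar>mode k t\<bar>)"
        by (rule set_integral_sum[OF finite_K modes_int])
      show "\<bar>g (comb K b t) - g (comb K a t)\<bar> \<le> (\<Sum>k\<in>K. \<bar>b k - a k\<bar> * \<bar>mode k t\<bar>)" for t
      proof -
        have "\<bar>g (comb K b t) - g (comb K a t)\<bar> \<le> \<bar>\<Sum>k\<in>K. (b k - a k) * mode k t\<bar>"
          using assms(1)[of "comb K b t" "comb K a t"] by (simp add: comb_def left_diff_distrib sum_subtractf)
        also have "\<dots> \<le> (\<Sum>k\<in>K. \<bar>(b k - a k) * mode k t\<bar>)" by (rule sum_abs)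
        finally show ?thesis by (simp add: abs_mult)
      qed
    qed
    also have "\<dots> = (\<Sum>k\<in>K. \<bar>b k - a k\<bar> * norm1 (mode k))"
      using set_integral_sum(2)[OF finite_K modes_int] by (simp add: norm1_def)
    finally show ?thesis .
  qed
  have coord: "((\<lambda>b. b k) \<longlongrightarrow> a k) (at a)" for k
    using continuous_on_product_coordinates[of k] unfolding continuous_on_def by blast
  have "((\<lambda>b. \<Sum>k\<in>K. \<bar>b k - a k\<bar> * norm1 (mode k)) \<longlongrightarrow> (\<Sum>k\<in>K. \<bar>a k - a k\<bar> * norm1 (mode k))) (at a)"
    by (intro tendsto_intros coord)
  hence "((\<lambda>b. \<Sum>k\<in>K. \<bar>b k - a k\<bar> * norm1 (mode k)) \<longlongrightarrow> 0) (at a)" by simp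
  hence "((\<lambda>b. ?J b - ?J a) \<longlongrightarrow> 0) (at a)"
    by (rule Lim_null_comparison[rotated]) (use bound in auto)
  thus "(?J \<longlongrightarrow> ?J a) (at a)" by (simp add: LIM_zero_iff)
qed

lemma continuous_comb: "continuous_on UNIV (\<lambda>a. comb K a t)"
  unfolding comb_def by (intro continuous_intros continuous_on_product_coordinates)

text \<open>The duality for an arbitrary convex cost. The set \<open>C\<close> contains the dual
  feasible functions, \<open>c\<close> the prescribed moments and \<open>\<eta>\<close> a linear
  shift of the dual objective, which is nonzero for a cost that measures the distance to a given signal.
  The hypothesis \<open>support\<close> says that \<open>C\<close> is large enough: a functional
  bounded by \<open>B\<close> below the cost level \<open>r\<close> is a multiple \<open>\<mu>\<close>
  of a feasible one, with the bound that duality predicts. It is required for \<open>r'\<close>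
  below \<open>r\<close> only, to leave room for approximation.\<close>
theorem minimax:
  fixes \<Phi> :: "(real \<Rightarrow> real) \<Rightarrow> real" and F C :: "(real \<Rightarrow> real) set"
    and c \<eta> :: "complex \<times> bool \<Rightarrow> real" and obj :: "(real \<Rightarrow> real) \<Rightarrow> real"
  assumes convex: "\<And>p q s. 0 \<le> s \<Longrightarrow> s \<le> 1 \<Longrightarrow>
      \<Phi> (\<lambda>t. (1 - s) * decay p t + s * decay q t) \<le> (1 - s) * \<Phi> (decay p) + s * \<Phi> (decay q)"
    and lipschitz: "\<And>p q b. \<Phi> (\<lambda>t. decay p t + b * decay q t) \<le> \<Phi> (decay p) + \<bar>b\<bar> * N (decay q)"
    and cost_0: "\<Phi> (\<lambda>_. 0) \<le> 0"
    and feasible_closed: "closed {a. comb K a \<in> C}"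
    and feasible_bounded: "\<And>a. comb K a \<in> C \<Longrightarrow> norm1 (comb K a) \<le> 1"
    and feasible_0: "(\<lambda>_. 0) \<in> C"
    and support: "\<And>a r r' B t0. 0 \<le> t0 \<Longrightarrow> comb K a t0 \<noteq> 0 \<Longrightarrow> 0 < r' \<Longrightarrow> r' < r \<Longrightarrow>
      (\<And>p. \<Phi> (decay p) < r \<Longrightarrow> pairing (decay p) (comb K a) \<le> B) \<Longrightarrow>
      \<exists>\<mu>>0. (\<lambda>t. comb K a t / \<mu>) \<in> C \<and> r' * \<mu> + (\<Sum>k\<in>K. a k * \<eta> k) \<le> B"
    and weak: "\<And>e a. e \<in> F \<Longrightarrow> comb K a \<in> C \<Longrightarrow> (\<Sum>k\<in>K. a k * (c k - \<eta> k)) \<le> \<Phi> e"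
    and moments: "\<And>p. (\<And>k. k \<in> K \<Longrightarrow> pairing (decay p) (mode k) = c k) \<Longrightarrow> decay p \<in> F"
    and obj: "\<And>a. obj (comb K a) = (\<Sum>k\<in>K. a k * (c k - \<eta> k))"
  shows "is_maximum (INF e\<in>F. ereal (\<Phi> e)) obj {f \<in> range (comb K). f \<in> C}"
proof -
  let ?val = "\<lambda>a. \<Sum>k\<in>K. a k * (c k - \<eta> k)"
  obtain M where M: "\<And>a k. norm1 (comb K a) \<le> 1 \<Longrightarrow> k \<in> K \<Longrightarrow> \<bar>a k\<bar> \<le> M k"
    using coefficient_bounds by blast
  \<comment> \<open>setting the coefficients off the modes to 0 makes the domain compact\<close>
  define M' where "M' = (\<lambda>k. if k \<in> K then M k else 0)"
  define S where "S = {a. \<forall>k. \<bar>a k\<bar> \<le> M' k} \<inter> {a. comb K a \<in> C}"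
  have restrict: "(\<lambda>k. if k \<in> K then a k else 0) \<in> S" if a: "comb K a \<in> C" for a
  proof -
    have eq: "comb K (\<lambda>k. if k \<in> K then a k else 0) = comb K a" by (rule comb_cong) simp
    show ?thesis using M[OF feasible_bounded[OF a]] a by (auto simp: S_def M'_def eq)
  qed
  have S_compact: "compact S" unfolding S_def
    by (intro compact_Int_closed compact_coordinate_box feasible_closed)
  have "S \<noteq> {}"
  proof -
    have "comb K (\<lambda>_. 0) = (\<lambda>_. 0)" by (simp add: comb_def fun_eq_iff)
    thus ?thesis using restrict[of "\<lambda>_. 0"] feasible_0 by auto
  qed
  have val_cont: "continuous_on S ?val"
    by (intro continuous_intros continuous_on_subset[OF continuous_on_product_coordinates]) auto
  obtain a0 where a0: "a0 \<in> S" "\<And>a. a \<in> S \<Longrightarrow> ?val a \<le> ?val a0"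
    using continuous_attains_sup[OF S_compact \<open>S \<noteq> {}\<close> val_cont] by blast
  have max: "?val a \<le> ?val a0" if "comb K a \<in> C" for a
  proof -
    have "?val (\<lambda>k. if k \<in> K then a k else 0) = ?val a" by (rule sum.cong) auto
    thus ?thesis using a0(2)[OF restrict[OF that]] by simp
  qed
  have a0_C: "comb K a0 \<in> C" using a0(1) by (simp add: S_def)
  have val0: "0 \<le> ?val a0"
    using max[of "\<lambda>_. 0"] feasible_0 by (simp add: comb_def[abs_def])
  have attain: "\<exists>e\<in>F. \<Phi> e < r" if r: "?val a0 < r" for r
  proof -
    \<comment> \<open>two intermediate levels: one is lost to density, the other to the correction of the moments\<close>
    define r0 where "r0 = (?val a0 + 2 * r) / 3"
    define r1 where "r1 = (2 * ?val a0 + r) / 3"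
    have rs: "?val a0 < r1" "r1 < r0" "r0 < r" using r by (auto simp: r0_def r1_def)
    have "\<exists>f\<in>range decay. \<Phi> f < r \<and> (\<forall>k\<in>K. pairing f (mode k) = c k)"
    proof (rule attain_moments[OF finite_K])
      fix f g b assume "f \<in> range decay" "g \<in> range decay"
      then obtain p q where fg: "f = decay p" "g = decay q" by blast
      show "(\<lambda>t. f t + b * g t) \<in> range decay"
        unfolding fg decay_add_smult[symmetric] by (rule rangeI)
      show "pairing (\<lambda>t. f t + b * g t) (mode k) = pairing f (mode k) + b * pairing g (mode k)"
        if "k \<in> K" for k
        unfolding fg by (rule pairing_decay_add[OF mode_continuous K_integrable[OF that]])
      show "\<Phi> (\<lambda>t. (1 - s) * f t + s * g t) \<le> (1 - s) * \<Phi> f + s * \<Phi> g"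
        if "0 \<le> s" "s \<le> 1" for s
        unfolding fg by (rule convex[OF that])
      show "\<Phi> (\<lambda>t. f t + b * g t) \<le> \<Phi> f + \<bar>b\<bar> * N g"
        unfolding fg by (rule lipschitz)
    next
      fix a :: "complex \<times> bool \<Rightarrow> real" assume "\<And>f. f \<in> range decay \<Longrightarrow> (\<Sum>k\<in>K. a k * pairing f (mode k)) = 0"
      thus "\<forall>k\<in>K. a k = 0" by (intro decay_moments_independent) simp
    next
      show "decay 0 \<in> range decay" by simp
      have "decay 0 = (\<lambda>_. 0)" by (simp add: decay_def fun_eq_iff)
      thus "\<Phi> (decay 0) < r0" using cost_0 val0 rs by simp
      show "r0 < r" by (rule rs)
      fix a :: "complex \<times> bool \<Rightarrow> real" assume nz: "\<exists>k\<in>K. a k \<noteq> 0"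
      show "\<exists>f\<in>range decay. \<Phi> f < r0 \<and> (\<Sum>k\<in>K. a k * c k) < (\<Sum>k\<in>K. a k * pairing f (mode k))"
      proof (rule ccontr)
        assume no: "\<not> ?thesis"
        have le: "pairing (decay p) (comb K a) \<le> (\<Sum>k\<in>K. a k * c k)" if "\<Phi> (decay p) < r0" for p
        proof (rule ccontr)
          assume "\<not> ?thesis"
          hence "(\<Sum>k\<in>K. a k * c k) < (\<Sum>k\<in>K. a k * pairing (decay p) (mode k))"
            unfolding pairing_decay_comb by simp
          thus False using no that by blast
        qed
        have "\<exists>t0\<ge>0. comb K a t0 \<noteq> 0"
        proof (rule ccontr)
          assume "\<not> ?thesis"
          hence "\<forall>k\<in>K. a k = 0" by (intro modes_independent[OF finite_R conj_free_R]) simp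
          thus False using nz by blast
        qed
        then obtain t0 where t0: "0 \<le> t0" "comb K a t0 \<noteq> 0" by blast
        have "0 < r1" using rs val0 by linarith
        obtain \<mu> where \<mu>: "\<mu> > 0" "(\<lambda>t. comb K a t / \<mu>) \<in> C"
          "r1 * \<mu> + (\<Sum>k\<in>K. a k * \<eta> k) \<le> (\<Sum>k\<in>K. a k * c k)"
          using support[OF t0 \<open>0 < r1\<close> rs(2) le] by blast
        have "(\<lambda>t. comb K a t / \<mu>) = comb K (\<lambda>k. a k / \<mu>)"
          by (simp add: comb_def fun_eq_iff sum_divide_distrib)
        with \<mu>(2) have "comb K (\<lambda>k. a k / \<mu>) \<in> C" by (simp only:)
        from max[OF this] have "?val (\<lambda>k. a k / \<mu>) \<le> ?val a0" .
        moreover have "?val (\<lambda>k. a k / \<mu>) = ((\<Sum>k\<in>K. a k * c k) - (\<Sum>k\<in>K. a k * \<eta> k)) / \<mu>"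
          by (simp add: sum_divide_distrib sum_subtractf[symmetric] diff_divide_distrib right_diff_distrib)
        moreover have "r1 \<le> ((\<Sum>k\<in>K. a k * c k) - (\<Sum>k\<in>K. a k * \<eta> k)) / \<mu>"
          using \<mu> by (simp add: field_simps)
        ultimately show False using rs by linarith
      qed
    qed
    then obtain p where "\<Phi> (decay p) < r" "\<forall>k\<in>K. pairing (decay p) (mode k) = c k" by blast
    thus ?thesis using moments[of p] by (intro bexI[of _ "decay p"]) auto
  qed
  have "(INF e\<in>F. ereal (\<Phi> e)) = ereal (?val a0)"
  proof (rule antisym)
    show "(INF e\<in>F. ereal (\<Phi> e)) \<le> ereal (?val a0)"
    proof (rule ereal_le_epsilon2)
      fix \<epsilon> :: real assume "0 < \<epsilon>"
      then obtain e where "e \<in> F" "\<Phi> e < ?val a0 + \<epsilon>" using attain[of "?val a0 + \<epsilon>"] by auto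
      thus "(INF e\<in>F. ereal (\<Phi> e)) \<le> ereal (?val a0) + ereal \<epsilon>"
        by (intro INF_lower2[of e]) auto
    qed
    show "ereal (?val a0) \<le> (INF e\<in>F. ereal (\<Phi> e))"
      using weak[OF _ a0_C] by (intro INF_greatest) simp
  qed
  thus ?thesis unfolding is_maximum_def
    using a0_C max by (intro bexI[of _ "comb K a0"]) (auto simp: obj)
qed

end

section \<open>Supremum costs\<close>

text \<open>Integrands that yield admissible costs as suprema over time. They vanish at 0 so that the cost of
  the zero signal is 0 and that bounded signals have finite cost.\<close>
definition convex_cost :: "(real \<Rightarrow> real \<Rightarrow> real) \<Rightarrow> bool" where
  "convex_cost \<phi> \<longleftrightarrow> (\<forall>t\<ge>0. \<phi> t 0 = 0 \<and> (\<forall>x y. \<phi> t x - \<phi> t y \<le> \<bar>x - y\<bar>) \<and>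
    (\<forall>x y s. 0 \<le> s \<longrightarrow> s \<le> 1 \<longrightarrow> \<phi> t ((1 - s) * x + s * y) \<le> (1 - s) * \<phi> t x + s * \<phi> t y))"

definition sup_cost :: "(real \<Rightarrow> real \<Rightarrow> real) \<Rightarrow> (real \<Rightarrow> real) \<Rightarrow> real" where
  "sup_cost \<phi> e = (SUP t\<in>{0..}. \<phi> t (e t))"

lemma sup_cost_least: "(\<And>t. 0 \<le> t \<Longrightarrow> \<phi> t (e t) \<le> c) \<Longrightarrow> sup_cost \<phi> e \<le> c"
  unfolding sup_cost_def by (rule cSUP_least) auto

lemma sup_cost_upper:
  assumes "convex_cost \<phi>" "\<And>t. 0 \<le> t \<Longrightarrow> \<bar>e t\<bar> \<le> B" "0 \<le> t"
  shows "\<phi> t (e t) \<le> sup_cost \<phi> e"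
  unfolding sup_cost_def
proof (rule cSUP_upper)
  show "bdd_above ((\<lambda>t. \<phi> t (e t)) ` {0..})"
  proof (rule bdd_aboveI2)
    fix s :: real assume "s \<in> {0..}"
    hence s: "0 \<le> s" by simp
    have "\<phi> s (e s) - \<phi> s 0 \<le> \<bar>e s - 0\<bar>" "\<phi> s 0 = 0"
      using assms(1) s unfolding convex_cost_def by blast+
    thus "\<phi> s (e s) \<le> B" using assms(2)[OF s] by simp
  qed
qed (use assms(3) in simp)

lemma sup_cost_decay_upper: "convex_cost \<phi> \<Longrightarrow> 0 \<le> t \<Longrightarrow> \<phi> t (decay p t) \<le> sup_cost \<phi> (decay p)"
proof -
  assume \<phi>: "convex_cost \<phi>" and t: "0 \<le> t"
  obtain B where "\<forall>t\<ge>0. \<bar>decay p t\<bar> \<le> B" using decay_bounded by blast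
  thus ?thesis using sup_cost_upper[OF \<phi> _ t, of "decay p" B] by simp
qed

lemma sup_cost_convex:
  assumes \<phi>: "convex_cost \<phi>" and s: "0 \<le> s" "s \<le> 1"
  shows "sup_cost \<phi> (\<lambda>t. (1 - s) * decay p t + s * decay q t)
    \<le> (1 - s) * sup_cost \<phi> (decay p) + s * sup_cost \<phi> (decay q)"
proof (rule sup_cost_least)
  fix t :: real assume t: "0 \<le> t"
  have "\<phi> t ((1 - s) * decay p t + s * decay q t) \<le> (1 - s) * \<phi> t (decay p t) + s * \<phi> t (decay q t)"
    using \<phi> s t unfolding convex_cost_def by simp
  also have "\<dots> \<le> (1 - s) * sup_cost \<phi> (decay p) + s * sup_cost \<phi> (decay q)"
    using s by (intro add_mono mult_left_mono sup_cost_decay_upper \<phi> t) auto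
  finally show "\<phi> t ((1 - s) * decay p t + s * decay q t)
      \<le> (1 - s) * sup_cost \<phi> (decay p) + s * sup_cost \<phi> (decay q)" .
qed

lemma convex_cost_abs: "convex_cost (\<lambda>_ x. \<bar>x\<bar>)"
proof -
  have "\<bar>(1 - s) * x + s * y\<bar> \<le> (1 - s) * \<bar>x\<bar> + s * \<bar>y\<bar>" if "0 \<le> s" "s \<le> 1" for x y s :: real
    using abs_triangle_ineq[of "(1 - s) * x" "s * y"] that by (simp add: abs_mult)
  thus ?thesis by (auto simp: convex_cost_def)
qed

lemma convex_cost_linear: "\<bar>\<sigma>\<bar> = 1 \<Longrightarrow> convex_cost (\<lambda>_ x. \<sigma> * x)"
  unfolding convex_cost_def by (auto simp: abs_if algebra_simps split: if_splits)

lemma convex_cost_max: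
  assumes "\<bar>\<sigma>\<bar> = 1" "\<And>t. 0 \<le> t \<Longrightarrow> 0 \<le> h t"
  shows "convex_cost (\<lambda>t x. max (\<sigma> * x - h t) 0)"
  unfolding convex_cost_def
proof (intro allI impI conjI)
  fix t :: real assume t: "0 \<le> t"
  show "max (\<sigma> * 0 - h t) 0 = 0" using assms(2)[OF t] by simp
  fix x y :: real
  have "\<sigma> * x - \<sigma> * y \<le> \<bar>x - y\<bar>" using assms(1) by (auto simp: abs_if split: if_splits)
  thus "max (\<sigma> * x - h t) 0 - max (\<sigma> * y - h t) 0 \<le> \<bar>x - y\<bar>" by (auto simp: max_def)
  fix s :: real assume s: "0 \<le> s" "s \<le> 1"
  have "\<sigma> * ((1 - s) * x + s * y) - h t = (1 - s) * (\<sigma> * x - h t) + s * (\<sigma> * y - h t)"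
    by (simp add: algebra_simps)
  also have "\<dots> \<le> (1 - s) * max (\<sigma> * x - h t) 0 + s * max (\<sigma> * y - h t) 0"
    using s by (intro add_mono mult_left_mono) auto
  finally show "max (\<sigma> * ((1 - s) * x + s * y) - h t) 0
      \<le> (1 - s) * max (\<sigma> * x - h t) 0 + s * max (\<sigma> * y - h t) 0"
    using s by (auto intro!: add_nonneg_nonneg)
qed

abbreviation sup_norm :: "(real \<Rightarrow> real) \<Rightarrow> real" where
  "sup_norm \<equiv> sup_cost (\<lambda>_ x. \<bar>x\<bar>)"

lemma sup_cost_lipschitz:
  assumes \<phi>: "convex_cost \<phi>"
  shows "sup_cost \<phi> (\<lambda>t. decay p t + b * decay q t) \<le> sup_cost \<phi> (decay p) + \<bar>b\<bar> * sup_norm (decay q)"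
proof (rule sup_cost_least)
  fix t :: real assume t: "0 \<le> t"
  have "\<phi> t (decay p t + b * decay q t) - \<phi> t (decay p t) \<le> \<bar>(decay p t + b * decay q t) - decay p t\<bar>"
    using \<phi> t unfolding convex_cost_def by blast
  also have "\<dots> \<le> \<bar>b\<bar> * sup_norm (decay q)"
    using sup_cost_decay_upper[OF convex_cost_abs t, of q] by (simp add: abs_mult mult_left_mono)
  finally show "\<phi> t (decay p t + b * decay q t) \<le> sup_cost \<phi> (decay p) + \<bar>b\<bar> * sup_norm (decay q)"
    using sup_cost_decay_upper[OF \<phi> t, of p] by linarith
qed

lemma sup_cost_0: "convex_cost \<phi> \<Longrightarrow> sup_cost \<phi> (\<lambda>_. 0) \<le> 0"
  by (rule sup_cost_least) (simp add: convex_cost_def)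

context mode_family
begin

lemma pairing_le_norm1:
  assumes e: "continuous_on {0..} e" "\<And>t. 0 \<le> t \<Longrightarrow> \<bar>e t\<bar> \<le> B"
    and h: "set_integrable lborel {0..} (\<lambda>t. h t * comb K a t)"
    and le: "\<And>t. 0 \<le> t \<Longrightarrow> (e t - h t) * comb K a t \<le> S * \<bar>comb K a t\<bar>"
    and "norm1 (comb K a) \<le> 1" "0 \<le> S"
  shows "pairing e (comb K a) - pairing h (comb K a) \<le> S"
proof -
  have int: "set_integrable lborel {0..} (\<lambda>t. e t * comb K a t)"
    by (rule set_integrable_bounded_mult[OF e(1) comb_continuous combK_integrable e(2)])
  have "pairing e (comb K a) - pairing h (comb K a)
      = (LINT t:{0..}|lborel. e t * comb K a t - h t * comb K a t)"
    unfolding pairing_def using set_integral_diff(2)[OF int h] by simp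
  also have "\<dots> \<le> (LINT t:{0..}|lborel. S * \<bar>comb K a t\<bar>)"
    using le by (intro set_integral_mono_halfline set_integral_diff(1) int h set_integrable_mult_right
      combK_parts_integrable) (auto simp: algebra_simps)
  also have "\<dots> = S * norm1 (comb K a)" by (simp add: norm1_def)
  also have "\<dots> \<le> S" using assms(5,6) by (simp add: mult_left_le)
  finally show ?thesis .
qed

lemma closed_norm1_le_1: "closed {a. norm1 (comb K a) \<le> 1}"
  unfolding norm1_def
  by (intro closed_Collect_le continuous_on_const continuous_lipschitz_integral) auto

lemma sup_norm_minimax:
  assumes F: "\<And>e. e \<in> F \<Longrightarrow> e \<in> C0"
    and F_moments: "\<And>e k. e \<in> F \<Longrightarrow> k \<in> K \<Longrightarrow> pairing e (mode k) = c k"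
    and moments: "\<And>p. (\<And>k. k \<in> K \<Longrightarrow> pairing (decay p) (mode k) = c k) \<Longrightarrow> decay p \<in> F"
    and obj: "\<And>a. obj (comb K a) = (\<Sum>k\<in>K. a k * c k)"
  shows "is_maximum (INF e\<in>F. ereal (SUP t\<in>{0..}. \<bar>e t\<bar>)) obj {f \<in> range (comb K). norm1 f \<le> 1}"
proof -
  have "is_maximum (INF e\<in>F. ereal (sup_norm e)) obj {f \<in> range (comb K). f \<in> {f. norm1 f \<le> 1}}"
  proof (rule minimax[where \<eta> = "\<lambda>_. 0" and N = sup_norm])
    show "closed {a. comb K a \<in> {f. norm1 f \<le> 1}}" using closed_norm1_le_1 by simp
    show "(\<lambda>_. 0) \<in> {f. norm1 f \<le> 1}" by (simp add: norm1_def)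
    fix a :: "complex \<times> bool \<Rightarrow> real" and r r' B t0
    assume t0: "0 \<le> t0" "comb K a t0 \<noteq> 0" and r: "0 < r'" "r' < r"
      and B: "\<And>p. sup_norm (decay p) < r \<Longrightarrow> pairing (decay p) (comb K a) \<le> B"
    have "(LINT t:{0..}|lborel. r' * max (comb K a t) 0 + r' * max (- comb K a t) 0) \<le> B"
    proof (rule decay_support[where \<epsilon> = "(r - r') / 2"])
      fix p assume p: "\<And>t. 0 \<le> t \<Longrightarrow> - r' - (r - r') / 2 \<le> decay p t \<and> decay p t \<le> r' + (r - r') / 2"
      have "sup_norm (decay p) \<le> r' + (r - r') / 2"
        using p by (intro sup_cost_least) (force simp: abs_le_iff)
      also have "\<dots> < r" using r by (simp add: field_simps)
      finally show "pairing (decay p) (comb K a) \<le> B" by (rule B)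
    qed (use r in \<open>auto intro: comb_continuous combK_integrable\<close>)
    moreover have "r' * max y 0 + r' * max (- y) 0 = r' * \<bar>y\<bar>" for y :: real by (auto simp: max_def)
    ultimately have "r' * norm1 (comb K a) \<le> B" by (simp add: norm1_def)
    thus "\<exists>\<mu>>0. (\<lambda>t. comb K a t / \<mu>) \<in> {f. norm1 f \<le> 1} \<and> r' * \<mu> + (\<Sum>k\<in>K. a k * 0) \<le> B"
      using norm1_pos[OF t0] by (intro exI[of _ "norm1 (comb K a)"]) (auto simp: norm1_def)
  next
    fix e a assume e: "e \<in> F" and a: "comb K a \<in> {f. norm1 f \<le> 1}"
    obtain B where B: "\<And>t. 0 \<le> t \<Longrightarrow> \<bar>e t\<bar> \<le> B" using C0_bounded[OF F[OF e]] by blast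
    have cont: "continuous_on {0..} e" using F[OF e] by (simp add: C0_def)
    have le: "\<bar>e t\<bar> \<le> sup_norm e" if "0 \<le> t" for t
      using sup_cost_upper[OF convex_cost_abs, of e B t] B that by simp
    have "pairing e (comb K a) = (\<Sum>k\<in>K. a k * pairing e (mode k))"
      by (rule pairing_bounded_comb[OF cont]) (rule B)
    hence "(\<Sum>k\<in>K. a k * c k) = pairing e (comb K a)"
      using F_moments[OF e] by simp
    also have "pairing e (comb K a) = pairing e (comb K a) - pairing (\<lambda>_. 0) (comb K a)"
      by (simp add: pairing_def)
    also have "\<dots> \<le> sup_norm e"
    proof (rule pairing_le_norm1[OF cont])
      show "\<bar>e t\<bar> \<le> B" if "0 \<le> t" for t using B[OF that] .
      show "(e t - 0) * comb K a t \<le> sup_norm e * \<bar>comb K a t\<bar>" if "0 \<le> t" for t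
      proof -
        have "e t * comb K a t \<le> \<bar>e t\<bar> * \<bar>comb K a t\<bar>" by (simp add: abs_mult[symmetric])
        also have "\<dots> \<le> sup_norm e * \<bar>comb K a t\<bar>" by (rule mult_right_mono[OF le[OF that]]) simp
        finally show ?thesis by simp
      qed
      show "0 \<le> sup_norm e" using le[of 0] abs_ge_zero[of "e 0"] by linarith
    qed (use a in \<open>auto simp: set_integrable_def\<close>)
    finally show "(\<Sum>k\<in>K. a k * (c k - 0)) \<le> sup_norm e" by simp
  next
    show "sup_norm (\<lambda>t. (1 - s) * decay p t + s * decay q t)
        \<le> (1 - s) * sup_norm (decay p) + s * sup_norm (decay q)" if "0 \<le> s" "s \<le> 1" for p q s
      by (rule sup_cost_convex[OF convex_cost_abs that])
    show "sup_norm (\<lambda>t. decay p t + b * decay q t) \<le> sup_norm (decay p) + \<bar>b\<bar> * sup_norm (decay q)" for p q b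
      by (rule sup_cost_lipschitz[OF convex_cost_abs])
    show "sup_norm (\<lambda>_. 0) \<le> 0" by (rule sup_cost_0[OF convex_cost_abs])
    show "decay p \<in> F" if "\<And>k. k \<in> K \<Longrightarrow> pairing (decay p) (mode k) = c k" for p
      using that by (rule moments)
  qed (auto simp: obj)
  thus ?thesis by (simp add: sup_cost_def)
qed

text \<open>The sign \<open>\<sigma>\<close> selects which side of the signal is penalised. The
  opposite side is unconstrained, which forces a separating functional to have the sign
  \<open>\<sigma>\<close>: otherwise its supremum would be infinite. The threshold
  \<open>h\<close> is 0 or the reference.\<close>
lemma one_sided_minimax:
  fixes \<sigma> :: real
  assumes \<sigma>: "\<bar>\<sigma>\<bar> = 1"
    and h: "continuous_on {0..} h" "\<And>t. 0 \<le> t \<Longrightarrow> 0 \<le> h t" "\<And>k. k \<in> K \<Longrightarrow> pairing_defined (mode k) h"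
    and F: "\<And>e. e \<in> F \<Longrightarrow> e \<in> C0"
    and F_moments: "\<And>e k. e \<in> F \<Longrightarrow> k \<in> K \<Longrightarrow> pairing e (mode k) = c k"
    and moments: "\<And>p. (\<And>k. k \<in> K \<Longrightarrow> pairing (decay p) (mode k) = c k) \<Longrightarrow> decay p \<in> F"
    and obj: "\<And>a. obj (comb K a) = (\<Sum>k\<in>K. a k * (c k - \<sigma> * pairing (mode k) h))"
  shows "is_maximum (INF e\<in>F. ereal (SUP t\<in>{0..}. max (\<sigma> * e t - h t) 0)) obj
    {f \<in> range (comb K). (\<forall>t\<ge>0. 0 \<le> \<sigma> * f t) \<and> norm1 f \<le> 1}"
proof -
  let ?\<Phi> = "sup_cost (\<lambda>t x. max (\<sigma> * x - h t) 0)"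
  let ?C = "{f. (\<forall>t\<ge>0. 0 \<le> \<sigma> * f t) \<and> norm1 f \<le> 1}"
  have \<sigma>2: "\<sigma> * \<sigma> = 1" using \<sigma> by (auto simp: abs_if split: if_splits)
  note cc = convex_cost_max[of \<sigma> h, OF \<sigma> h(2)]
  have h_int: "set_integrable lborel {0..} (\<lambda>t. h t * comb K a t)" for a
  proof -
    have "set_integrable lborel {0..} (\<lambda>t. \<Sum>k\<in>K. a k * (mode k t * h t))"
      using h(3) unfolding pairing_defined_def
      by (intro set_integral_sum(1)[OF finite_K] set_integrable_mult_right)
    thus ?thesis
      by (simp add: comb_def sum_distrib_left mult_ac)
  qed
  have h_pair: "pairing h (comb K a) = (\<Sum>k\<in>K. a k * pairing (mode k) h)" for a
    using pairing_comb[OF finite_K h(3)] by (simp add: pairing_commute)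
  have "is_maximum (INF e\<in>F. ereal (?\<Phi> e)) obj {f \<in> range (comb K). f \<in> ?C}"
  proof (rule minimax[where \<eta> = "\<lambda>k. \<sigma> * pairing (mode k) h" and N = sup_norm])
    have "closed {a. \<forall>t. 0 \<le> t \<longrightarrow> 0 \<le> \<sigma> * comb K a t}"
      by (intro closed_Collect_all closed_Collect_imp open_Collect_const closed_Collect_le
          continuous_intros continuous_comb)
    from closed_Collect_conj[OF this closed_norm1_le_1]
    show "closed {a. comb K a \<in> ?C}" by simp
    show "(\<lambda>_. 0) \<in> ?C" by (simp add: norm1_def)
    fix a :: "complex \<times> bool \<Rightarrow> real" and r r' B t0
    assume t0: "0 \<le> t0" "comb K a t0 \<noteq> 0" and r: "0 < r'" "r' < r"
      and B: "\<And>p. ?\<Phi> (decay p) < r \<Longrightarrow> pairing (decay p) (comb K a) \<le> B"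
    define f where "f = (\<lambda>t. \<sigma> * comb K a t)"
    have f_cont: "continuous_on {0..} f" unfolding f_def by (intro continuous_intros comb_continuous)
    have f_int: "set_integrable lborel {0..} f"
      unfolding f_def by (intro set_integrable_mult_right combK_integrable)
    have hf_int: "set_integrable lborel {0..} (\<lambda>t. h t * f t)"
      using set_integrable_mult_right[of \<sigma>, OF h_int[of a]] by (simp add: f_def mult_ac)
    have parts: "set_integrable lborel {0..} (\<lambda>t. max (f t) 0)" "set_integrable lborel {0..} (\<lambda>t. max (- f t) 0)"
      by (rule lipschitz_image_integrable[OF f_cont f_int]; auto simp: max_def)+
    have rh_int: "set_integrable lborel {0..} (\<lambda>t. (r' + h t) * max (f t) 0)"
    proof (rule set_integrable_dominated)
      have "set_integrable lborel {0..} (\<lambda>t. r' * \<bar>f t\<bar>)" "set_integrable lborel {0..} (\<lambda>t. \<bar>h t * f t\<bar>)"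
        using f_int hf_int by (auto intro!: set_integrable_abs)
      thus "set_integrable lborel {0..} (\<lambda>t. r' * \<bar>f t\<bar> + \<bar>h t * f t\<bar>)" by (rule set_integral_add(1))
      show "continuous_on {0..} (\<lambda>t. (r' + h t) * max (f t) 0)" by (intro continuous_intros f_cont h)
      show "norm ((r' + h t) * max (f t) 0) \<le> r' * \<bar>f t\<bar> + \<bar>h t * f t\<bar>" if "0 \<le> t" for t
      proof -
        have "0 \<le> r' + h t" using h(2)[OF that] r(1) by simp
        hence "norm ((r' + h t) * max (f t) 0) \<le> (r' + h t) * \<bar>f t\<bar>"
          by (auto simp: abs_mult intro!: mult_left_mono)
        also have "\<dots> = r' * \<bar>f t\<bar> + \<bar>h t * f t\<bar>"
          using h(2)[OF that] by (simp add: abs_mult algebra_simps)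
        finally show ?thesis .
      qed
    qed
    have all_\<alpha>: "(LINT t:{0..}|lborel. (r' + h t) * max (f t) 0) + \<alpha> * (LINT t:{0..}|lborel. max (- f t) 0) \<le> B"
      if "0 \<le> \<alpha>" for \<alpha>
    proof -
      have "(LINT t:{0..}|lborel. (r' + h t) * max (f t) 0 + \<alpha> * max (- f t) 0) \<le> B"
      proof (rule decay_support[where \<epsilon> = "(r - r') / 2", OF f_cont f_int])
        show "set_integrable lborel {0..} (\<lambda>t. (r' + h t) * f t)"
          using set_integral_add(1)[OF set_integrable_mult_right[of r', OF f_int] hf_int]
          by (simp add: algebra_simps)
        fix p assume p: "\<And>t. 0 \<le> t \<Longrightarrow> - \<alpha> - (r - r') / 2 \<le> decay p t \<and> decay p t \<le> r' + h t + (r - r') / 2"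
        have flip: "decay (smult \<sigma> p) t = \<sigma> * decay p t" for t by (simp add: decay_def)
        have "?\<Phi> (decay (smult \<sigma> p)) \<le> r' + (r - r') / 2"
        proof (rule sup_cost_least)
          fix t :: real assume t: "0 \<le> t"
          have "\<sigma> * decay (smult \<sigma> p) t = decay p t" by (simp add: flip mult.assoc[symmetric] \<sigma>2)
          moreover have "decay p t - h t \<le> r' + (r - r') / 2" using p[OF t] by linarith
          moreover have "0 \<le> r' + (r - r') / 2" using r by (simp add: field_simps)
          ultimately show "max (\<sigma> * decay (smult \<sigma> p) t - h t) 0 \<le> r' + (r - r') / 2"
            by (metis max.boundedI)
        qed
        also have "\<dots> < r" using r by (simp add: field_simps)
        finally have "pairing (decay (smult \<sigma> p)) (comb K a) \<le> B" by (rule B)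
        thus "pairing (decay p) f \<le> B" by (simp add: pairing_def f_def flip mult_ac)
      qed (use r h that in \<open>auto intro!: continuous_intros\<close>)
      thus ?thesis
        using set_integral_add(2)[OF rh_int set_integrable_mult_right[of \<alpha>, OF parts(2)]] by simp
    qed
    \<comment> \<open>letting the free side grow without bound leaves no room for a negative part\<close>
    have neg_int: "(LINT t:{0..}|lborel. max (- f t) 0) \<le> 0"
    proof (rule ccontr)
      let ?X = "LINT t:{0..}|lborel. (r' + h t) * max (f t) 0" and ?Y = "LINT t:{0..}|lborel. max (- f t) 0"
      assume "\<not> ?Y \<le> 0"
      moreover define \<alpha> where "\<alpha> = (\<bar>B\<bar> + \<bar>?X\<bar> + 1) / ?Y"
      ultimately have "0 \<le> \<alpha>" "\<alpha> * ?Y = \<bar>B\<bar> + \<bar>?X\<bar> + 1" by auto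
      with all_\<alpha>[OF \<open>0 \<le> \<alpha>\<close>] show False by linarith
    qed
    have neg_cont: "continuous_on {0..} (\<lambda>t. max (- f t) 0)" by (intro continuous_intros f_cont)
    have neg0: "max (- f t) 0 = 0" if "0 \<le> t" for t
      by (rule nonneg_integral_le_0_imp_0[OF neg_cont parts(2) _ neg_int that]) simp
    have f_nonneg: "0 \<le> f t" if "0 \<le> t" for t
      using neg0[OF that] by (simp add: max_def split: if_splits)
    have f_abs: "f t = \<bar>comb K a t\<bar>" if "0 \<le> t" for t
    proof -
      have "\<bar>f t\<bar> = \<bar>comb K a t\<bar>" using \<sigma> by (simp add: f_def abs_mult)
      thus ?thesis using f_nonneg[OF that] by simp
    qed
    have "r' * norm1 (comb K a) + \<sigma> * pairing h (comb K a)
        = (LINT t:{0..}|lborel. r' * \<bar>comb K a t\<bar>) + (LINT t:{0..}|lborel. \<sigma> * (h t * comb K a t))"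
      by (simp add: norm1_def pairing_def)
    also have "\<dots> = (LINT t:{0..}|lborel. r' * \<bar>comb K a t\<bar> + \<sigma> * (h t * comb K a t))"
      by (rule set_integral_add(2)[symmetric])
         (intro set_integrable_mult_right combK_parts_integrable h_int)+
    also have "\<dots> = (LINT t:{0..}|lborel. (r' + h t) * max (f t) 0)"
    proof (rule set_lebesgue_integral_cong)
      show "\<forall>t. t \<in> {0..} \<longrightarrow> r' * \<bar>comb K a t\<bar> + \<sigma> * (h t * comb K a t) = (r' + h t) * max (f t) 0"
      proof (intro allI impI)
        fix t :: real assume "t \<in> {0..}"
        hence t: "0 \<le> t" by simp
        have "max (f t) 0 = f t" using f_nonneg[OF t] by simp
        thus "r' * \<bar>comb K a t\<bar> + \<sigma> * (h t * comb K a t) = (r' + h t) * max (f t) 0"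
          unfolding f_abs[OF t, symmetric] by (simp add: f_def algebra_simps)
      qed
    qed simp
    also have "\<dots> \<le> B" using all_\<alpha>[of 0] by simp
    finally have le: "r' * norm1 (comb K a) + \<sigma> * pairing h (comb K a) \<le> B" .
    have "0 \<le> \<sigma> * (comb K a t / norm1 (comb K a))" if "0 \<le> t" for t
      using f_nonneg[OF that] norm1_pos[OF t0] by (simp add: f_def)
    moreover have "norm1 (\<lambda>t. comb K a t / norm1 (comb K a)) \<le> 1"
      using norm1_pos[OF t0] by (simp add: norm1_def)
    moreover have "(\<Sum>k\<in>K. a k * (\<sigma> * pairing (mode k) h)) = \<sigma> * pairing h (comb K a)"
      by (simp add: h_pair sum_distrib_left mult_ac)
    ultimately show "\<exists>\<mu>>0. (\<lambda>t. comb K a t / \<mu>) \<in> ?C \<and> r' * \<mu> + (\<Sum>k\<in>K. a k * (\<sigma> * pairing (mode k) h)) \<le> B"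
      using norm1_pos[OF t0] le by (intro exI[of _ "norm1 (comb K a)"]) auto
  next
    fix e a assume e: "e \<in> F" and "comb K a \<in> ?C"
    hence a: "\<And>t. 0 \<le> t \<Longrightarrow> 0 \<le> \<sigma> * comb K a t" "norm1 (comb K a) \<le> 1" by auto
    obtain B where B: "\<And>t. 0 \<le> t \<Longrightarrow> \<bar>e t\<bar> \<le> B" using C0_bounded[OF F[OF e]] by blast
    have cont: "continuous_on {0..} e" using F[OF e] by (simp add: C0_def)
    have le: "max (\<sigma> * e t - h t) 0 \<le> ?\<Phi> e" if "0 \<le> t" for t
      using sup_cost_upper[OF cc, of e B t] B that by simp
    have "pairing e (comb K a) = (\<Sum>k\<in>K. a k * pairing e (mode k))"
      by (rule pairing_bounded_comb[OF cont]) (rule B)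
    hence "(\<Sum>k\<in>K. a k * c k) = pairing e (comb K a)"
      using F_moments[OF e] by simp
    hence "(\<Sum>k\<in>K. a k * (c k - \<sigma> * pairing (mode k) h)) = pairing e (comb K a) - \<sigma> * pairing h (comb K a)"
      by (simp add: h_pair right_diff_distrib sum_subtractf sum_distrib_left mult_ac)
    also have "\<dots> = pairing e (comb K a) - pairing (\<lambda>t. \<sigma> * h t) (comb K a)"
      by (simp add: pairing_def mult.assoc)
    also have "\<dots> \<le> ?\<Phi> e"
    proof (rule pairing_le_norm1[OF cont])
      show "\<bar>e t\<bar> \<le> B" if "0 \<le> t" for t using B[OF that] .
      show "set_integrable lborel {0..} (\<lambda>t. \<sigma> * h t * comb K a t)"
        using set_integrable_mult_right[of \<sigma>, OF h_int[of a]] by (simp add: mult.assoc)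
      show "(e t - \<sigma> * h t) * comb K a t \<le> ?\<Phi> e * \<bar>comb K a t\<bar>" if t: "0 \<le> t" for t
      proof -
        have abs: "\<bar>comb K a t\<bar> = \<sigma> * comb K a t" using \<sigma> a(1)[OF t] by (metis abs_mult abs_of_nonneg mult_1)
        have "(e t - \<sigma> * h t) * comb K a t = \<sigma> * \<sigma> * e t * comb K a t - \<sigma> * h t * comb K a t"
          by (simp add: \<sigma>2 algebra_simps)
        also have "\<dots> = (\<sigma> * e t - h t) * \<bar>comb K a t\<bar>"
          unfolding abs by (simp add: algebra_simps)
        also have "\<dots> \<le> ?\<Phi> e * \<bar>comb K a t\<bar>" using le[OF t] by (intro mult_right_mono) auto
        finally show ?thesis .
      qed
      show "0 \<le> ?\<Phi> e" using le[of 0] by simp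
    qed (use a in auto)
    finally show "(\<Sum>k\<in>K. a k * (c k - \<sigma> * pairing (mode k) h)) \<le> ?\<Phi> e" .
  next
    show "?\<Phi> (\<lambda>t. (1 - s) * decay p t + s * decay q t) \<le> (1 - s) * ?\<Phi> (decay p) + s * ?\<Phi> (decay q)"
      if "0 \<le> s" "s \<le> 1" for p q s
      by (rule sup_cost_convex[OF cc that])
    show "?\<Phi> (\<lambda>t. decay p t + b * decay q t) \<le> ?\<Phi> (decay p) + \<bar>b\<bar> * sup_norm (decay q)" for p q b
      by (rule sup_cost_lipschitz[OF cc])
    show "?\<Phi> (\<lambda>_. 0) \<le> 0" by (rule sup_cost_0[OF cc])
    show "decay p \<in> F" if "\<And>k. k \<in> K \<Longrightarrow> pairing (decay p) (mode k) = c k" for p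
      using that by (rule moments)
  qed (auto simp: obj)
  thus ?thesis by (simp add: sup_cost_def)
qed

end

section \<open>The spread cost and the theorem\<close>

context mode_family
begin

text \<open>A signal tending to 0 has nonnegative supremum and nonpositive infimum, so a spread of at
  most \<open>2 * r\<close> means a range in some interval from \<open>- \<alpha>\<close> to
  \<open>\<beta>\<close> with \<open>\<alpha> + \<beta> = 2 * r\<close>. A linear functional is
  largest at the two extreme intervals, whence the dual gauge is
  twice the maximum of the integrals of the positive and negative parts.\<close>
lemma spread_minimax:
  assumes F: "\<And>e. e \<in> F \<Longrightarrow> e \<in> C0"
    and F_moments: "\<And>e k. e \<in> F \<Longrightarrow> k \<in> K \<Longrightarrow> pairing e (mode k) = c k"
    and moments: "\<And>p. (\<And>k. k \<in> K \<Longrightarrow> pairing (decay p) (mode k) = c k) \<Longrightarrow> decay p \<in> F"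
    and obj: "\<And>a. obj (comb K a) = (\<Sum>k\<in>K. a k * c k)"
  shows "is_maximum (INF e\<in>F. ereal (1/2 * ((SUP t\<in>{0..}. e t) - (INF t\<in>{0..}. e t)))) obj
    {f \<in> range (comb K). (LINT t:{0..}|lborel. max (f t) 0) \<le> 1/2 \<and>
      (LINT t:{0..}|lborel. min (f t) 0) \<ge> - 1/2}"
proof -
  let ?S = "sup_cost (\<lambda>_ x. 1 * x)" and ?T = "sup_cost (\<lambda>_ x. (-1) * x)"
  let ?\<Phi> = "\<lambda>e. 1/2 * (?S e + ?T e)"
  let ?C = "{f :: real \<Rightarrow> real. (LINT t:{0..}|lborel. max (f t) 0) \<le> 1/2 \<and> (LINT t:{0..}|lborel. min (f t) 0) \<ge> - 1/2}"
  have ccS: "convex_cost (\<lambda>_ x. 1 * x)" by (rule convex_cost_linear) simp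
  have ccT: "convex_cost (\<lambda>_ x. (-1) * x)" by (rule convex_cost_linear) simp
  note parts = combK_parts_integrable
  have "is_maximum (INF e\<in>F. ereal (?\<Phi> e)) obj {f \<in> range (comb K). f \<in> ?C}"
  proof (rule minimax[where \<eta> = "\<lambda>_. 0" and N = sup_norm])
    have "closed {a. (LINT t:{0..}|lborel. max (comb K a t) 0) \<le> 1/2}"
      by (intro closed_Collect_le continuous_on_const continuous_lipschitz_integral[of "\<lambda>x. max x 0"])
         (auto intro: abs_max_0_diff)
    moreover have "closed {a. - 1/2 \<le> (LINT t:{0..}|lborel. min (comb K a t) 0)}"
      by (intro closed_Collect_le continuous_on_const continuous_lipschitz_integral[of "\<lambda>x. min x 0"])
         (auto intro: abs_min_0_diff)
    ultimately show "closed {a. comb K a \<in> ?C}"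
      using closed_Collect_conj by simp
    show "(\<lambda>_. 0) \<in> ?C" by simp
    show "norm1 (comb K a) \<le> 1" if "comb K a \<in> ?C" for a
    proof -
      have "norm1 (comb K a) = (LINT t:{0..}|lborel. max (comb K a t) 0 - min (comb K a t) 0)"
        unfolding norm1_def by (rule set_lebesgue_integral_cong) auto
      also have "\<dots> = (LINT t:{0..}|lborel. max (comb K a t) 0) - (LINT t:{0..}|lborel. min (comb K a t) 0)"
        by (rule set_integral_diff(2)[OF parts(1,2)])
      finally show ?thesis using that by simp
    qed
    fix a :: "complex \<times> bool \<Rightarrow> real" and r r' B t0
    assume t0: "0 \<le> t0" "comb K a t0 \<noteq> 0" and r: "0 < r'" "r' < r"
      and B: "\<And>p. ?\<Phi> (decay p) < r \<Longrightarrow> pairing (decay p) (comb K a) \<le> B"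
    let ?f = "comb K a"
    let ?p = "LINT t:{0..}|lborel. max (?f t) 0" and ?n = "LINT t:{0..}|lborel. max (- ?f t) 0"
    have neg_int: "set_integrable lborel {0..} (\<lambda>t. max (- ?f t) 0)"
      by (rule combK_lipschitz_integrable[of "\<lambda>x. max (- x) 0"]) (auto simp: max_def)
    have key: "\<beta> * ?p + \<alpha> * ?n \<le> B" if ab: "0 \<le> \<alpha>" "0 \<le> \<beta>" "\<alpha> + \<beta> = 2 * r'" for \<alpha> \<beta>
    proof -
      have "(LINT t:{0..}|lborel. \<beta> * max (?f t) 0 + \<alpha> * max (- ?f t) 0) \<le> B"
      proof (rule decay_support[where \<epsilon> = "(r - r') / 2"])
        fix p assume p: "\<And>t. 0 \<le> t \<Longrightarrow> - \<alpha> - (r - r') / 2 \<le> decay p t \<and> decay p t \<le> \<beta> + (r - r') / 2"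
        have "?S (decay p) \<le> \<beta> + (r - r') / 2"
          using p by (intro sup_cost_least) simp
        moreover have "?T (decay p) \<le> \<alpha> + (r - r') / 2"
        proof (rule sup_cost_least)
          show "-1 * decay p t \<le> \<alpha> + (r - r') / 2" if "0 \<le> t" for t using p[OF that] by linarith
        qed
        ultimately have "?\<Phi> (decay p) < r" using ab(3) r by (simp add: field_simps)
        thus "pairing (decay p) ?f \<le> B" by (rule B)
      qed (use r ab in \<open>auto intro: comb_continuous combK_integrable\<close>)
      thus ?thesis
        using set_integral_add(2)[OF set_integrable_mult_right[of \<beta>, OF parts(1)[of a]]
            set_integrable_mult_right[of \<alpha>, OF neg_int]] by simp
    qed
    have min_eq: "(LINT t:{0..}|lborel. min (?f t) 0) = - ?n"
    proof -
      have "(LINT t:{0..}|lborel. min (?f t) 0) = (LINT t:{0..}|lborel. - max (- ?f t) 0)"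
        by (rule set_lebesgue_integral_cong) (auto simp: min_def max_def)
      thus ?thesis using set_integral_uminus[OF neg_int] by simp
    qed
    define \<mu> where "\<mu> = 2 * max ?p ?n"
    have "norm1 ?f = ?p + ?n"
      unfolding norm1_def set_integral_add(2)[OF parts(1) neg_int, symmetric]
      by (rule set_lebesgue_integral_cong) (auto simp: max_def)
    hence \<mu>: "\<mu> > 0" using norm1_pos[OF t0] by (auto simp: \<mu>_def max_def)
    have pn: "?p \<le> \<mu> / 2" "?n \<le> \<mu> / 2" by (auto simp: \<mu>_def)
    have "max (y / \<mu>) 0 = max y 0 / \<mu>" "min (y / \<mu>) 0 = min y 0 / \<mu>" for y
      using \<mu> by (auto simp: max_def min_def field_simps)
    hence scaled: "(LINT t:{0..}|lborel. max (?f t / \<mu>) 0) = ?p / \<mu>"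
      "(LINT t:{0..}|lborel. min (?f t / \<mu>) 0) = - ?n / \<mu>"
      by (simp_all only: set_integral_divide_zero min_eq)
    have "?p / \<mu> \<le> 1/2" "- 1/2 \<le> - ?n / \<mu>" using pn \<mu> by (simp_all add: field_simps)
    hence "(\<lambda>t. ?f t / \<mu>) \<in> ?C" unfolding mem_Collect_eq scaled by (rule conjI)
    moreover have "r' * \<mu> \<le> B"
      using key[of 0 "2 * r'"] key[of "2 * r'" 0] r(1) by (auto simp: \<mu>_def max_def)
    ultimately show "\<exists>\<mu>>0. (\<lambda>t. ?f t / \<mu>) \<in> ?C \<and> r' * \<mu> + (\<Sum>k\<in>K. a k * 0) \<le> B"
      using \<mu> by auto
  next
    fix e a assume e: "e \<in> F" and a: "comb K a \<in> ?C"
    obtain B where B: "\<And>t. 0 \<le> t \<Longrightarrow> \<bar>e t\<bar> \<le> B" using C0_bounded[OF F[OF e]] by blast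
    have cont: "continuous_on {0..} e" and lim: "(e \<longlongrightarrow> 0) at_top" using F[OF e] by (auto simp: C0_def)
    have S: "e t \<le> ?S e" and T: "- e t \<le> ?T e" if "0 \<le> t" for t
      using sup_cost_upper[OF ccS, of e B t] sup_cost_upper[OF ccT, of e B t] B that by auto
    have ev: "eventually (\<lambda>t::real. 0 \<le> t) at_top" by (rule eventually_ge_at_top)
    have S0: "0 \<le> ?S e"
      by (rule tendsto_upperbound[OF lim eventually_mono[OF ev S]]) auto
    have T0: "0 \<le> ?T e"
      using tendsto_minus[OF lim] by (intro tendsto_upperbound[OF _ eventually_mono[OF ev T]]) auto
    have "pairing e (comb K a) = (\<Sum>k\<in>K. a k * pairing e (mode k))"
      by (rule pairing_bounded_comb[OF cont]) (rule B)
    hence "(\<Sum>k\<in>K. a k * c k) = pairing e (comb K a)"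
      using F_moments[OF e] by simp
    also have "\<dots> \<le> (LINT t:{0..}|lborel. ?S e * max (comb K a t) 0 - ?T e * min (comb K a t) 0)"
      unfolding pairing_def
    proof (rule set_integral_mono_halfline)
      show "set_integrable lborel {0..} (\<lambda>t. e t * comb K a t)"
        by (rule set_integrable_bounded_mult[OF cont comb_continuous combK_integrable]) (rule B)
      show "set_integrable lborel {0..} (\<lambda>t. ?S e * max (comb K a t) 0 - ?T e * min (comb K a t) 0)"
        by (intro set_integral_diff(1) set_integrable_mult_right parts)
      show "e t * comb K a t \<le> ?S e * max (comb K a t) 0 - ?T e * min (comb K a t) 0" if "0 \<le> t" for t
      proof (cases "0 \<le> comb K a t")
        case True
        thus ?thesis using mult_right_mono[OF S[OF that] True] by simp
      next
        case False
        hence "comb K a t \<le> 0" by simp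
        from mult_right_mono_neg[OF T[OF that] this] False show ?thesis by simp
      qed
    qed
    also have "\<dots> = ?S e * (LINT t:{0..}|lborel. max (comb K a t) 0) - ?T e * (LINT t:{0..}|lborel. min (comb K a t) 0)"
      using set_integral_diff(2)[OF set_integrable_mult_right[of "?S e", OF parts(1)[of a]]
        set_integrable_mult_right[of "?T e", OF parts(2)[of a]]] by simp
    also have "\<dots> \<le> ?S e * (1/2) - ?T e * (- 1/2)"
      using a S0 T0 by (intro diff_mono mult_left_mono) auto
    finally show "(\<Sum>k\<in>K. a k * (c k - 0)) \<le> ?\<Phi> e" by simp
  next
    show "?\<Phi> (\<lambda>t. (1 - s) * decay p t + s * decay q t) \<le> (1 - s) * ?\<Phi> (decay p) + s * ?\<Phi> (decay q)"
      if s: "0 \<le> s" "s \<le> 1" for p q s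
      using sup_cost_convex[OF ccS s, of p q] sup_cost_convex[OF ccT s, of p q]
      by (simp only: distrib_left)
    show "?\<Phi> (\<lambda>t. decay p t + b * decay q t) \<le> ?\<Phi> (decay p) + \<bar>b\<bar> * sup_norm (decay q)" for p q b
    proof -
      have "1/2 * (y + z) \<le> 1/2 * (y' + z') + u" if "y \<le> y' + u" "z \<le> z' + u" for y z y' z' u :: real
        using that by simp
      from this[OF sup_cost_lipschitz[OF ccS, of p b q] sup_cost_lipschitz[OF ccT, of p b q]]
      show ?thesis .
    qed
    show "?\<Phi> (\<lambda>_. 0) \<le> 0" 
      by (intro mult_nonneg_nonpos add_nonpos_nonpos sup_cost_0 ccS ccT) simp
    show "decay p \<in> F" if "\<And>k. k \<in> K \<Longrightarrow> pairing (decay p) (mode k) = c k" for p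
      using that by (rule moments)
  qed (auto simp: obj)
  moreover have "?\<Phi> e = 1/2 * ((SUP t\<in>{0..}. e t) - (INF t\<in>{0..}. e t))" for e
    by (simp add: sup_cost_def Inf_real_def image_image)
  ultimately show ?thesis by simp
qed

end

lemma mode_in_exp_trig_span:
  assumes "finite R" "fst k \<in> R"
  shows "mode k \<in> exp_trig_span R"
proof -
  have "mode k = comb (modes R) (\<lambda>i. if i = k then 1 else 0)"
  proof
    fix t
    have "comb (modes R) (\<lambda>i. if i = k then 1 else 0) t
      = (\<Sum>i\<in>modes R. if i = k then mode i t else 0)"
      unfolding comb_def by (rule sum.cong) auto
    also have "\<dots> = (if k \<in> modes R then mode k t else 0)" using assms(1) by simp
    also have "\<dots> = mode k t" using assms(2) by (auto simp: modes_def mode_def)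
    finally show "mode k t = comb (modes R) (\<lambda>i. if i = k then 1 else 0) t" ..
  qed
  thus ?thesis unfolding exp_trig_span_eq[OF assms(1)] by blast
qed

text \<open>If both members of a conjugate pair are retained, uniqueness of the representative makes
  them equal.\<close>
lemma conj_representatives_cnj:
  "conj_representatives Z R \<Longrightarrow> r \<in> R \<Longrightarrow> cnj r \<in> R \<Longrightarrow> cnj r = r"
  unfolding conj_representatives_def by (metis complex_cnj_cnj subsetD)

lemma conj_representatives_exists:
  "conj_representatives Z R \<Longrightarrow> s \<in> Z \<Longrightarrow> \<exists>r\<in>R. r = s \<or> r = cnj s"
  unfolding conj_representatives_def by blast

lemma rhp_zeros_cnj: "s \<in> rhp_zeros G \<Longrightarrow> cnj s \<in> rhp_zeros G"
  by (simp add: rhp_zeros_def rnum_def poly_cpoly_cnj)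

lemma rhp_poles_cnj: "s \<in> rhp_poles G \<Longrightarrow> cnj s \<in> rhp_poles G"
  by (simp add: rhp_poles_def rden_def poly_cpoly_cnj)

lemma finite_rhp_zeros: "G \<noteq> 0 \<Longrightarrow> finite (rhp_zeros G)"
  unfolding rhp_zeros_def by (rule finite_subset[OF _ poly_roots_finite[of "rnum G"]]) auto

lemma finite_rhp_poles: "finite (rhp_poles G)"
  unfolding rhp_poles_def by (rule finite_subset[OF _ poly_roots_finite[of "rden G"]]) auto

locale tracking_problem_modes = tracking_problem +
  fixes Zr Pr Vr :: "complex set"
  assumes Zr: "conj_representatives (rhp_zeros P) Zr"
    and Pr: "conj_representatives (rhp_poles P) Pr"
    and Vr: "conj_representatives (rhp_zeros w_hat) Vr"
begin

lemma reps_subset: "Zr \<subseteq> rhp_zeros P" "Pr \<subseteq> rhp_poles P" "Vr \<subseteq> rhp_zeros w_hat"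
  using Zr Pr Vr by (auto simp: conj_representatives_def)

lemma reps_finite: "finite Zr" "finite Pr" "finite Vr"
  using reps_subset finite_rhp_zeros finite_rhp_poles nonzero by (meson finite_subset)+

lemma reps_disjoint: "Zr \<inter> Pr = {}" "Zr \<inter> Vr = {}" "Pr \<inter> Vr = {}" "Zr \<inter> (Pr \<union> Vr) = {}"
  using reps_subset distinct by blast+

sublocale mode_family "Zr \<union> (Pr \<union> Vr)"
proof
  show "finite (Zr \<union> (Pr \<union> Vr))" using reps_finite by simp
  show "0 < Re z" if "z \<in> Zr \<union> (Pr \<union> Vr)" for z
    using that reps_subset node_Re[of z] unfolding nodes_def by blast
  show "conj_free (Zr \<union> (Pr \<union> Vr))"
    unfolding conj_free_def
  proof (intro ballI impI)
    fix z assume z: "z \<in> Zr \<union> (Pr \<union> Vr)" "cnj z \<in> Zr \<union> (Pr \<union> Vr)"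
    consider "z \<in> Zr" | "z \<in> Pr" | "z \<in> Vr" using z(1) by blast
    thus "cnj z = z"
    proof cases
      case 1
      hence "cnj z \<in> rhp_zeros P" using reps_subset(1) rhp_zeros_cnj by blast
      hence "cnj z \<in> Zr" using z(2) reps_subset distinct by auto
      with 1 show ?thesis by (rule conj_representatives_cnj[OF Zr])
    next
      case 2
      hence "cnj z \<in> rhp_poles P" using reps_subset(2) rhp_poles_cnj by blast
      hence "cnj z \<in> Pr" using z(2) reps_subset distinct by auto
      with 2 show ?thesis by (rule conj_representatives_cnj[OF Pr])
    next
      case 3
      hence "cnj z \<in> rhp_zeros w_hat" using reps_subset(3) rhp_zeros_cnj by blast
      hence "cnj z \<in> Vr" using z(2) reps_subset distinct by auto
      with 3 show ?thesis by (rule conj_representatives_cnj[OF Vr])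
    qed
  qed
qed

text \<open>The prescribed pairing with each mode: the real form of \<open>target\<close>.\<close>
definition moment :: "complex \<times> bool \<Rightarrow> real" where
  "moment k = (if fst k \<in> Zr then pairing (mode k) w else 0)"

lemma kernel_integrable_w:
  assumes "z \<in> Zr"
  shows "set_integrable lborel {0..} (\<lambda>t. exp (- (z * complex_of_real t)) * complex_of_real (w t))"
  using assms reps_subset by (intro set_integrable_laplace_kernel[OF w_cont w_integrable]) auto

lemma moments_iff_laplace_target:
  assumes "set_integrable lborel {0..} (\<lambda>t. exp (- (z * complex_of_real t)) * complex_of_real (e t))"
    and z: "z \<in> Zr \<union> (Pr \<union> Vr)"
  shows "(\<forall>b. (z, b) \<in> K \<longrightarrow> pairing e (mode (z, b)) = moment (z, b)) \<longleftrightarrow> laplace e z = target z"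
proof (cases "z \<in> Zr")
  case True
  have "laplace w z = target z"
    using True reps_subset w_hat_at_zero(2)[of z] by (auto simp: target_def)
  thus ?thesis
    using mode_moments_iff_laplace[OF assms(1) kernel_integrable_w[OF True] z] True
    by (simp add: moment_def pairing_commute[of e])
next
  case False
  have "laplace (\<lambda>_. 0) z = target z"
    using False z reps_subset distinct by (auto simp: target_def laplace_def)
  moreover have "pairing (mode k) (\<lambda>_. 0) = 0" for k by (simp add: pairing_def)
  ultimately show ?thesis
    using mode_moments_iff_laplace[OF assms(1) _ z, of "\<lambda>_. 0"] False
    by (simp add: moment_def pairing_commute[of e] set_integrable_def)
qed

lemma error_signal_moments:
  assumes e: "e \<in> error_signals w_hat n d v" and k: "k \<in> K"
  shows "pairing e (mode k) = moment k"
proof -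
  obtain z b where kz: "k = (z, b)" "z \<in> Zr \<union> (Pr \<union> Vr)"
    using k by (auto simp: modes_def)
  hence node: "z \<in> nodes" using reps_subset by (auto simp: nodes_def)
  have "e \<in> C0" using e by (simp add: error_signals_def)
  hence "set_integrable lborel {0..} (\<lambda>t. exp (- (z * complex_of_real t)) * complex_of_real (e t))"
    using C0_exp_weight_integrable[OF _ node_Re[OF node]]
    by (intro set_integrable_laplace_kernel[of e "Re z" z]) (auto simp: C0_def)
  from moments_iff_laplace_target[OF this kz(2)] error_signal_laplace[OF e node]
  show ?thesis using k kz(1) by blast
qed

lemma decay_error_signal:
  assumes "\<And>k. k \<in> K \<Longrightarrow> pairing (decay p) (mode k) = moment k"
  shows "decay p \<in> error_signals w_hat n d v"
proof (rule decay_is_error_signal)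
  obtain A where A: "\<And>s. 0 \<le> Re s \<Longrightarrow> laplace (decay p) s = reval A s"
    and int: "\<And>s. 0 \<le> Re s \<Longrightarrow> set_integrable lborel {0..}
      (\<lambda>t. exp (- (s * complex_of_real t)) * complex_of_real (decay p t))"
    using decay_rational_laplace[of p] by metis
  have rep: "laplace (decay p) r = target r" if r: "r \<in> Zr \<union> (Pr \<union> Vr)" for r
  proof -
    have "0 \<le> Re r" using Re_pos[OF r] by simp
    from moments_iff_laplace_target[OF int[OF this] r] assms show ?thesis by blast
  qed
  fix s assume s: "s \<in> nodes"
  hence "\<exists>r\<in>Zr \<union> (Pr \<union> Vr). r = s \<or> r = cnj s"
    using conj_representatives_exists[OF Zr, of s] conj_representatives_exists[OF Pr, of s]
      conj_representatives_exists[OF Vr, of s] unfolding nodes_def by blast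
  then obtain r where r: "r \<in> Zr \<union> (Pr \<union> Vr)" "r = s \<or> r = cnj s" by blast
  show "laplace (decay p) s = target s"
  proof (cases "r = s")
    case False
    hence s_eq: "s = cnj r" using r(2) by simp
    have zero: "r \<in> rhp_zeros P \<longleftrightarrow> s \<in> rhp_zeros P"
      using rhp_zeros_cnj[of r P] rhp_zeros_cnj[of s P] s_eq by auto
    have "laplace (decay p) s = cnj (laplace (decay p) r)"
      using A[of s] A[of r] node_Re[OF s] by (simp add: s_eq reval_cnj)
    also have "\<dots> = target s"
      unfolding rep[OF r(1)] using zero by (simp add: target_def s_eq reval_cnj)
    finally show ?thesis .
  qed (use rep[OF r(1)] in simp)
qed

end

text \<open>In the last equality of the theorem the separating functions are nonnegative, while the dual
  variable is taken nonpositive.\<close>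
lemma is_maximum_reflect:
  assumes "is_maximum m g A" "\<And>f. f \<in> A \<Longrightarrow> obj (\<lambda>t. - f t) = g f"
    and "B = (\<lambda>f t. - f t) ` A"
  shows "is_maximum m obj B"
  using assms unfolding is_maximum_def by auto

theorem mainTheorem2:
  fixes P w_hat n d x v :: ratfun
    and w :: "real \<Rightarrow> real"
    and \<theta>\<^sub>p \<theta>\<^sub>w :: nat
    and Z_ret P_ret V_ret :: "complex set"
    and F U V W :: "(real \<Rightarrow> real) set"
  assumes P_proper: "proper P"
    and P_order: "zero_order_at_infinity P \<theta>\<^sub>p"
    and w_cont: "continuous_on {0..} w"
    and w_laplace: "has_laplace w w_hat"
    and w_order: "zero_order_at_infinity w_hat \<theta>\<^sub>w" "\<theta>\<^sub>w \<ge> 1"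
    and off_axis: "\<forall>s \<in> rhp_zeros P \<union> rhp_poles P \<union> rhp_zeros w_hat. Re s \<noteq> 0"
    and simple_zeros: "\<forall>s \<in> rhp_zeros P. order s (rnum P) = 1"
    and simple_poles: "\<forall>s \<in> rhp_poles P. order s (rden P) = 1"
    and simple_w: "\<forall>s \<in> rhp_zeros w_hat. order s (rnum w_hat) = 1"
    and distinct: "rhp_zeros P \<inter> rhp_poles P = {}"
      "rhp_zeros P \<inter> rhp_zeros w_hat = {}" "rhp_poles P \<inter> rhp_zeros w_hat = {}"
    and factorization: "coprime_factorization P n d x v"
    and F: "F = error_signals w_hat n d v"
    and Z_ret: "conj_representatives (rhp_zeros P) Z_ret"
    and P_ret: "conj_representatives (rhp_poles P) P_ret"
    and V_ret: "conj_representatives (rhp_zeros w_hat) V_ret"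
    and U: "U = exp_trig_span Z_ret"
    and V: "V = exp_trig_span P_ret"
    and W: "W = exp_trig_span V_ret"
    and pairing_U: "\<forall>u \<in> U. pairing_defined u w"
    and no_common_pole: "rhp_poles P \<inter> rhp_poles w_hat = {}"
    and orders: "\<theta>\<^sub>w + \<theta>\<^sub>p = 1"
  shows
    "is_maximum (INF e\<in>F. ereal (SUP t\<in>{0..}. \<bar>e t\<bar>))
       (\<lambda>es. pairing (projector U (fun_sum V W) es) w)
       {es \<in> fun_sum U (fun_sum V W). norm1 es \<le> 1} \<and>
     is_maximum (INF e\<in>F. ereal (SUP t\<in>{0..}. max (e t) 0))
       (\<lambda>es. pairing (projector U (fun_sum V W) es) w)
       {es \<in> fun_sum U (fun_sum V W). (\<forall>t\<ge>0. es t \<ge> 0) \<and> norm1 es \<le> 1} \<and>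
     is_maximum (INF e\<in>F. ereal (SUP t\<in>{0..}. max (- e t) 0))
       (\<lambda>es. pairing (projector U (fun_sum V W) es) w)
       {es \<in> fun_sum U (fun_sum V W). (\<forall>t\<ge>0. es t \<le> 0) \<and> norm1 es \<le> 1} \<and>
     is_maximum (INF e\<in>F. ereal (1/2 * ((SUP t\<in>{0..}. e t) - (INF t\<in>{0..}. e t))))
       (\<lambda>es. pairing (projector U (fun_sum V W) es) w)
       {es \<in> fun_sum U (fun_sum V W).
          (LINT t:{0..}|lborel. max (es t) 0) \<le> 1/2 \<and> (LINT t:{0..}|lborel. min (es t) 0) \<ge> - 1/2} \<and>
     ((\<forall>t\<ge>0. w t \<ge> 0) \<and> (\<forall>u \<in> fun_sum V W. pairing_defined u w) \<longrightarrow>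
     is_maximum (INF e\<in>F. ereal (SUP t\<in>{0..}. max (e t - w t) 0))
       (\<lambda>es. pairing (projector (fun_sum V W) U es) w)
       {es \<in> fun_sum U (fun_sum V W). (\<forall>t\<ge>0. es t \<le> 0) \<and> norm1 es \<le> 1})"
proof -
  have \<theta>: "\<theta>\<^sub>w = 1" "\<theta>\<^sub>p = 0" using orders w_order(2) by auto
  have Z_sub: "Z_ret \<subseteq> rhp_zeros P" using Z_ret by (simp add: conj_representatives_def)
  have P_nz: "P \<noteq> 0" using P_order by (simp add: zero_order_at_infinity_def)
  have Z_fin: "finite Z_ret" using finite_subset[OF Z_sub finite_rhp_zeros[OF P_nz]] .
  have mode_in_U: "mode k \<in> U" if "fst k \<in> Z_ret" for k
    unfolding U by (rule mode_in_exp_trig_span[where k = k, OF Z_fin that])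
  have w_rep: "set_integrable lborel {0..} (\<lambda>t. exp (- Re z * t) * w t)" if "z \<in> Z_ret" for z
    using pairing_U mode_in_U that by (intro exp_weight_integrable w_cont) auto
  have w_int: "set_integrable lborel {0..} (\<lambda>t. exp (- Re z * t) * w t)" if z: "z \<in> rhp_zeros P" for z
  proof -
    obtain r where "r \<in> Z_ret" "r = z \<or> r = cnj z"
      using conj_representatives_exists[OF Z_ret z] by blast
    thus ?thesis using w_rep[of r] by auto
  qed
  interpret tracking_problem_modes P w_hat n d x v w Z_ret P_ret V_ret
  proof (unfold_locales)
  qed (use assms \<theta> w_int in auto)
  let ?F = "error_signals w_hat n d v"
  have VW: "fun_sum V W = exp_trig_span (P_ret \<union> V_ret)"
    unfolding V W by (rule fun_sum_exp_trig_span[OF reps_finite(2,3) reps_disjoint(3)])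
  have PV_fin: "finite (P_ret \<union> V_ret)" using reps_finite by simp
  have D: "fun_sum U (fun_sum V W) = range (comb K)"
    unfolding VW U fun_sum_exp_trig_span[OF reps_finite(1) PV_fin reps_disjoint(4)]
    by (rule exp_trig_span_eq) (use reps_finite in simp)
  have proj_U: "projector U (fun_sum V W) (comb K a) = comb (modes Z_ret) a" for a
    unfolding VW U by (rule projector_comb[OF reps_finite(1) PV_fin reps_disjoint(4) conj_free_R])
  have proj_VW: "projector (fun_sum V W) U (comb K a) = comb (modes (P_ret \<union> V_ret)) a" for a
    unfolding VW U
    using projector_comb[OF PV_fin reps_finite(1), of a] reps_disjoint(4) conj_free_R
    by (simp add: Un_commute Int_commute)
  have split_K: "(\<Sum>k\<in>K. g k) = (\<Sum>k\<in>modes Z_ret. g k) + (\<Sum>k\<in>modes (P_ret \<union> V_ret). g k)"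
    for g :: "complex \<times> bool \<Rightarrow> real"
    unfolding modes_Un[of Z_ret] using reps_finite reps_disjoint(4)
    by (intro sum.union_disjoint) (auto simp: modes_disjoint)
  have moment_Z: "moment k = pairing (mode k) w" if "k \<in> modes Z_ret" for k
    using that by (auto simp: moment_def modes_def)
  have moment_PV: "moment k = 0" if "k \<in> modes (P_ret \<union> V_ret)" for k
    using that reps_disjoint(4) by (auto simp: moment_def modes_def)
  have mode_defined: "pairing_defined (mode k) w" if "k \<in> modes Z_ret" for k
    using that pairing_U mode_in_U by (auto simp: modes_def)
  have obj: "pairing (projector U (fun_sum V W) (comb K a)) w = (\<Sum>k\<in>K. a k * moment k)" for a
    unfolding proj_U split_K using pairing_comb[OF _ mode_defined, of "modes Z_ret" a] reps_finite
    by (simp add: moment_Z moment_PV)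
  have F_C0: "e \<in> C0" if "e \<in> ?F" for e using that by (simp add: error_signals_def)
  note facts = F_C0 error_signal_moments decay_error_signal
  have zero: "continuous_on {0..} (\<lambda>_. 0 :: real)" "\<And>k. k \<in> K \<Longrightarrow> pairing_defined (mode k) (\<lambda>_. 0)"
    "\<And>k. pairing (mode k) (\<lambda>_. 0) = 0"
    by (auto simp: pairing_defined_def set_integrable_def pairing_def)
  have one: "is_maximum (INF e\<in>?F. ereal (SUP t\<in>{0..}. \<bar>e t\<bar>))
      (\<lambda>es. pairing (projector U (fun_sum V W) es) w) {f \<in> range (comb K). norm1 f \<le> 1}"
    by (rule sup_norm_minimax[OF facts obj])
  have two: "is_maximum (INF e\<in>?F. ereal (SUP t\<in>{0..}. max (1 * e t - 0) 0))
      (\<lambda>es. pairing (projector U (fun_sum V W) es) w)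
      {f \<in> range (comb K). (\<forall>t\<ge>0. 0 \<le> 1 * f t) \<and> norm1 f \<le> 1}"
    by (rule one_sided_minimax[OF _ zero(1) _ zero(2) facts]) (auto simp: obj zero(3))
  have three: "is_maximum (INF e\<in>?F. ereal (SUP t\<in>{0..}. max ((-1) * e t - 0) 0))
      (\<lambda>es. pairing (projector U (fun_sum V W) es) w)
      {f \<in> range (comb K). (\<forall>t\<ge>0. 0 \<le> (-1) * f t) \<and> norm1 f \<le> 1}"
    by (rule one_sided_minimax[OF _ zero(1) _ zero(2) facts]) (auto simp: obj zero(3))
  have four: "is_maximum (INF e\<in>?F. ereal (1/2 * ((SUP t\<in>{0..}. e t) - (INF t\<in>{0..}. e t))))
      (\<lambda>es. pairing (projector U (fun_sum V W) es) w)
      {f \<in> range (comb K). (LINT t:{0..}|lborel. max (f t) 0) \<le> 1/2 \<and>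
        (LINT t:{0..}|lborel. min (f t) 0) \<ge> - 1/2}"
    by (rule spread_minimax[OF facts obj])
  have five: "is_maximum (INF e\<in>?F. ereal (SUP t\<in>{0..}. max (e t - w t) 0))
      (\<lambda>es. pairing (projector (fun_sum V W) U es) w)
      {f \<in> range (comb K). (\<forall>t\<ge>0. f t \<le> 0) \<and> norm1 f \<le> 1}"
    if w_nonneg: "\<forall>t\<ge>0. w t \<ge> 0" and VW_defined: "\<forall>u\<in>fun_sum V W. pairing_defined u w"
  proof -
    have PV_defined: "pairing_defined (mode k) w" if k: "k \<in> modes (P_ret \<union> V_ret)" for k
    proof -
      have "mode k \<in> fun_sum V W"
        unfolding VW using k by (intro mode_in_exp_trig_span PV_fin) (auto simp: modes_def)
      thus ?thesis using VW_defined by blast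
    qed
    have K_defined: "pairing_defined (mode k) w" if "k \<in> K" for k
      using that mode_defined PV_defined unfolding modes_Un[of Z_ret] by blast
    have obj5: "pairing (projector (fun_sum V W) U (\<lambda>t. - comb K a t)) w
        = (\<Sum>k\<in>K. a k * (moment k - 1 * pairing (mode k) w))" for a
    proof -
      have neg: "(\<lambda>t. - comb K a t) = comb K (\<lambda>k. - a k)" by (simp add: comb_def fun_eq_iff sum_negf)
      show ?thesis
        unfolding neg proj_VW split_K using pairing_comb[OF _ PV_defined, of "modes (P_ret \<union> V_ret)" "\<lambda>k. - a k"] PV_fin
        by (simp add: moment_Z moment_PV)
    qed
    have "is_maximum (INF e\<in>?F. ereal (SUP t\<in>{0..}. max (1 * e t - w t) 0))
        (\<lambda>f. pairing (projector (fun_sum V W) U (\<lambda>t. - f t)) w)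
        {f \<in> range (comb K). (\<forall>t\<ge>0. 0 \<le> 1 * f t) \<and> norm1 f \<le> 1}"
      by (rule one_sided_minimax[OF _ w_cont _ K_defined facts obj5]) (use w_nonneg in auto)
    hence max5: "is_maximum (INF e\<in>?F. ereal (SUP t\<in>{0..}. max (e t - w t) 0))
        (\<lambda>f. pairing (projector (fun_sum V W) U (\<lambda>t. - f t)) w)
        {f \<in> range (comb K). (\<forall>t\<ge>0. 0 \<le> f t) \<and> norm1 f \<le> 1}" by simp
    show ?thesis
    proof (rule is_maximum_reflect[OF max5 refl])
      have neg: "(\<lambda>t. - f t) \<in> range (comb K)" if f: "f \<in> range (comb K)" for f
      proof -
        obtain a where "f = comb K a" using f by blast
        hence "(\<lambda>t. - f t) = comb K (\<lambda>k. - a k)" by (simp add: comb_def fun_eq_iff sum_negf)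
        thus ?thesis by blast
      qed
      show "{f \<in> range (comb K). (\<forall>t\<ge>0. f t \<le> 0) \<and> norm1 f \<le> 1}
          = (\<lambda>f t. - f t) ` {f \<in> range (comb K). (\<forall>t\<ge>0. 0 \<le> f t) \<and> norm1 f \<le> 1}" (is "?A = ?m ` ?B")
      proof (intro equalityI subsetI)
        fix f assume "f \<in> ?A"
        hence "?m f \<in> ?B" using neg[of f] by (simp add: norm1_def)
        thus "f \<in> ?m ` ?B" by (intro image_eqI[of _ _ "?m f"]) auto
      next
        fix f assume "f \<in> ?m ` ?B"
        then obtain g where "g \<in> ?B" "f = ?m g" by blast
        thus "f \<in> ?A" using neg[of g] by (simp add: norm1_def)
      qed
    qed
  qed
  show ?thesis
    unfolding F D using one two three four five by simp
qed

end
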